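(* Let $(G_i)_{i\ge1}$ be a sequence of graphs, each $G_i$ having two marked pendant vertices $u_i,v_i$, and let $G^\circ_n$ be the bar-ring formed by $G_1,\dots,G_n$ in this order. Suppose that (i) every $G_i$ is connected, and there are infinitely many $i$ such that $\gamma_{\max}(G_i)>\gamma_{\min}(G_i)$; (ii) there is a constant $M$ such that every $G_i$ has at most $M$ edges. Then the embedding distributions of $(G^\circ_n)_{n\ge1}$ are asymptotically normal; that is, both sequences of random variables $(\gamma_{G^\circ_n})_{n\ge1}$ and $(\gamma^{E}_{G^\circ_n})_{n\ge1}$ are asymptotically normal.
   Context: Graphs are finite, with loops and multiple edges allowed. A pendant vertex is a vertex of degree 1. Bar-ring: given graphs $G_1,\dots,G_n$, each $G_i$ having two marked pendant vertices $u_i,v_i$, their bar-ring is obtained from the disjoint union of $G_1,\dots,G_n$ by adding, for every $1\le i\le n$, an edge between $v_i$ and $u_{j}$ where $j\equiv i+1\pmod n$. Orientable cellular embeddings of a connected graph $G$ are counted as rotation systems, i.e. a choice of cyclic order of the edge-ends around each vertex. General cellular embeddings of $G$ are described by signed rotation systems, i.e. a rotation system together with a choice, for each edge, of being twisted or untwisted, counted up to reversing the local orientation at vertices (a uniformly random signed rotation system gives the same Euler-genus distribution). If $f$ is the number of faces, the Euler-genus is $2-|V|+|E|-f$; for an orientable embedding the genus is half of the Euler-genus. $\gamma_{\min}(G),\gamma_{\max}(G)$ are the minimum and maximum genus over all orientable embeddings of $G$. $\gamma_G$ is the genus of a uniformly random orientable embedding of $G$, and $\gamma^{E}_G$ is the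 Euler-genus of a uniformly random general embedding of $G$. A sequence of real random variables $(X_n)$ is asymptotically normal if $(X_n-\mathbb{E}X_n)/\sqrt{\mathrm{Var}\,X_n}$ converges in distribution to $\mathcal N(0,1)$. *)

theory Defs
  imports
    "HOL-Probability.Probability"
    "HOL-Combinatorics.Orbits"
    "Graph_Theory.Digraph_Component"
begin

text \<open>
  A finite undirected graph, loops and multiple edges allowed, is a \<^const>\<open>fin_digraph\<close> whose arcs
  are read as undirected edges: the direction of an arc is only a reference orientation that names
  its two ends. Every edge \<open>e\<close> thus has the two edge-ends \<open>(e, False)\<close> (at the tail) and \<open>(e, True)\<close>
  (at the head), also when \<open>e\<close> is a loop.
\<close>

type_synonym 'e edge_end = "'e \<times> bool"

definition edge_ends :: "('v, 'e) pre_digraph \<Rightarrow> 'e edge_end set" where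
  "edge_ends G = arcs G \<times> UNIV"

definition end_vertex :: "('v, 'e) pre_digraph \<Rightarrow> 'e edge_end \<Rightarrow> 'v" where
  "end_vertex G h = (if snd h then head G (fst h) else tail G (fst h))"

definition opposite :: "'e edge_end \<Rightarrow> 'e edge_end" where
  "opposite h = (fst h, \<not> snd h)"

definition ends_at :: "('v, 'e) pre_digraph \<Rightarrow> 'v \<Rightarrow> 'e edge_end set" where
  "ends_at G x = {h \<in> edge_ends G. end_vertex G h = x}"

definition pendant :: "('v, 'e) pre_digraph \<Rightarrow> 'v \<Rightarrow> bool" where
  "pendant G x \<longleftrightarrow> x \<in> verts G \<and> card (ends_at G x) = 1"


definition bar_ring ::
  "(nat \<Rightarrow> ('v, 'e) pre_digraph) \<Rightarrow> (nat \<Rightarrow> 'v) \<Rightarrow> (nat \<Rightarrow> 'v) \<Rightarrow> nat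
    \<Rightarrow> (nat \<times> 'v, (nat \<times> 'e) + nat) pre_digraph" where
  "bar_ring G u v n =
    \<lparr> verts = (SIGMA i:{1..n}. verts (G i)),
      arcs = (SIGMA i:{1..n}. arcs (G i)) <+> {1..n},
      tail = (\<lambda>a. case a of Inl (i, e) \<Rightarrow> (i, tail (G i) e) | Inr i \<Rightarrow> (i, v i)),
      head = (\<lambda>a. case a of Inl (i, e) \<Rightarrow> (i, head (G i) e)
                          | Inr i \<Rightarrow> (let j = i mod n + 1 in (j, u j))) \<rparr>"


text \<open>
  The cyclic orders around all the vertices are collected in one permutation of the edge-ends, which
  sends an edge-end to the next one at the same vertex.
\<close>

definition rotation_systems :: "('v, 'e) pre_digraph \<Rightarrow> ('e edge_end \<Rightarrow> 'e edge_end) set" where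
  "rotation_systems G = {\<sigma>. \<sigma> permutes edge_ends G \<and>
     (\<forall>x\<in>verts G. ends_at G x \<noteq> {} \<longrightarrow> cyclic_on \<sigma> (ends_at G x))}"

text \<open>
  Face tracing only sees faces that have an edge on their boundary; in addition, an isolated vertex
  (in a connected graph: a graph with a single vertex and no edge, embedded in the sphere)
  contributes one face.
\<close>

definition isolated_verts :: "('v, 'e) pre_digraph \<Rightarrow> 'v set" where
  "isolated_verts G = {x \<in> verts G. ends_at G x = {}}"

definition num_faces :: "('v, 'e) pre_digraph \<Rightarrow> ('e edge_end \<Rightarrow> 'e edge_end) \<Rightarrow> nat" where
  "num_faces G \<sigma> = card (orbit (\<sigma> \<circ> opposite) ` edge_ends G) + card (isolated_verts G)"

definition euler_genus_of_faces :: "('v, 'e) pre_digraph \<Rightarrow> nat \<Rightarrow> int" where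
  "euler_genus_of_faces G f = 2 - int (card (verts G)) + int (card (arcs G)) - int f"

definition genus :: "('v, 'e) pre_digraph \<Rightarrow> ('e edge_end \<Rightarrow> 'e edge_end) \<Rightarrow> real" where
  "genus G \<sigma> = real_of_int (euler_genus_of_faces G (num_faces G \<sigma>)) / 2"

definition min_genus :: "('v, 'e) pre_digraph \<Rightarrow> real" where
  "min_genus G = Min (genus G ` rotation_systems G)"

definition max_genus :: "('v, 'e) pre_digraph \<Rightarrow> real" where
  "max_genus G = Max (genus G ` rotation_systems G)"


text \<open>The second component of a signed rotation system is the set of twisted edges.\<close>

type_synonym 'e signed_rotation = "('e edge_end \<Rightarrow> 'e edge_end) \<times> 'e set"

definition signed_rotation_systems :: "('v, 'e) pre_digraph \<Rightarrow> 'e signed_rotation set" where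
  "signed_rotation_systems G = rotation_systems G \<times> Pow (arcs G)"

text \<open>
  A state \<open>(h, s)\<close> of the face tracer is about to leave the vertex of \<open>h\<close> along \<open>h\<close>; the flag \<open>s\<close>
  says whether the tracer currently agrees with the local orientation at that vertex. Walking along
  a twisted edge flips the flag, and a tracer that disagrees with the local orientation turns
  according to the inverse rotation.
\<close>

definition face_step :: "'e signed_rotation \<Rightarrow> 'e edge_end \<times> bool \<Rightarrow> 'e edge_end \<times> bool" where
  "face_step = (\<lambda>(\<sigma>, T) (h, s).
     let s' = (s \<noteq> (fst h \<in> T)) in ((if s' then \<sigma> else inv \<sigma>) (opposite h), s'))"

text \<open>
  The same side of the same edge, walked along in the opposite direction. Every boundary walk is
  found once in each direction, so a face is an orbit of \<^const>\<open>face_step\<close> joined with the orbit of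
  the reversed walk.
\<close>

definition reverse_state :: "'e signed_rotation \<Rightarrow> 'e edge_end \<times> bool \<Rightarrow> 'e edge_end \<times> bool" where
  "reverse_state = (\<lambda>(\<sigma>, T) (h, s). (opposite h, s = (fst h \<in> T)))"

definition signed_num_faces :: "('v, 'e) pre_digraph \<Rightarrow> 'e signed_rotation \<Rightarrow> nat" where
  "signed_num_faces G X =
     card ((\<lambda>x. orbit (face_step X) x \<union> orbit (face_step X) (reverse_state X x)) `
             (edge_ends G \<times> UNIV))
     + card (isolated_verts G)"

definition signed_euler_genus :: "('v, 'e) pre_digraph \<Rightarrow> 'e signed_rotation \<Rightarrow> real" where
  "signed_euler_genus G X = real_of_int (euler_genus_of_faces G (signed_num_faces G X))"

text \<open>
  Reversing the local orientation at the vertices in \<open>S\<close> reverses the rotations there and changes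
  the twist of the edges that have exactly one end in \<open>S\<close>.
\<close>

definition switch :: "('v, 'e) pre_digraph \<Rightarrow> 'v set \<Rightarrow> 'e signed_rotation \<Rightarrow> 'e signed_rotation" where
  "switch G S = (\<lambda>(\<sigma>, T).
     (\<lambda>h. if h \<in> edge_ends G \<and> end_vertex G h \<in> S then inv \<sigma> h else \<sigma> h,
      {e \<in> arcs G. (e \<in> T) \<noteq> ((tail G e \<in> S) \<noteq> (head G e \<in> S))}))"

definition switch_rel :: "('v, 'e) pre_digraph \<Rightarrow> ('e signed_rotation \<times> 'e signed_rotation) set" where
  "switch_rel G = {(X, Y). X \<in> signed_rotation_systems G \<and> Y \<in> signed_rotation_systems G \<and>
     (\<exists>S\<subseteq>verts G. Y = switch G S X)}"

definition general_embeddings :: "('v, 'e) pre_digraph \<Rightarrow> 'e signed_rotation set set" where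
  "general_embeddings G = signed_rotation_systems G // switch_rel G"

text \<open>All representatives of a general embedding have the same Euler-genus.\<close>

definition euler_genus :: "('v, 'e) pre_digraph \<Rightarrow> 'e signed_rotation set \<Rightarrow> real" where
  "euler_genus G C = the_elem (signed_euler_genus G ` C)"


definition asymptotically_normal :: "(nat \<Rightarrow> 'a pmf) \<Rightarrow> (nat \<Rightarrow> 'a \<Rightarrow> real) \<Rightarrow> bool" where
  "asymptotically_normal p X \<longleftrightarrow>
     weak_conv_m
       (\<lambda>n. distr (measure_pmf (p n)) borel
          (\<lambda>\<omega>. (X n \<omega> - measure_pmf.expectation (p n) (X n))
                 / sqrt (measure_pmf.variance (p n) (X n))))
       std_normal_distribution"

end

theory Submission
  imports Defs "HOL-Real_Asymp.Real_Asymp"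
begin

text \<open>
  Joining two components at pendant vertices merges the two face boundaries there, so each of the
  first \<open>2n - 1\<close> joints of a bar-ring lowers the number of faces by exactly one and the last joint
  changes it by at most one. Hence, up to a constant and a bounded error, the (Euler-)genus of a
  random embedding of the bar-ring is a sum of independent bounded variables, one for each graph
  \<open>G\<^sub>i\<close>; a graph with a genus gap contributes a variance bounded below, because there
  are only boundedly many embeddings. A Lyapunov estimate for characteristic functions and
  Levy's continuity theorem give the normal limit. The bound for signed rotation systems also covers the
  orientable case, which is the case without twisted edges. General embeddings are the classes of
  signed rotation systems under switching; these all have the same size, since the switchings
  fixing a signed rotation system depend on the graph only.
\<close>

text \<open>Cutting the ring at its joints leaves \<open>2 * n\<close> components rather than
  \<open>n\<close>, because each added edge becomes a component of its own, a single edge with one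
  face. All joints have degree two, and two edge-ends admit only one cyclic order: gluing leaves no
  choice, so a uniform rotation system of the ring is exactly a tuple of independent uniform ones.
  In the signed case the twists of the added edges are free, and they do not affect the number of
  faces of the cut ring. Faces are counted through orbits of tracer states, each face giving two
  mirror-image orbits; a joint composes the tracer with two transpositions, and a transposition
  changes the number of orbits in a controlled way. On the probabilistic side the obstacle is that
  the error from the closing joint depends on the summands. It shifts the mean and the variance used
  for standardizing, so the standard deviation of the genus has to be compared with that of the
  independent sum; the two differ by a bounded amount while the latter tends to infinity.\<close>

hide_const (open) Finite_Cartesian_Product.transpose

section \<open>Counting orbits\<close>

definition num_orbits :: "('a \<Rightarrow> 'a) \<Rightarrow> 'a set \<Rightarrow> nat" where
  "num_orbits f D = card (orbit f ` D)"

lemma orbit_subset_invariant: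
  assumes "f ` D \<subseteq> D" "x \<in> D"
  shows "orbit f x \<subseteq> D"
proof
  fix y assume "y \<in> orbit f x"
  then show "y \<in> D" by induct (use assms in auto)
qed

text \<open>\<open>orbit f x\<close> starts at \<open>f x\<close> and not at \<open>x\<close>. As
  \<open>f\<close> is arbitrary outside \<open>D\<close>, the fact for permutations is applied to
  its restriction.\<close>

lemma self_in_orbit_bij_betw:
  assumes "finite D" "bij_betw f D D" "x \<in> D"
  shows "x \<in> orbit f x"
proof -
  have "perm_restrict f D permutes D"
    by (rule bij_imp_permutes)
      (use assms in \<open>auto simp: perm_restrict_def cong: bij_betw_cong\<close>)
  then have "x \<in> orbit (perm_restrict f D) x"
    using assms(1) by (intro permutation_self_in_orbit) (auto simp: permutation_permutes)
  also have "orbit (perm_restrict f D) x = orbit f x"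
    by (rule orbit_cong0[where A = D])
      (use assms in \<open>auto simp: perm_restrict_def bij_betw_def\<close>)
  finally show ?thesis .
qed

lemma orbit_eq_of_mem:
  assumes "finite D" "bij_betw f D D" "x \<in> D" "y \<in> orbit f x"
  shows "orbit f y = orbit f x"
proof -
  have "x \<in> orbit f x" by (rule self_in_orbit_bij_betw[OF assms(1-3)])
  then show ?thesis
    using assms(4) by (auto intro: orbit_trans orbit_swap)
qed

lemma orbit_image_orbit:
  assumes "finite D" "bij_betw f D D" "x \<in> D"
  shows "orbit f ` orbit f x = {orbit f x}"
proof -
  have "orbit f ` orbit f x = (\<lambda>_. orbit f x) ` orbit f x"
    by (rule image_cong[OF refl]) (rule orbit_eq_of_mem[OF assms])
  also have "\<dots> = {orbit f x}" by (simp add: image_constant_conv orbit_nonempty)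
  finally show ?thesis .
qed

section \<open>Orbits after composition with a transposition\<close>

lemma bij_betw_transpose_comp:
  assumes "bij_betw f D D" "x \<in> D" "y \<in> D"
  shows "bij_betw (transpose x y \<circ> f) D D"
proof (rule bij_betw_trans[OF assms(1)])
  show "bij_betw (transpose x y) D D"
    using assms by (intro permutes_imp_bij permutes_swap_id)
qed

lemma orbit_transpose_comp_cong:
  assumes "finite D" "bij_betw f D D" "z \<in> D" "x \<notin> orbit f z" "y \<notin> orbit f z"
  shows "orbit (transpose x y \<circ> f) z = orbit f z"
proof (rule orbit_cong)
  show "z \<in> orbit f z" by (rule self_in_orbit_bij_betw[OF assms(1-3)])
  fix s assume "s \<in> orbit f z"
  then have "f s \<in> orbit f z" by (rule orbit.step)
  then have "f s \<noteq> x" "f s \<noteq> y" using assms by auto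
  then show "(transpose x y \<circ> f) s = f s" by (simp add: transpose_apply_other)
qed

lemma transpose_in:
  assumes "x \<in> A" "y \<in> A" "z \<in> A"
  shows "transpose x y z \<in> A"
  using assms by (simp add: Transposition.transpose_def)

lemma invariant_of_transpose_comp_invariant:
  assumes "(transpose x y \<circ> f) ` W \<subseteq> W" "x \<in> W" "y \<in> W"
  shows "f ` W \<subseteq> W"
proof
  fix w assume "w \<in> f ` W"
  then obtain z where z: "z \<in> W" "w = f z" by auto
  have "transpose x y (f z) \<in> W" using assms(1) z by auto
  then have "transpose x y (transpose x y (f z)) \<in> W" by (rule transpose_in[OF assms(2,3)])
  then show "w \<in> W" using z(2) by simp
qed

text \<open>The new map follows the cycle of \<open>x\<close> until the old one would return to
  \<open>x\<close>; there it enters the cycle of \<open>y\<close>, and it crosses back where the old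
  one would return to \<open>y\<close>.\<close>

lemma orbit_transpose_comp_merge:
  assumes fin: "finite D" and bij: "bij_betw f D D" and xy: "x \<in> D" "y \<in> D"
    and notin: "y \<notin> orbit f x"
  shows "orbit (transpose x y \<circ> f) x = orbit f x \<union> orbit f y"
proof -
  let ?g = "transpose x y \<circ> f"
  let ?W = "orbit ?g x"
  have bijg: "bij_betw ?g D D" by (rule bij_betw_transpose_comp[OF bij xy])
  have xW: "x \<in> ?W" by (rule self_in_orbit_bij_betw[OF fin bijg xy(1)])
  have xx: "x \<in> orbit f x" by (rule self_in_orbit_bij_betw[OF fin bij xy(1)])
  have yy: "y \<in> orbit f y" by (rule self_in_orbit_bij_betw[OF fin bij xy(2)])
  have gW: "?g ` ?W \<subseteq> ?W" by (auto intro: orbit.step simp del: comp_apply)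
  \<comment> \<open>If the new walk missed \<open>y\<close>, it would agree with \<open>f\<close> on
    the cycle of \<open>x\<close> and reach the predecessor of \<open>x\<close> there, whose new
    image is \<open>y\<close>.\<close>
  have yW: "y \<in> ?W"
  proof (rule ccontr)
    assume y: "y \<notin> ?W"
    have "f ` (?W \<inter> orbit f x) \<subseteq> ?W \<inter> orbit f x"
    proof
      fix w assume "w \<in> f ` (?W \<inter> orbit f x)"
      then obtain z where z: "z \<in> ?W" "z \<in> orbit f x" "w = f z" by auto
      have w: "w \<in> orbit f x" using z by (auto intro: orbit.step)
      have "transpose x y w \<in> ?W" using gW z by auto
      moreover have "w \<noteq> x" using y \<open>transpose x y w \<in> ?W\<close> by auto
      moreover have "w \<noteq> y" using w notin by auto
      ultimately show "w \<in> ?W \<inter> orbit f x" using w by (simp add: transpose_apply_other)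
    qed
    then have sub: "orbit f x \<subseteq> ?W"
      using orbit_subset_invariant[of f "?W \<inter> orbit f x" x] xW xx by auto
    obtain z where z: "z \<in> orbit f x" "f z = x"
      using xx by (metis orbit.cases)
    have "?g z \<in> ?W" using gW z(1) sub by blast
    then show False using z(2) y by simp
  qed
  have fW: "f ` ?W \<subseteq> ?W"
    by (rule invariant_of_transpose_comp_invariant[OF gW xW yW])
  have "?g ` (orbit f x \<union> orbit f y) \<subseteq> orbit f x \<union> orbit f y"
    using transpose_in[of x "orbit f x \<union> orbit f y" y] xx yy by (auto intro: orbit.step simp del: Un_iff)
  then have "?W \<subseteq> orbit f x \<union> orbit f y"
    by (rule orbit_subset_invariant) (use xx in auto)
  moreover have "orbit f x \<subseteq> ?W" "orbit f y \<subseteq> ?W"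
    using orbit_subset_invariant[OF fW] xW yW by auto
  ultimately show ?thesis by blast
qed

lemma num_orbits_transpose_comp_merge:
  assumes fin: "finite D" and bij: "bij_betw f D D" and xy: "x \<in> D" "y \<in> D"
    and notin: "y \<notin> orbit f x"
  shows "num_orbits f D = Suc (num_orbits (transpose x y \<circ> f) D)"
proof -
  let ?g = "transpose x y \<circ> f"
  let ?R = "D - (orbit f x \<union> orbit f y)"
  note eq = orbit_eq_of_mem[OF fin bij]
  note self = self_in_orbit_bij_betw[OF fin bij]
  have bijg: "bij_betw ?g D D" by (rule bij_betw_transpose_comp[OF bij xy])
  have merge: "orbit ?g x = orbit f x \<union> orbit f y"
    by (rule orbit_transpose_comp_merge[OF assms])
  have out: "orbit ?g z = orbit f z" if "z \<in> ?R" for z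
    by (rule orbit_transpose_comp_cong[OF fin bij])
      (use that self[of z] eq[of z x] eq[of z y] in \<open>blast+\<close>)
  have ins: "orbit ?g z = orbit f x \<union> orbit f y" if "z \<in> orbit f x \<union> orbit f y" for z
    using orbit_eq_of_mem[OF fin bijg xy(1), of z] that merge by auto
  have sub: "orbit f x \<union> orbit f y \<subseteq> D"
    using orbit_subset_invariant[of f D] bij xy by (auto simp: bij_betw_def)
  then have D: "D = orbit f x \<union> orbit f y \<union> ?R" by auto
  have g: "orbit ?g ` D = {orbit f x \<union> orbit f y} \<union> orbit f ` ?R"
  proof -
    have "orbit ?g ` D = orbit ?g ` (orbit f x \<union> orbit f y) \<union> orbit ?g ` ?R"
      using D by (metis image_Un)
    also have "orbit ?g ` ?R = orbit f ` ?R" by (rule image_cong) (auto simp: out)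
    also have "orbit ?g ` (orbit f x \<union> orbit f y) = {orbit f x \<union> orbit f y}"
      using ins self[OF xy(1)] by auto
    finally show ?thesis .
  qed
  have f: "orbit f ` D = {orbit f x} \<union> {orbit f y} \<union> orbit f ` ?R"
  proof -
    have "orbit f ` D = orbit f ` (orbit f x) \<union> orbit f ` (orbit f y) \<union> orbit f ` ?R"
      using D by (metis image_Un)
    also have "orbit f ` orbit f x = {orbit f x}" by (rule orbit_image_orbit[OF fin bij xy(1)])
    also have "orbit f ` orbit f y = {orbit f y}" by (rule orbit_image_orbit[OF fin bij xy(2)])
    finally show ?thesis .
  qed
  have "orbit f x \<noteq> orbit f y" using self[OF xy(2)] notin by auto
  moreover have "orbit f x \<notin> orbit f ` ?R" "orbit f y \<notin> orbit f ` ?R"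
    using self by auto
  moreover have "orbit f x \<union> orbit f y \<notin> orbit f ` ?R"
    using self by auto
  ultimately show ?thesis
    using fin unfolding num_orbits_def f g by simp
qed

text \<open>A transposition is its own inverse, so the merging of two orbits can be read in both
  directions: either \<open>f\<close> or the composed map has \<open>x\<close> and \<open>y\<close>
  on different orbits.\<close>

lemma num_orbits_transpose_comp_le:
  assumes fin: "finite D" and bij: "bij_betw f D D" and xy: "x \<in> D" "y \<in> D"
  shows "num_orbits (transpose x y \<circ> f) D \<le> Suc (num_orbits f D)"
    and "num_orbits f D \<le> Suc (num_orbits (transpose x y \<circ> f) D)"
proof -
  let ?g = "transpose x y \<circ> f"
  have bijg: "bij_betw ?g D D" by (rule bij_betw_transpose_comp[OF bij xy])
  have gg: "transpose x y \<circ> ?g = f" by (simp add: fun_eq_iff)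
  \<comment> \<open>Instead of excluding by parity that \<open>y\<close> lies on both orbits of
    \<open>x\<close>, it is enough to see that in this case no orbit would change.\<close>
  have "num_orbits ?g D = num_orbits f D" if y: "y \<in> orbit f x" and yg: "y \<in> orbit ?g x"
  proof -
    have self: "x \<in> orbit f x" "x \<in> orbit ?g x"
      using self_in_orbit_bij_betw[OF fin bij xy(1)] self_in_orbit_bij_betw[OF fin bijg xy(1)]
      by auto
    have "?g ` orbit f x \<subseteq> orbit f x"
      using transpose_in[OF self(1) y] by (auto intro: orbit.step)
    then have 1: "orbit ?g x \<subseteq> orbit f x"
      by (rule orbit_subset_invariant) (rule self)
    have "?g ` orbit ?g x \<subseteq> orbit ?g x" by (auto intro: orbit.step simp del: comp_apply)
    then have "f ` orbit ?g x \<subseteq> orbit ?g x"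
      by (rule invariant_of_transpose_comp_invariant) (use self yg in auto)
    then have "orbit f x \<subseteq> orbit ?g x"
      by (rule orbit_subset_invariant) (rule self)
    with 1 have x: "orbit ?g x = orbit f x" by auto
    have "orbit ?g z = orbit f z" if z: "z \<in> D" for z
    proof (cases "z \<in> orbit f x")
      case True
      then show ?thesis
        using orbit_eq_of_mem[OF fin bij xy(1), of z] orbit_eq_of_mem[OF fin bijg xy(1), of z] x
        by metis
    next
      case False
      have "x \<notin> orbit f z" "y \<notin> orbit f z"
        using orbit_eq_of_mem[OF fin bij z, of x] orbit_eq_of_mem[OF fin bij z, of y] y False
          orbit_eq_of_mem[OF fin bij xy(1), of y] self_in_orbit_bij_betw[OF fin bij z]
        by metis+
      then show ?thesis by (intro orbit_transpose_comp_cong[OF fin bij z])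
    qed
    then show ?thesis by (simp add: num_orbits_def)
  qed
  moreover have "num_orbits f D = Suc (num_orbits ?g D)" if "y \<notin> orbit f x"
    by (rule num_orbits_transpose_comp_merge[OF assms that])
  moreover have "num_orbits ?g D = Suc (num_orbits f D)" if "y \<notin> orbit ?g x"
    using num_orbits_transpose_comp_merge[OF fin bijg xy that] by (simp only: gg)
  ultimately show "num_orbits ?g D \<le> Suc (num_orbits f D)"
    and "num_orbits f D \<le> Suc (num_orbits ?g D)"
    by fastforce+
qed

section \<open>Orbit counts on disjoint unions and under conjugation\<close>

lemma num_orbits_UN_disjoint:
  assumes "finite I" "\<And>i. i \<in> I \<Longrightarrow> finite (D i)" "\<And>i. i \<in> I \<Longrightarrow> f ` D i \<subseteq> D i"
    and disj: "\<And>i j. i \<in> I \<Longrightarrow> j \<in> I \<Longrightarrow> i \<noteq> j \<Longrightarrow> D i \<inter> D j = {}"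
  shows "num_orbits f (\<Union>i\<in>I. D i) = (\<Sum>i\<in>I. num_orbits f (D i))"
  unfolding num_orbits_def image_UN
proof (rule card_UN_disjoint)
  show "\<forall>i\<in>I. \<forall>j\<in>I. i \<noteq> j \<longrightarrow> orbit f ` D i \<inter> orbit f ` D j = {}"
  proof (intro ballI impI)
    fix i j assume ij: "i \<in> I" "j \<in> I" "i \<noteq> j"
    have "orbit f x \<noteq> orbit f y" if "x \<in> D i" "y \<in> D j" for x y
      using orbit_subset_invariant[OF assms(3)[OF ij(1)] that(1)] orbit_nonempty[of f x]
        orbit_subset_invariant[OF assms(3)[OF ij(2)] that(2)] disj[OF ij] by auto
    then show "orbit f ` D i \<inter> orbit f ` D j = {}" by blast
  qed
qed (use assms in auto)

lemma orbit_image_semiconj: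
  assumes "f ` D \<subseteq> D" "x \<in> D" "\<And>z. z \<in> D \<Longrightarrow> g (\<phi> z) = \<phi> (f z)"
  shows "orbit g (\<phi> x) = \<phi> ` orbit f x"
proof (intro equalityI subsetI)
  fix y assume "y \<in> orbit g (\<phi> x)"
  then show "y \<in> \<phi> ` orbit f x"
  proof induct
    case base
    then show ?case using assms by (auto intro: orbit.base)
  next
    case (step y)
    then obtain z where z: "z \<in> orbit f x" "y = \<phi> z" by auto
    then have "z \<in> D" using orbit_subset_invariant[OF assms(1,2)] by auto
    then show ?case using z assms(3) by (auto intro: orbit.step)
  qed
next
  fix y assume "y \<in> \<phi> ` orbit f x"
  then obtain z where z: "z \<in> orbit f x" "y = \<phi> z" by auto
  from z(1) have "\<phi> z \<in> orbit g (\<phi> x)"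
  proof induct
    case base
    then show ?case using assms(2,3) by (metis orbit.base)
  next
    case (step z)
    then have "z \<in> D" using orbit_subset_invariant[OF assms(1,2)] by auto
    then show ?case using step assms(3) by (metis orbit.step)
  qed
  then show "y \<in> orbit g (\<phi> x)" using z by simp
qed

lemma num_orbits_semiconj:
  assumes "inj_on \<phi> D" "f ` D \<subseteq> D" "\<And>z. z \<in> D \<Longrightarrow> g (\<phi> z) = \<phi> (f z)"
  shows "num_orbits g (\<phi> ` D) = num_orbits f D"
proof -
  have "orbit g ` \<phi> ` D = (\<lambda>S. \<phi> ` S) ` orbit f ` D"
    using orbit_image_semiconj[of f D _ g \<phi>] assms by (auto simp: image_image)
  moreover have "inj_on (\<lambda>S. \<phi> ` S) (orbit f ` D)"
  proof (rule inj_onI)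
    fix A B assume "A \<in> orbit f ` D" "B \<in> orbit f ` D" "\<phi> ` A = \<phi> ` B"
    moreover from this have "A \<subseteq> D" "B \<subseteq> D" using orbit_subset_invariant[OF assms(2)] by blast+
    ultimately show "A = B" using inj_on_image_eq_iff[OF assms(1)] by blast
  qed
  ultimately show ?thesis by (simp add: num_orbits_def card_image)
qed

text \<open>A new point is a cycle of its own, and transposing it with an old point merges the two
  cycles.\<close>

lemma exists_cyclic_permutation:
  assumes "finite S" "S \<noteq> {}"
  shows "\<exists>\<pi>. \<pi> permutes S \<and> cyclic_on \<pi> S"
  using assms
proof (induction rule: finite_ne_induct)
  case (singleton x)
  have "cyclic_on id {x}" unfolding cyclic_on_def using orbit_eq_singleton_iff[of id x] by auto
  then show ?case using permutes_id by blast
next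
  case (insert a S)
  then obtain \<pi> x where \<pi>: "\<pi> permutes S" "cyclic_on \<pi> S" and x: "x \<in> S" by auto
  have per: "\<pi> permutes insert a S" using \<pi>(1) by (rule permutes_subset) auto
  have a: "orbit \<pi> a = {a}"
    using orbit_eq_singleton_iff[of \<pi> a] \<pi>(1) insert by (simp add: permutes_not_in)
  have "orbit (transpose a x \<circ> \<pi>) a = orbit \<pi> a \<union> orbit \<pi> x"
    by (rule orbit_transpose_comp_merge[where D = "insert a S"])
      (use insert x a per in \<open>auto intro: permutes_imp_bij\<close>)
  also have "\<dots> = insert a S" using a orbit_cyclic_eq3[OF \<pi>(2) x] by simp
  finally have "cyclic_on (transpose a x \<circ> \<pi>) (insert a S)"
    unfolding cyclic_on_def by auto
  moreover have "transpose a x \<circ> \<pi> permutes insert a S"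
    by (intro permutes_compose per permutes_swap_id) (use x in auto)
  ultimately show ?case by blast
qed

section \<open>Reversible permutations\<close>

text \<open>A walk that turned into its own reversal would have a midpoint, which the reversal either
  fixes or exchanges with its successor.\<close>

lemma reversal_notin_orbit:
  assumes inj: "inj f" and rev: "\<And>x. f (r (f x)) = r x"
    and fix1: "\<And>x. r x \<noteq> x" and fix2: "\<And>x. r x \<noteq> f x"
  shows "r x \<notin> orbit f x"
proof
  assume "r x \<in> orbit f x"
  then obtain m where m: "(f ^^ m) x = r x" by (auto simp: orbit_altdef)
  have pow: "(f ^^ k) (r ((f ^^ k) x)) = r x" for k
  proof (induction k)
    case (Suc k)
    have "(f ^^ Suc k) (r ((f ^^ Suc k) x)) = (f ^^ k) (f (r (f ((f ^^ k) x))))"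
      by (simp add: funpow_swap1)
    then show ?case using Suc by (simp only: rev)
  qed simp
  have injk: "inj (f ^^ k)" for k using inj by (rule inj_fn)
  define k where "k = m div 2"
  show False
  proof (cases "even m")
    case True
    then have "m = k + k" unfolding k_def by presburger
    then have "(f ^^ k) (r ((f ^^ k) x)) = (f ^^ k) ((f ^^ k) x)"
      using m pow[of k] by (simp add: funpow_add)
    then show False using injk fix1 by (auto dest: injD)
  next
    case False
    then have "m = k + Suc k" unfolding k_def by presburger
    then have "(f ^^ k) (r ((f ^^ k) x)) = (f ^^ k) (f ((f ^^ k) x))"
      using m pow[of k] by (simp add: funpow_add funpow_swap1)
    then show False using injk fix2 by (auto dest: injD)
  qed
qed

text \<open>\<open>rev\<close> says that \<open>r\<close> conjugates \<open>f\<close> to its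
  inverse: \<open>f\<close> leads from \<open>r (f z)\<close> back to \<open>r z\<close>. On a
  finite set a map and its inverse have the same orbits.\<close>

lemma reversal_image_orbit:
  assumes fin: "finite D" and bij: "bij_betw f D D" and rD: "r ` D \<subseteq> D"
    and rr: "\<And>x. r (r x) = x" and rev: "\<And>x. f (r (f x)) = r x" and x: "x \<in> D"
  shows "r ` orbit f x = orbit f (r x)"
proof -
  have sub: "r ` orbit f x \<subseteq> orbit f (r x)" if x: "x \<in> D" for x
  proof
    fix w assume "w \<in> r ` orbit f x"
    then obtain z where z: "z \<in> orbit f x" "w = r z" by auto
    have step: "r (f z) \<in> orbit f (r z)" if "z \<in> D" for z
    proof -
      have fz: "f z \<in> D" using bij that by (auto simp: bij_betw_def)
      then have D: "r (f z) \<in> D" using rD by auto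
      have "f (r (f z)) \<in> orbit f (r (f z))" by (rule orbit.base)
      then have "orbit f (r z) = orbit f (r (f z))"
        using orbit_eq_of_mem[OF fin bij D] by (simp add: rev)
      then show ?thesis using self_in_orbit_bij_betw[OF fin bij D] by simp
    qed
    have D: "orbit f x \<subseteq> D" by (rule orbit_subset_invariant) (use bij x in \<open>auto simp: bij_betw_def\<close>)
    from z(1) have "r z \<in> orbit f (r x)"
    proof induct
      case base
      then show ?case by (rule step[OF x])
    next
      case (step y)
      then show ?case using \<open>\<And>z. z \<in> D \<Longrightarrow> r (f z) \<in> orbit f (r z)\<close> D by (blast intro: orbit_trans)
    qed
    then show "w \<in> orbit f (r x)" using z by simp
  qed
  have "r ` r ` orbit f (r x) \<subseteq> r ` orbit f x" using sub[of "r x"] x rD rr by auto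
  then show ?thesis using sub[OF x] by (auto simp: image_image rr)
qed

text \<open>Joining each orbit with its mirror image is a two-to-one map on orbits;
  \<open>ne\<close> keeps an orbit from being its own mirror image.\<close>

lemma card_reversal_classes:
  assumes fin: "finite D" and bij: "bij_betw f D D" and rD: "r ` D \<subseteq> D"
    and rr: "\<And>x. r (r x) = x" and rev: "\<And>x. f (r (f x)) = r x"
    and ne: "\<And>x. x \<in> D \<Longrightarrow> r x \<notin> orbit f x"
  shows "num_orbits f D = 2 * card ((\<lambda>x. orbit f x \<union> orbit f (r x)) ` D)"
proof -
  let ?Q = "orbit f ` D"
  define m where "m O' = O' \<union> r ` O'" for O'
  note ro = reversal_image_orbit[OF fin bij rD rr rev]
  note self = self_in_orbit_bij_betw[OF fin bij]
  have img: "m ` ?Q = (\<lambda>x. orbit f x \<union> orbit f (r x)) ` D"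
    by (auto simp: m_def ro image_image)
  have two: "card {Q \<in> ?Q. m Q = F} = 2" if F: "F \<in> m ` ?Q" for F
  proof -
    obtain x where x: "x \<in> D" "F = m (orbit f x)" using F by auto
    have rx: "r x \<in> D" using x rD by auto
    have "m (orbit f (r x)) = m (orbit f x)"
      by (simp add: m_def ro[OF x(1)] ro[OF rx] rr Un_commute)
    have "{Q \<in> ?Q. m Q = F} = {orbit f x, orbit f (r x)}"
    proof (intro equalityI subsetI)
      fix Q assume "Q \<in> {Q \<in> ?Q. m Q = F}"
      then obtain y where y: "y \<in> D" "Q = orbit f y" "m Q = F" by auto
      have "y \<in> m Q" using self[OF y(1)] y by (auto simp: m_def)
      then have "y \<in> orbit f x \<or> y \<in> orbit f (r x)" using y x ro[OF x(1)] by (auto simp: m_def)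
      then show "Q \<in> {orbit f x, orbit f (r x)}"
        using orbit_eq_of_mem[OF fin bij x(1)] orbit_eq_of_mem[OF fin bij rx] y by blast
    next
      fix Q assume "Q \<in> {orbit f x, orbit f (r x)}"
      then show "Q \<in> {Q \<in> ?Q. m Q = F}"
        using x rx \<open>m (orbit f (r x)) = m (orbit f x)\<close> by auto
    qed
    moreover have "orbit f x \<noteq> orbit f (r x)" using ne[OF x(1)] self[OF rx] by auto
    ultimately show ?thesis by simp
  qed
  have "card ?Q = (\<Sum>F\<in>m ` ?Q. card {Q \<in> ?Q. m Q = F})"
    using sum.image_gen[of ?Q "\<lambda>_. 1::nat" m] fin by simp
  also have "\<dots> = 2 * card (m ` ?Q)" using two by simp
  finally show ?thesis by (simp add: img num_orbits_def)
qed

section \<open>Face tracing\<close>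

lemma fst_opposite [simp]: "fst (opposite h) = fst h"
  by (simp add: opposite_def)

lemma opposite_opposite [simp]: "opposite (opposite h) = h"
  by (simp add: opposite_def)

lemma opposite_neq [simp]: "opposite h \<noteq> h"
  by (simp add: opposite_def prod_eq_iff)

lemma opposite_eq_iff [simp]: "opposite h = opposite h' \<longleftrightarrow> h = h'"
  by (metis opposite_opposite)

lemma face_step_apply:
  "face_step (\<sigma>, T) (h, s) =
     ((if s \<noteq> (fst h \<in> T) then \<sigma> else inv \<sigma>) (opposite h), s \<noteq> (fst h \<in> T))"
  by (simp add: face_step_def Let_def)

lemma reverse_state_apply: "reverse_state (\<sigma>, T) (h, s) = (opposite h, s = (fst h \<in> T))"
  by (simp add: reverse_state_def)

lemma bij_inv_apply:
  assumes "bij \<sigma>"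
  shows "inv \<sigma> (\<sigma> x) = x" "\<sigma> (inv \<sigma> x) = x"
  using assms by (simp_all add: bij_is_inj bij_is_surj surj_f_inv_f)

text \<open>The flag of the image tells which of \<open>\<sigma>\<close> and
  \<open>inv \<sigma>\<close> was applied; the edge-end recovered from it then determines the old
  flag.\<close>

lemma inj_face_step:
  assumes "bij \<sigma>"
  shows "inj (face_step (\<sigma>, T))"
proof (rule injI)
  fix x y assume eq: "face_step (\<sigma>, T) x = face_step (\<sigma>, T) y"
  obtain h s h' s' where xy: "x = (h, s)" "y = (h', s')" by (metis surj_pair)
  define b where "b = (s \<noteq> (fst h \<in> T))"
  have b: "b = (s' \<noteq> (fst h' \<in> T))"
    and "(if b then \<sigma> else inv \<sigma>) (opposite h) = (if b then \<sigma> else inv \<sigma>) (opposite h')"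
    using eq by (auto simp: xy face_step_apply b_def)
  moreover have "inj (if b then \<sigma> else inv \<sigma>)"
    using assms by (simp add: bij_is_inj bij_imp_bij_inv)
  ultimately have "opposite h = opposite h'" by (metis injD)
  then have "h = h'" by simp
  then have "s = s'" using b unfolding b_def by blast
  with \<open>h = h'\<close> show "x = y" by (simp add: xy)
qed

text \<open>Walking back over the edge just entered, the tracer turns in the opposite sense, which
  undoes the last turn.\<close>

lemma face_step_reverse_state:
  assumes "bij \<sigma>"
  shows "face_step (\<sigma>, T) (reverse_state (\<sigma>, T) (face_step (\<sigma>, T) x)) = reverse_state (\<sigma>, T) x"
proof -
  obtain h s where x: "x = (h, s)" by (metis surj_pair)
  define b where "b = (s \<noteq> (fst h \<in> T))"
  define k where "k = (if b then \<sigma> else inv \<sigma>) (opposite h)"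
  have "face_step (\<sigma>, T) x = (k, b)" by (simp add: x face_step_apply b_def k_def)
  moreover have "reverse_state (\<sigma>, T) (k, b) = (opposite k, b = (fst k \<in> T))"
    by (simp add: reverse_state_apply)
  moreover have "face_step (\<sigma>, T) (opposite k, b = (fst k \<in> T)) =
      ((if b then inv \<sigma> else \<sigma>) k, \<not> b)"
    by (cases b) (simp_all add: face_step_apply)
  moreover have "(if b then inv \<sigma> else \<sigma>) k = opposite h"
    by (cases b) (simp_all add: k_def bij_inv_apply[OF assms])
  moreover have "reverse_state (\<sigma>, T) x = (opposite h, \<not> b)"
    by (simp add: x reverse_state_apply b_def)
  ultimately show ?thesis by simp
qed

lemma reverse_state_reverse_state [simp]: "reverse_state X (reverse_state X x) = x"
  by (cases X; cases x) (auto simp: reverse_state_apply)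

lemma reverse_state_neq: "reverse_state X x \<noteq> x"
  by (cases X; cases x) (auto simp: reverse_state_apply)

lemma reverse_state_neq_face_step: "reverse_state X x \<noteq> face_step X x"
  by (cases X; cases x) (auto simp: reverse_state_apply face_step_apply)

text \<open>Reversal always changes the edge-end, and it produces the negation of the flag that a
  step produces. So neither kind of midpoint can occur.\<close>

lemma reverse_state_notin_orbit:
  assumes "bij \<sigma>"
  shows "reverse_state (\<sigma>, T) x \<notin> orbit (face_step (\<sigma>, T)) x"
  using inj_face_step[OF assms] face_step_reverse_state[OF assms] reverse_state_neq
    reverse_state_neq_face_step
  by (rule reversal_notin_orbit)

lemma image_inv_subset:
  assumes "bij \<sigma>" "finite A" "\<sigma> ` A \<subseteq> A"
  shows "inv \<sigma> ` A \<subseteq> A"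
proof -
  have "\<sigma> ` A = A"
    using assms by (intro endo_inj_surj) (auto intro: inj_on_subset bij_is_inj)
  then show ?thesis using assms(1) by (metis bij_is_inj image_inv_f_f order_refl)
qed

lemma face_step_image_subset:
  assumes "bij \<sigma>" "finite A" "\<sigma> ` A \<subseteq> A" "opposite ` A \<subseteq> A"
  shows "face_step (\<sigma>, T) ` (A \<times> UNIV) \<subseteq> A \<times> UNIV"
proof
  fix y assume "y \<in> face_step (\<sigma>, T) ` (A \<times> UNIV)"
  then obtain h s where h: "h \<in> A" and y: "y = face_step (\<sigma>, T) (h, s)" by blast
  have "opposite h \<in> A" using assms(4) h by blast
  then have "\<sigma> (opposite h) \<in> A" "inv \<sigma> (opposite h) \<in> A"
    using image_inv_subset[OF assms(1-3)] assms(3) by blast+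
  then show "y \<in> A \<times> UNIV" by (simp add: y face_step_apply)
qed

lemma bij_betw_face_step:
  assumes "bij \<sigma>" "finite A" "\<sigma> ` A \<subseteq> A" "opposite ` A \<subseteq> A"
  shows "bij_betw (face_step (\<sigma>, T)) (A \<times> UNIV) (A \<times> UNIV)"
proof -
  have "inj_on (face_step (\<sigma>, T)) (A \<times> UNIV)"
    using inj_face_step[OF assms(1)] by (rule inj_on_subset) simp
  moreover from this have "face_step (\<sigma>, T) ` (A \<times> UNIV) = A \<times> UNIV"
    using assms(2) face_step_image_subset[OF assms] by (intro endo_inj_surj) auto
  ultimately show ?thesis by (simp add: bij_betw_def)
qed

text \<open>Taken over a set of edge-ends instead of a graph, so that it also counts the faces of a
  ring whose joints have been cut open, where the permutation is no longer a rotation system of the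
  ring.\<close>

definition face_classes :: "'e edge_end set \<Rightarrow> 'e signed_rotation \<Rightarrow> nat" where
  "face_classes A X = card ((\<lambda>x. orbit (face_step X) x \<union> orbit (face_step X) (reverse_state X x)) `
     (A \<times> UNIV))"

lemma signed_num_faces_eq:
  "signed_num_faces H X = face_classes (edge_ends H) X + card (isolated_verts H)"
  by (simp add: signed_num_faces_def face_classes_def)

text \<open>Transpositions act on orbits and not on faces; this factor two translates between
  them.\<close>

lemma num_orbits_face_step:
  assumes "bij \<sigma>" "finite A" "\<sigma> ` A \<subseteq> A" "opposite ` A \<subseteq> A"
  shows "num_orbits (face_step (\<sigma>, T)) (A \<times> UNIV) = 2 * face_classes A (\<sigma>, T)"
  unfolding face_classes_def
proof (rule card_reversal_classes)
  show "bij_betw (face_step (\<sigma>, T)) (A \<times> UNIV) (A \<times> UNIV)"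
    by (rule bij_betw_face_step[OF assms])
  show "reverse_state (\<sigma>, T) ` (A \<times> UNIV) \<subseteq> A \<times> UNIV"
    using assms(4) by (auto simp: reverse_state_apply)
qed (use assms(2) face_step_reverse_state[OF assms(1)] reverse_state_notin_orbit[OF assms(1)] in
    simp_all)

lemma face_step_untwisted: "face_step (\<sigma>, {}) (h, True) = ((\<sigma> \<circ> opposite) h, True)"
  by (simp add: face_step_apply)

text \<open>Without twisted edges the flag never changes. The states with flag \<open>True\<close>
  carry the map \<open>\<sigma> \<circ> opposite\<close>, those with flag \<open>False\<close> the
  reversed walks, so one of the two layers sees every face once.\<close>

lemma face_classes_untwisted:
  assumes "bij \<sigma>" "finite A" "\<sigma> ` A \<subseteq> A" "opposite ` A \<subseteq> A"
  shows "face_classes A (\<sigma>, {}) = num_orbits (\<sigma> \<circ> opposite) A"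
proof -
  let ?f = "face_step (\<sigma>, {})" and ?r = "reverse_state (\<sigma>, {})"
  let ?A = "\<lambda>s::bool. (\<lambda>h. (h, s)) ` A"
  have bij: "bij_betw ?f (A \<times> UNIV) (A \<times> UNIV)" by (rule bij_betw_face_step[OF assms])
  have sub: "?f ` ?A s \<subseteq> ?A s" for s
  proof
    fix y assume "y \<in> ?f ` ?A s"
    then obtain h where h: "h \<in> A" and y: "y = ?f (h, s)" by blast
    have "opposite h \<in> A" using assms(4) h by blast
    then have "\<sigma> (opposite h) \<in> A" "inv \<sigma> (opposite h) \<in> A"
      using image_inv_subset[OF assms(1-3)] assms(3) by blast+
    then show "y \<in> ?A s" by (cases s) (simp_all add: y face_step_apply)
  qed
  have D: "A \<times> UNIV = (\<Union>s\<in>UNIV. ?A s)" by auto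
  have "num_orbits ?f (A \<times> UNIV) = (\<Sum>s\<in>UNIV. num_orbits ?f (?A s))"
    unfolding D by (rule num_orbits_UN_disjoint) (use assms sub in auto)
  also have "\<dots> = num_orbits ?f (?A True) + num_orbits ?f (?A False)"
    by (simp add: UNIV_bool)
  \<comment> \<open>With no twisted edge, reversal negates the flag and thereby exchanges the two
    layers.\<close>
  also have "num_orbits ?f (?A False) = num_orbits ?f (?A True)"
  proof -
    have img: "?r ` ?A True = ?A False"
    proof -
      have "?r ` ?A True = (\<lambda>h. (h, False)) ` opposite ` A"
        by (auto simp: reverse_state_apply image_image)
      also have "opposite ` A = A"
        using assms(4) by (auto simp: image_iff) (metis image_subset_iff opposite_opposite)
      finally show ?thesis .
    qed
    have rA: "?r ` (A \<times> UNIV) \<subseteq> A \<times> UNIV"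
      using assms(4) by (auto simp: reverse_state_apply)
    have ro: "?r ` orbit ?f x = orbit ?f (?r x)" if "x \<in> A \<times> UNIV" for x
    proof (rule reversal_image_orbit[where D = "A \<times> UNIV"])
      show "?f (?r (?f x)) = ?r x" for x by (rule face_step_reverse_state[OF assms(1)])
    qed (use assms(2) bij rA that in simp_all)
    have "orbit ?f ` ?A False = (\<lambda>x. orbit ?f (?r x)) ` ?A True"
      unfolding img[symmetric] by (rule image_image)
    also have "\<dots> = (\<lambda>x. ?r ` orbit ?f x) ` ?A True"
      by (rule image_cong[OF refl], rule ro[symmetric]) blast
    also have "\<dots> = (\<lambda>S. ?r ` S) ` orbit ?f ` ?A True"
      by (rule image_image[symmetric])
    finally have "orbit ?f ` ?A False = (\<lambda>S. ?r ` S) ` orbit ?f ` ?A True" .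
    moreover have inj: "inj (\<lambda>S. ?r ` S)"
    proof (rule injI)
      fix S S' assume "?r ` S = ?r ` S'"
      then have "?r ` ?r ` S = ?r ` ?r ` S'" by simp
      then show "S = S'" by (simp add: image_image)
    qed
    ultimately show ?thesis
      unfolding num_orbits_def using card_image[OF inj_on_subset[OF inj subset_UNIV]] by simp
  qed
  also have "num_orbits ?f (?A True) = num_orbits (\<sigma> \<circ> opposite) A"
    by (rule num_orbits_semiconj) (use assms in \<open>auto simp: inj_on_def face_step_untwisted\<close>)
  finally show ?thesis using num_orbits_face_step[OF assms, of "{}"] by simp
qed

section \<open>Amalgamating two pendant vertices\<close>

text \<open>A fixed edge-end is the only one at its vertex. Composing with
  \<open>transpose p q\<close> turns two such ends into one rotation of length two. It commutes with
  \<open>\<sigma>\<close>, so \<open>inv \<sigma>\<close> changes in the same way and each flag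
  contributes one transposition of states.\<close>

lemma face_step_transpose:
  assumes "bij \<sigma>" "\<sigma> p = p" "\<sigma> q = q"
  shows "face_step (transpose p q \<circ> \<sigma>, T) =
    transpose (p, True) (q, True) \<circ> (transpose (p, False) (q, False) \<circ> face_step (\<sigma>, T))"
proof -
  have inv: "inv (transpose p q \<circ> \<sigma>) = transpose p q \<circ> inv \<sigma>"
  proof -
    have "inv (transpose p q \<circ> \<sigma>) h = transpose p q (inv \<sigma> h)" for h
    proof -
      have comm: "\<sigma> (transpose p q z) = transpose p q (\<sigma> z)" for z
        using assms by (metis bij_inv_apply(1) transpose_apply_first transpose_apply_other
          transpose_apply_second)
      have "(transpose p q \<circ> \<sigma>) (transpose p q (inv \<sigma> h)) = h"
        by (simp add: comm bij_inv_apply[OF assms(1)])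
      moreover have "inj (transpose p q \<circ> \<sigma>)"
        using assms(1) by (simp add: bij_is_inj inj_compose)
      ultimately show ?thesis by (metis inv_f_f)
    qed
    then show ?thesis by auto
  qed
  have "transpose (p, True) (q, True) (transpose (p, False) (q, False) (h, s)) =
    (transpose p q h, s)" for h s
    by (cases s) (auto simp: Transposition.transpose_def)
  then show ?thesis by (auto simp: fun_eq_iff face_step_apply inv)
qed

text \<open>\<open>A\<close> separates \<open>p\<close> from \<open>q\<close> and is closed under
  face tracing, so both transpositions merge different orbits. For the second one this also uses
  that the two directions of the walk through \<open>p\<close> are different orbits, so that the
  first merge leaves the orbit of \<open>(p, True)\<close> alone.\<close>

lemma num_orbits_amalgamate:
  assumes perm: "bij \<sigma>" "finite E" "\<sigma> ` E \<subseteq> E" "opposite ` E \<subseteq> E"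
    and pq: "p \<in> E" "q \<in> E" "\<sigma> p = p" "\<sigma> q = q"
    and A: "A \<subseteq> E" "\<sigma> ` A \<subseteq> A" "opposite ` A \<subseteq> A" "p \<in> A" "q \<notin> A"
  shows "num_orbits (face_step (\<sigma>, T)) (E \<times> UNIV) =
    num_orbits (face_step (transpose p q \<circ> \<sigma>, T)) (E \<times> UNIV) + 2"
proof -
  let ?f = "face_step (\<sigma>, T)" and ?D = "E \<times> (UNIV :: bool set)"
  let ?g = "transpose (p, False) (q, False) \<circ> ?f"
  have bij: "bij_betw ?f ?D ?D" by (rule bij_betw_face_step[OF perm])
  have fin: "finite ?D" using perm by simp
  have "?f ` (A \<times> UNIV) \<subseteq> A \<times> UNIV"
    by (rule face_step_image_subset) (use perm A finite_subset in auto)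
  then have sub: "orbit ?f (p, s) \<subseteq> A \<times> UNIV" for s
    by (rule orbit_subset_invariant) (use A in simp)
  have "num_orbits ?f ?D = Suc (num_orbits ?g ?D)"
    by (rule num_orbits_transpose_comp_merge[OF fin bij]) (use sub pq A in auto)
  also have "num_orbits ?g ?D = Suc (num_orbits (transpose (p, True) (q, True) \<circ> ?g) ?D)"
  proof (rule num_orbits_transpose_comp_merge[OF fin])
    show "bij_betw ?g ?D ?D" by (rule bij_betw_transpose_comp[OF bij]) (use pq in auto)
    \<comment> \<open>The state from which the tracer arrives at \<open>(p, True)\<close>; its
      reversal is \<open>(p, False)\<close>. So \<open>(p, True)\<close> and
      \<open>(p, False)\<close> belong to mirror-image orbits.\<close>
    define x where "x = (opposite p, fst p \<notin> T)"
    have inv: "inv \<sigma> p = p" using perm(1) pq(3) by (metis bij_inv_apply(1))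
    have x: "?f x = (p, True)" "reverse_state (\<sigma>, T) x = (p, False)"
      using pq inv by (auto simp: x_def face_step_apply reverse_state_apply)
    have "x \<in> ?D" using perm(4) pq(1) by (auto simp: x_def)
    then have "orbit ?f (p, True) = orbit ?f x"
      using orbit_eq_of_mem[OF fin bij, of x] orbit.base[of ?f x] x by simp
    then have "(p, False) \<notin> orbit ?f (p, True)"
      using reverse_state_notin_orbit[OF perm(1), of T x] x by simp
    moreover have "(q, False) \<notin> orbit ?f (p, True)" using sub A by auto
    ultimately have "orbit ?g (p, True) = orbit ?f (p, True)"
      by (intro orbit_transpose_comp_cong[OF fin bij]) (use pq in auto)
    then show "(q, True) \<notin> orbit ?g (p, True)" using sub A by auto
  qed (use pq in auto)
  finally show ?thesis by (simp add: face_step_transpose[OF perm(1) pq(3,4)])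
qed

text \<open>This serves the joint that closes the ring, where no set separates \<open>p\<close> from
  \<open>q\<close>: each of the two transpositions still changes the number of orbits by at most
  one.\<close>

lemma num_orbits_amalgamate_le:
  assumes perm: "bij \<sigma>" "finite E" "\<sigma> ` E \<subseteq> E" "opposite ` E \<subseteq> E"
    and pq: "p \<in> E" "q \<in> E" "\<sigma> p = p" "\<sigma> q = q"
  shows "num_orbits (face_step (\<sigma>, T)) (E \<times> UNIV) \<le>
      num_orbits (face_step (transpose p q \<circ> \<sigma>, T)) (E \<times> UNIV) + 2"
    and "num_orbits (face_step (transpose p q \<circ> \<sigma>, T)) (E \<times> UNIV) \<le>
      num_orbits (face_step (\<sigma>, T)) (E \<times> UNIV) + 2"
proof -
  let ?f = "face_step (\<sigma>, T)" and ?D = "E \<times> (UNIV :: bool set)"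
  let ?g = "transpose (p, False) (q, False) \<circ> ?f"
  let ?h = "transpose (p, True) (q, True) \<circ> ?g"
  have bij: "bij_betw ?f ?D ?D" by (rule bij_betw_face_step[OF perm])
  have fin: "finite ?D" using perm by simp
  have bijg: "bij_betw ?g ?D ?D" by (rule bij_betw_transpose_comp[OF bij]) (use pq in auto)
  have h: "face_step (transpose p q \<circ> \<sigma>, T) = ?h"
    by (rule face_step_transpose[OF perm(1) pq(3,4)])
  have D: "(p, s) \<in> ?D" "(q, s) \<in> ?D" for s using pq by auto
  note 1 = num_orbits_transpose_comp_le[OF fin bij D[of False]]
  note 2 = num_orbits_transpose_comp_le[OF fin bijg D[of True]]
  show "num_orbits ?f ?D \<le> num_orbits (face_step (transpose p q \<circ> \<sigma>, T)) ?D + 2"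
    and "num_orbits (face_step (transpose p q \<circ> \<sigma>, T)) ?D \<le> num_orbits ?f ?D + 2"
    unfolding h using 1 2 by linarith+
qed

text \<open>The edge-ends \<open>p j\<close> and \<open>q j\<close> are the two ends at the vertex obtained by amalgamating a
  pendant vertex of the component of level \<open>j - 1\<close> with a pendant vertex of the component of
  level \<open>j\<close>; the last amalgamation closes the ring of \<open>N\<close> components.\<close>

locale ring_of_components =
  fixes E :: "'e edge_end set" and N :: nat and p q :: "nat \<Rightarrow> 'e edge_end"
    and L :: "'e edge_end \<Rightarrow> nat" and \<sigma> :: "'e edge_end \<Rightarrow> 'e edge_end"
  assumes fin: "finite E" and opp: "opposite ` E \<subseteq> E" and perm: "\<sigma> permutes E"
    and N: "N \<ge> 1"
    and p_in: "\<And>j. 1 \<le> j \<Longrightarrow> j \<le> N \<Longrightarrow> p j \<in> E"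
    and q_in: "\<And>j. 1 \<le> j \<Longrightarrow> j \<le> N \<Longrightarrow> q j \<in> E"
    and L_p: "\<And>j. 1 \<le> j \<Longrightarrow> j \<le> N \<Longrightarrow> Suc (L (p j)) = j"
    and L_q: "\<And>j. 1 \<le> j \<Longrightarrow> j \<le> N \<Longrightarrow> L (q j) = j mod N"
    and neq: "\<And>i j. 1 \<le> i \<Longrightarrow> i \<le> N \<Longrightarrow> 1 \<le> j \<Longrightarrow> j \<le> N \<Longrightarrow> p i \<noteq> q j"
    and swap: "\<And>j. 1 \<le> j \<Longrightarrow> j \<le> N \<Longrightarrow> \<sigma> (p j) = q j"
      "\<And>j. 1 \<le> j \<Longrightarrow> j \<le> N \<Longrightarrow> \<sigma> (q j) = p j"
    and L_opp: "\<And>h. h \<in> E \<Longrightarrow> L (opposite h) = L h"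
    and L_rot: "\<And>h. h \<in> E \<Longrightarrow> h \<notin> p ` {1..N} \<union> q ` {1..N} \<Longrightarrow> L (\<sigma> h) = L h"
begin

definition pending :: "nat \<Rightarrow> 'e edge_end set" where
  "pending m = p ` {m<..N} \<union> q ` {m<..N}"

text \<open>Read off from the final \<open>\<sigma>\<close> rather than built up by gluing: at a
  pending joint both ends become fixed points, which cuts the joint into two pendant
  vertices.\<close>

definition stage :: "nat \<Rightarrow> 'e edge_end \<Rightarrow> 'e edge_end" where
  "stage m h = (if h \<in> pending m then h else \<sigma> h)"

lemma inj_rot: "\<sigma> x = \<sigma> y \<longleftrightarrow> x = y"
  using perm by (metis permutes_inverses(2))

lemma rot_in_pending: "\<sigma> h \<in> pending m \<longleftrightarrow> h \<in> pending m"
proof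
  assume "h \<in> pending m"
  then obtain j where j: "j \<in> {m<..N}" and "h = p j \<or> h = q j" by (auto simp: pending_def)
  then have "\<sigma> h = q j \<or> \<sigma> h = p j" using swap[of j] by auto
  then show "\<sigma> h \<in> pending m" using j by (auto simp: pending_def)
next
  assume "\<sigma> h \<in> pending m"
  then obtain j where j: "j \<in> {m<..N}" and "\<sigma> h = p j \<or> \<sigma> h = q j" by (auto simp: pending_def)
  then have "\<sigma> h = \<sigma> (q j) \<or> \<sigma> h = \<sigma> (p j)" using swap[of j] by auto
  then show "h \<in> pending m" using j by (auto simp: pending_def inj_rot)
qed

lemma stage_permutes: "stage m permutes E"
proof (rule bij_imp_permutes)
  have "inj_on (stage m) E"
    using rot_in_pending[of _ m] by (auto simp: inj_on_def stage_def inj_rot split: if_splits)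
  moreover have "stage m ` E \<subseteq> E"
    using perm by (auto simp: stage_def permutes_in_image)
  ultimately show "bij_betw (stage m) E E"
    using fin by (simp add: bij_betw_def endo_inj_surj)
  show "stage m x = x" if "x \<notin> E" for x
    using that perm by (simp add: stage_def permutes_not_in)
qed

lemma pq_inj:
  assumes "1 \<le> i" "i \<le> N" "1 \<le> j" "j \<le> N"
  shows "p i = p j \<longleftrightarrow> i = j" "q i = q j \<longleftrightarrow> i = j"
proof -
  show p: "p i = p j \<longleftrightarrow> i = j" using assms L_p by metis
  show "q i = q j \<longleftrightarrow> i = j" using assms swap(2) p by metis
qed

lemma notin_pending:
  assumes "1 \<le> j" "j \<le> m"
  shows "j \<le> N \<Longrightarrow> p j \<notin> pending m" "j \<le> N \<Longrightarrow> q j \<notin> pending m"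
proof -
  assume N: "j \<le> N"
  have "p j \<noteq> p i" "p j \<noteq> q i" "q j \<noteq> q i" "q j \<noteq> p i" if "i \<in> {m<..N}" for i
  proof -
    have i: "1 \<le> i" "i \<le> N" "i \<noteq> j" using that assms by auto
    show "p j \<noteq> p i" "p j \<noteq> q i" "q j \<noteq> q i" "q j \<noteq> p i"
      using pq_inj[OF assms(1) N i(1,2)] neq[OF assms(1) N i(1,2)] neq[OF i(1,2) assms(1) N] i(3)
      by simp_all
  qed
  then show "p j \<notin> pending m" "q j \<notin> pending m" unfolding pending_def by blast+
qed

text \<open>\<open>\<sigma>\<close> exchanges the two ends of a joint and never reaches them from
  elsewhere, so making one more joint is a single transposition.\<close>

lemma stage_Suc:
  assumes "m < N"
  shows "stage (Suc m) = transpose (p (Suc m)) (q (Suc m)) \<circ> stage m"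
proof
  fix h
  have S: "pending m = insert (p (Suc m)) (insert (q (Suc m)) (pending (Suc m)))"
  proof -
    have "{m<..N} = insert (Suc m) {Suc m<..N}" using assms by auto
    then show ?thesis by (auto simp: pending_def)
  qed
  have pq: "p (Suc m) \<notin> pending (Suc m)" "q (Suc m) \<notin> pending (Suc m)"
    using notin_pending[of "Suc m" "Suc m"] assms by auto
  have sw: "\<sigma> (p (Suc m)) = q (Suc m)" "\<sigma> (q (Suc m)) = p (Suc m)" using swap assms by auto
  consider "h = p (Suc m)" | "h = q (Suc m)" | "h \<in> pending (Suc m)" | "h \<notin> pending m"
    using S by auto
  then show "stage (Suc m) h = (transpose (p (Suc m)) (q (Suc m)) \<circ> stage m) h"
  proof cases
    case 3
    then have "h \<noteq> p (Suc m)" "h \<noteq> q (Suc m)" using pq by auto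
    then show ?thesis using 3 S by (simp add: stage_def transpose_apply_other)
  next
    case 4
    then have "\<sigma> h \<notin> pending m" using rot_in_pending by simp
    then have "\<sigma> h \<noteq> p (Suc m)" "\<sigma> h \<noteq> q (Suc m)" using S by auto
    then show ?thesis using 4 S by (simp add: stage_def transpose_apply_other)
  qed (use pq S sw in \<open>simp_all add: stage_def\<close>)
qed

text \<open>The joints already made, with index at most \<open>m\<close>, link only levels up to
  \<open>m\<close>; the joint \<open>N\<close>, which leads back to level 0, is still open because
  \<open>m < N\<close>. So the levels up to \<open>m\<close> form the separating set for the next
  joint.\<close>

lemma stage_level:
  assumes "m < N" "h \<in> E" "L h \<le> m"
  shows "L (stage m h) \<le> m"
proof (cases "h \<in> pending m")
  case True
  then show ?thesis using assms by (simp add: stage_def)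
next
  case False
  show ?thesis
  proof (cases "h \<in> p ` {1..N} \<union> q ` {1..N}")
    case True
    then obtain j where j: "1 \<le> j" "j \<le> N" "h = p j \<or> h = q j" by auto
    then have "j \<le> m" using False by (auto simp: pending_def)
    then have "L (p j) \<le> m" "L (q j) \<le> m"
      using L_p[OF j(1,2)] L_q[OF j(1,2)] assms(1) by auto
    then show ?thesis using j False by (auto simp: stage_def swap)
  next
    case False
    then show ?thesis using assms L_rot by (auto simp: stage_def)
  qed
qed

lemma num_orbits_stage:
  "m < N \<Longrightarrow> num_orbits (face_step (stage 0, T)) (E \<times> UNIV) =
    num_orbits (face_step (stage m, T)) (E \<times> UNIV) + 2 * m"
proof (induction m)
  case (Suc m)
  \<comment> \<open>\<open>p (Suc m)\<close> has level \<open>m\<close> and belongs to this set.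
    \<open>q (Suc m)\<close> has level \<open>Suc m\<close>, since \<open>Suc m < N\<close> keeps
    the modulus in \<open>L_q\<close> from wrapping around.\<close>
  let ?A = "{h \<in> E. L h \<le> m}"
  have m: "1 \<le> Suc m" "Suc m \<le> N" using Suc by auto
  have "stage (Suc m) = transpose (p (Suc m)) (q (Suc m)) \<circ> stage m"
    by (rule stage_Suc) (use Suc in simp)
  then have "num_orbits (face_step (stage m, T)) (E \<times> UNIV) =
    num_orbits (face_step (stage (Suc m), T)) (E \<times> UNIV) + 2"
  proof (rule ssubst)
    show "num_orbits (face_step (stage m, T)) (E \<times> UNIV) =
      num_orbits (face_step (transpose (p (Suc m)) (q (Suc m)) \<circ> stage m, T)) (E \<times> UNIV) + 2"
    proof (rule num_orbits_amalgamate[where A = ?A])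
    show "stage m ` ?A \<subseteq> ?A"
      using stage_level[of m] stage_permutes[of m] Suc by (auto simp: permutes_in_image)
    show "opposite ` ?A \<subseteq> ?A" using opp L_opp by auto
    show "p (Suc m) \<in> ?A" using p_in[OF m] L_p[OF m] by simp
    show "q (Suc m) \<notin> ?A" using L_q[OF m] Suc by simp
    show "stage m (p (Suc m)) = p (Suc m)" "stage m (q (Suc m)) = q (Suc m)"
      using m by (auto simp: stage_def pending_def)
  qed (use fin opp p_in[OF m] q_in[OF m] stage_permutes[of m] in
      \<open>auto simp: permutes_bij permutes_in_image\<close>)
  qed
  moreover have "num_orbits (face_step (stage 0, T)) (E \<times> UNIV) =
      num_orbits (face_step (stage m, T)) (E \<times> UNIV) + 2 * m"
    by (rule Suc.IH) (use Suc.prems in simp)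
  ultimately show ?case by simp
qed simp

lemma face_classes_ring:
  "\<bar>int (face_classes E (\<sigma>, T)) - (int (face_classes E (stage 0, T)) - int N + 1)\<bar> \<le> 1"
proof -
  define m where "m = N - 1"
  have m: "m < N" "Suc m = N" using N by (auto simp: m_def)
  have N': "1 \<le> N" "N \<le> N" using N by auto
  have sN: "\<sigma> = transpose (p N) (q N) \<circ> stage m"
    using stage_Suc[OF m(1)] m by (auto simp: stage_def pending_def fun_eq_iff)
  have "stage m (p N) = p N" "stage m (q N) = q N"
    using m by (auto simp: stage_def pending_def)
  note le = num_orbits_amalgamate_le[where \<sigma> = "stage m", OF _ fin _ opp p_in[OF N'] q_in[OF N'] this,
      of T, folded sN]
  have perm': "bij (stage m)" "stage m ` E \<subseteq> E" "bij \<sigma>" "\<sigma> ` E \<subseteq> E" "bij (stage 0)" "stage 0 ` E \<subseteq> E"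
    using perm stage_permutes[of m] stage_permutes[of 0] permutes_bij[OF stage_permutes]
    by (auto simp: permutes_bij permutes_in_image)
  have "num_orbits (face_step (stage m, T)) (E \<times> UNIV) \<le> num_orbits (face_step (\<sigma>, T)) (E \<times> UNIV) + 2"
    "num_orbits (face_step (\<sigma>, T)) (E \<times> UNIV) \<le> num_orbits (face_step (stage m, T)) (E \<times> UNIV) + 2"
    using le perm' by auto
  moreover have "num_orbits (face_step (stage 0, T)) (E \<times> UNIV) =
    num_orbits (face_step (stage m, T)) (E \<times> UNIV) + 2 * m"
    by (rule num_orbits_stage[OF m(1)])
  moreover have "num_orbits (face_step (\<sigma>, T)) (E \<times> UNIV) = 2 * face_classes E (\<sigma>, T)"
    "num_orbits (face_step (stage 0, T)) (E \<times> UNIV) = 2 * face_classes E (stage 0, T)"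
    using num_orbits_face_step fin opp perm' by auto
  ultimately show ?thesis using m(2) by linarith
qed

end

section \<open>A central limit theorem for bounded summands\<close>

lemma (in prob_space) integrable_bounded:
  fixes X :: "'a \<Rightarrow> real"
  assumes "random_variable borel X" "\<And>\<omega>. \<bar>X \<omega>\<bar> \<le> K"
  shows "integrable M X"
  by (rule integrable_const_bound[where B = K]) (use assms in auto)

lemma (in prob_space) expectation_square_sum_indep:
  fixes W :: "'i \<Rightarrow> 'a \<Rightarrow> real"
  assumes "finite I" "indep_vars (\<lambda>_. borel) W I"
    and "\<And>i \<omega>. \<bar>W i \<omega>\<bar> \<le> K" "\<And>i. i \<in> I \<Longrightarrow> expectation (W i) = 0"
  shows "expectation (\<lambda>\<omega>. (\<Sum>i\<in>I. W i \<omega>)\<^sup>2) = (\<Sum>i\<in>I. expectation (\<lambda>\<omega>. (W i \<omega>)\<^sup>2))"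
  using assms
proof (induction I rule: finite_induct)
  case (insert i F)
  let ?S = "\<lambda>\<omega>. \<Sum>j\<in>F. W j \<omega>"
  have K: "0 \<le> K" using insert.prems(2)[of i undefined] by linarith
  have rv: "random_variable borel (W j)" if "j \<in> insert i F" for j
    using insert.prems(1) that by (auto simp: indep_vars_def2)
  have rvS: "random_variable borel ?S" using rv by (intro borel_measurable_sum) auto
  have bS: "\<bar>?S \<omega>\<bar> \<le> card F * K" for \<omega>
    using sum_norm_bound[of F "\<lambda>j. W j \<omega>" K] insert.prems(2) by simp
  have indF: "indep_vars (\<lambda>_. borel) W F"
    by (rule indep_vars_subset[OF insert.prems(1)]) auto
  have int: "integrable M (W i)" "integrable M ?S"
    using integrable_bounded[OF rv[of i]] integrable_bounded[OF rvS bS] insert.prems(2) by auto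
  have intWS: "integrable M (\<lambda>\<omega>. W i \<omega> * ?S \<omega>)"
    by (rule integrable_bounded[where K = "K * (card F * K)"])
      (use rv rvS bS insert.prems(2) K in \<open>auto simp: abs_mult intro!: mult_mono\<close>)
  have int2: "integrable M (\<lambda>\<omega>. (W i \<omega>)\<^sup>2)" "integrable M (\<lambda>\<omega>. (?S \<omega>)\<^sup>2)"
     apply (rule integrable_bounded[where K = "K\<^sup>2"])
    subgoal using rv by simp
    subgoal using insert.prems(2) K by (simp add: abs_le_square_iff[symmetric])
    apply (rule integrable_bounded[where K = "(card F * K)\<^sup>2"])
    subgoal using rvS by simp
    subgoal using bS K by (simp add: abs_le_square_iff[symmetric])
    done
  have "indep_var borel (W i) borel ?S"
    by (rule indep_vars_sum) (use insert in auto)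
  then have "expectation (\<lambda>\<omega>. W i \<omega> * ?S \<omega>) = expectation (W i) * expectation ?S"
    by (rule indep_var_lebesgue_integral) (use int in auto)
  then have zero: "expectation (\<lambda>\<omega>. W i \<omega> * ?S \<omega>) = 0" using insert.prems(3) by simp
  have "expectation (\<lambda>\<omega>. (\<Sum>j\<in>insert i F. W j \<omega>)\<^sup>2) =
    expectation (\<lambda>\<omega>. (W i \<omega>)\<^sup>2 + (?S \<omega>)\<^sup>2 + 2 * (W i \<omega> * ?S \<omega>))"
    using insert.hyps by (simp add: power2_sum algebra_simps)
  also have "\<dots> = expectation (\<lambda>\<omega>. (W i \<omega>)\<^sup>2) + expectation (\<lambda>\<omega>. (?S \<omega>)\<^sup>2)"
    using int2 intWS zero by simp
  finally show ?case using insert indF by simp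
qed simp

lemma one_minus_exp_bound:
  fixes x :: real
  assumes "x \<ge> 0"
  shows "\<bar>(1 - x) - exp (- x)\<bar> \<le> x\<^sup>2"
proof -
  have "1 - x \<le> exp (- x)" using exp_ge_add_one_self[of "- x"] by simp
  moreover have "exp (- x) \<le> 1 - x + x\<^sup>2"
  proof -
    \<comment> \<open>The product equals \<open>1 + x ^ 3\<close>.\<close>
    have "1 \<le> (1 + x) * (1 - x + x\<^sup>2)"
      using assms by (simp add: algebra_simps power2_eq_square)
    also have "\<dots> \<le> exp x * (1 - x + x\<^sup>2)"
    proof (rule mult_right_mono)
      have "0 \<le> (1 - x)\<^sup>2 + x" using assms by simp
      then show "0 \<le> 1 - x + x\<^sup>2" by (simp add: power2_eq_square algebra_simps)
    qed (rule exp_ge_add_one_self)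
    finally show ?thesis by (simp add: exp_minus field_simps)
  qed
  ultimately show ?thesis by simp
qed

text \<open>Each factor of the characteristic function is compared with its second-order expansion,
  and that with an exponential; the factors have modulus at most one, so the errors add up. The
  first term of the bound comes from the third moments, the second from replacing
  \<open>1 - x i\<close> by \<open>exp (- x i)\<close>.\<close>

lemma (in prob_space) char_sum_indep_approx:
  fixes W :: "'i \<Rightarrow> 'a \<Rightarrow> real"
  assumes fin: "finite I" and ind: "indep_vars (\<lambda>_. borel) W I"
    and bd: "\<And>i \<omega>. \<bar>W i \<omega>\<bar> \<le> K" and mean: "\<And>i. i \<in> I \<Longrightarrow> expectation (W i) = 0"
    and t: "t > 0" and var: "(\<Sum>i\<in>I. expectation (\<lambda>\<omega>. (W i \<omega>)\<^sup>2)) = t\<^sup>2"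
  shows "cmod (char (distr M borel (\<lambda>\<omega>. (\<Sum>i\<in>I. W i \<omega>) / t)) \<theta> - exp (- \<theta>\<^sup>2 / 2))
    \<le> \<bar>\<theta>\<bar> ^ 3 * K / (6 * t) + \<theta> ^ 4 * K\<^sup>2 / (4 * t\<^sup>2)"
proof -
  define v where "v i = expectation (\<lambda>\<omega>. (W i \<omega>)\<^sup>2)" for i
  define \<phi> where "\<phi> i = char (distr M borel (\<lambda>\<omega>. W i \<omega> / t)) \<theta>" for i
  \<comment> \<open>The second-order terms. They add up to half the square of
    \<open>\<theta>\<close>, so the product of the \<open>exp (- x i)\<close> is the Gaussian
    characteristic function.\<close>
  define x where "x i = \<theta>\<^sup>2 * (v i / t\<^sup>2) / 2" for i
  have K: "0 \<le> K" using bd[of undefined undefined] by linarith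
  have rv: "random_variable borel (W i)" if "i \<in> I" for i
    using ind that by (auto simp: indep_vars_def2)
  have rvt: "random_variable borel (\<lambda>\<omega>. W i \<omega> / t)" if "i \<in> I" for i
    using rv[OF that] by simp
  have sq: "(W i \<omega>)\<^sup>2 \<le> K\<^sup>2" for i \<omega> using bd K by (simp add: abs_le_square_iff[symmetric])
  have intW: "integrable M (W i)" "integrable M (\<lambda>\<omega>. (W i \<omega>)\<^sup>2)" if "i \<in> I" for i
    using integrable_bounded[OF rv[OF that] bd]
      integrable_bounded[of "\<lambda>\<omega>. (W i \<omega>)\<^sup>2" "K\<^sup>2"] rv[OF that] sq by auto
  have v: "0 \<le> v i" "v i \<le> K\<^sup>2" if "i \<in> I" for i
  proof -
    show "0 \<le> v i" by (simp add: v_def)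
    have "v i \<le> expectation (\<lambda>_. K\<^sup>2)"
      unfolding v_def by (rule integral_mono) (use intW[OF that] sq in auto)
    then show "v i \<le> K\<^sup>2" by (simp add: prob_space)
  qed
  have x0: "0 \<le> x i" if "i \<in> I" for i using v[OF that] by (simp add: x_def)
  have "char (distr M borel (\<lambda>\<omega>. (\<Sum>i\<in>I. W i \<omega>) / t)) \<theta> =
    char (distr M borel (\<lambda>\<omega>. \<Sum>i\<in>I. W i \<omega> / t)) \<theta>"
    by (simp add: sum_divide_distrib)
  also have "\<dots> = (\<Prod>i\<in>I. \<phi> i)"
    unfolding \<phi>_def
    by (rule char_distr_sum, rule indep_vars_compose2[OF ind]) auto
  finally have prod: "char (distr M borel (\<lambda>\<omega>. (\<Sum>i\<in>I. W i \<omega>) / t)) \<theta> = (\<Prod>i\<in>I. \<phi> i)" .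
  have "(\<Sum>i\<in>I. x i) = \<theta>\<^sup>2 / (2 * t\<^sup>2) * (\<Sum>i\<in>I. v i)"
  proof -
    have "x i = \<theta>\<^sup>2 / (2 * t\<^sup>2) * v i" for i by (simp add: x_def)
    then show ?thesis by (simp only: sum_distrib_left)
  qed
  also have "\<dots> = \<theta>\<^sup>2 / 2" using t var by (simp add: v_def)
  finally have sumx: "(\<Sum>i\<in>I. x i) = \<theta>\<^sup>2 / 2" .
  have "(\<Prod>i\<in>I. complex_of_real (exp (- x i))) = complex_of_real (exp (- (\<Sum>i\<in>I. x i)))"
    using fin by (simp add: exp_sum sum_negf[symmetric] del: of_real_exp)
  also have "\<dots> = exp (- \<theta>\<^sup>2 / 2)" by (simp add: sumx exp_of_real[symmetric])
  finally have gauss: "exp (- \<theta>\<^sup>2 / 2) = (\<Prod>i\<in>I. complex_of_real (exp (- x i)))" by simp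
  have summand: "cmod (\<phi> i - complex_of_real (exp (- x i)))
      \<le> \<bar>\<theta>\<bar> ^ 3 * K / (6 * t) * (v i / t\<^sup>2) + \<theta>\<^sup>2 * K\<^sup>2 / (2 * t\<^sup>2) * x i" if i: "i \<in> I" for i
  proof -
    let ?X = "\<lambda>\<omega>. W i \<omega> / t"
    have int: "integrable M ?X" "integrable M (\<lambda>\<omega>. (?X \<omega>)\<^sup>2)"
      using intW[OF i] by (auto simp: power_divide)
    have m0: "expectation ?X = 0" using mean[OF i] by simp
    have vX: "variance ?X = v i / t\<^sup>2" using mean[OF i] by (simp add: power_divide v_def)
    have "cmod (\<phi> i - (1 - \<theta>\<^sup>2 * (v i / t\<^sup>2) / 2))
        \<le> (\<theta>\<^sup>2 / 6) * expectation (\<lambda>\<omega>. min (6 * (?X \<omega>)\<^sup>2) (\<bar>\<theta>\<bar> * \<bar>?X \<omega>\<bar> ^ 3))"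
      unfolding \<phi>_def by (rule char_approx3'[OF rvt[OF i] int m0 vX refl])
    \<comment> \<open>The cubic branch of the minimum is used: one factor
      \<open>\<bar>?X \<omega>\<bar>\<close> is at most \<open>K / t\<close>, and what remains is a
      variance.\<close>
    also have "\<dots> \<le> (\<theta>\<^sup>2 / 6) * expectation (\<lambda>\<omega>. \<bar>\<theta>\<bar> * K / t * (?X \<omega>)\<^sup>2)"
    proof (intro mult_left_mono integral_mono)
      show "integrable M (\<lambda>\<omega>. min (6 * (?X \<omega>)\<^sup>2) (\<bar>\<theta>\<bar> * \<bar>?X \<omega>\<bar> ^ 3))"
      proof (rule Bochner_Integration.integrable_bound[of M "\<lambda>\<omega>. 6 * (?X \<omega>)\<^sup>2"])
        have [measurable]: "random_variable borel (W i)" by (rule rv[OF i])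
        show "random_variable borel (\<lambda>\<omega>. min (6 * (?X \<omega>)\<^sup>2) (\<bar>\<theta>\<bar> * \<bar>?X \<omega>\<bar> ^ 3))" by measurable
      qed (use int in \<open>auto simp: abs_le_iff min_le_iff_disj\<close>)
      show "integrable M (\<lambda>\<omega>. \<bar>\<theta>\<bar> * K / t * (?X \<omega>)\<^sup>2)" using int by simp
      fix \<omega>
      have "\<bar>?X \<omega>\<bar> \<le> K / t" using bd[of i \<omega>] t by (simp add: divide_right_mono)
      then have "\<bar>?X \<omega>\<bar> * (?X \<omega>)\<^sup>2 \<le> K / t * (?X \<omega>)\<^sup>2" by (rule mult_right_mono) simp
      then have "\<bar>?X \<omega>\<bar> ^ 3 \<le> K / t * (?X \<omega>)\<^sup>2"
        by (simp add: power3_eq_cube power2_eq_square flip: abs_mult)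
      then have "\<bar>\<theta>\<bar> * \<bar>?X \<omega>\<bar> ^ 3 \<le> \<bar>\<theta>\<bar> * (K / t * (?X \<omega>)\<^sup>2)" by (rule mult_left_mono) simp
      then show "min (6 * (?X \<omega>)\<^sup>2) (\<bar>\<theta>\<bar> * \<bar>?X \<omega>\<bar> ^ 3) \<le> \<bar>\<theta>\<bar> * K / t * (?X \<omega>)\<^sup>2"
        by (simp add: min_le_iff_disj mult.assoc)
    qed simp
    also have "expectation (\<lambda>\<omega>. \<bar>\<theta>\<bar> * K / t * (?X \<omega>)\<^sup>2) = \<bar>\<theta>\<bar> * K / t * (v i / t\<^sup>2)"
      by (simp add: power_divide v_def)
    also have "\<theta>\<^sup>2 / 6 * (\<bar>\<theta>\<bar> * K / t * (v i / t\<^sup>2)) = \<bar>\<theta>\<bar> ^ 3 * K / (6 * t) * (v i / t\<^sup>2)"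
    proof -
      have "a\<^sup>2 / 6 * (a * K / t * w) = a ^ 3 * K / (6 * t) * w" for a w :: real
        by (simp add: power3_eq_cube power2_eq_square)
      from this[of "\<bar>\<theta>\<bar>" "v i / t\<^sup>2"] show ?thesis by (simp only: power2_abs)
    qed
    finally have 1: "cmod (\<phi> i - (1 - x i)) \<le> \<bar>\<theta>\<bar> ^ 3 * K / (6 * t) * (v i / t\<^sup>2)"
      by (simp add: x_def)
    have "cmod (complex_of_real (1 - x i) - complex_of_real (exp (- x i))) = \<bar>(1 - x i) - exp (- x i)\<bar>"
      by (metis norm_of_real of_real_diff)
    also have "\<dots> \<le> (x i)\<^sup>2" by (rule one_minus_exp_bound[OF x0[OF i]])
    also have "\<dots> = x i * x i" by (simp add: power2_eq_square)
    also have "\<dots> \<le> \<theta>\<^sup>2 * K\<^sup>2 / (2 * t\<^sup>2) * x i"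
    proof (rule mult_right_mono[OF _ x0[OF i]])
      have "\<theta>\<^sup>2 / (2 * t\<^sup>2) * v i \<le> \<theta>\<^sup>2 / (2 * t\<^sup>2) * K\<^sup>2"
        by (rule mult_left_mono[OF v(2)[OF i]]) simp
      then show "x i \<le> \<theta>\<^sup>2 * K\<^sup>2 / (2 * t\<^sup>2)" by (simp add: x_def)
    qed
    finally have 2: "cmod (complex_of_real (1 - x i) - complex_of_real (exp (- x i)))
      \<le> \<theta>\<^sup>2 * K\<^sup>2 / (2 * t\<^sup>2) * x i" .
    show ?thesis
      using norm_triangle_le[OF add_mono[OF 1 2]] by (simp add: algebra_simps)
  qed
  have "cmod ((\<Prod>i\<in>I. \<phi> i) - (\<Prod>i\<in>I. complex_of_real (exp (- x i))))
    \<le> (\<Sum>i\<in>I. cmod (\<phi> i - complex_of_real (exp (- x i))))"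
  proof (rule norm_prod_diff)
    show "cmod (\<phi> i) \<le> 1" if "i \<in> I" for i
    proof -
      interpret D: real_distribution "distr M borel (\<lambda>\<omega>. W i \<omega> / t)"
        by (rule real_distribution_distr) (rule rvt[OF that])
      show ?thesis unfolding \<phi>_def by (rule D.cmod_char_le_1)
    qed
    show "cmod (complex_of_real (exp (- x i))) \<le> 1" if "i \<in> I" for i
      using x0[OF that] by (simp del: of_real_exp)
  qed
  also have "\<dots> \<le> (\<Sum>i\<in>I. \<bar>\<theta>\<bar> ^ 3 * K / (6 * t) * (v i / t\<^sup>2) + \<theta>\<^sup>2 * K\<^sup>2 / (2 * t\<^sup>2) * x i)"
    by (rule sum_mono) (rule summand)
  also have "\<dots> = \<bar>\<theta>\<bar> ^ 3 * K / (6 * t) * ((\<Sum>i\<in>I. v i) / t\<^sup>2) + \<theta>\<^sup>2 * K\<^sup>2 / (2 * t\<^sup>2) * (\<Sum>i\<in>I. x i)"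
    by (simp only: sum.distrib sum_distrib_left sum_divide_distrib)
  also have "(\<Sum>i\<in>I. v i) / t\<^sup>2 = 1" using var t by (simp add: v_def)
  also have "\<bar>\<theta>\<bar> ^ 3 * K / (6 * t) * 1 + \<theta>\<^sup>2 * K\<^sup>2 / (2 * t\<^sup>2) * (\<Sum>i\<in>I. x i) =
    \<bar>\<theta>\<bar> ^ 3 * K / (6 * t) + \<theta> ^ 4 * K\<^sup>2 / (4 * t\<^sup>2)"
    unfolding sumx by (simp add: power2_eq_square power4_eq_xxxx)
  finally show ?thesis unfolding prod gauss .
qed

section \<open>Bounded perturbations of a standardized sum\<close>

lemma cmod_iexp_diff_le: "cmod (iexp a - iexp b) \<le> \<bar>a - b\<bar>"
proof -
  have "iexp a - iexp b = iexp b * (iexp (a - b) - 1)"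
    by (simp add: algebra_simps exp_add[symmetric])
  then have "cmod (iexp a - iexp b) = cmod (iexp (a - b) - 1)" by (simp add: norm_mult)
  also have "\<dots> \<le> \<bar>a - b\<bar>" using iexp_approx1[of "a - b" 0] by simp
  finally show ?thesis .
qed

lemma (in prob_space) char_distr_diff_le:
  fixes X Y :: "'a \<Rightarrow> real"
  assumes [measurable]: "random_variable borel X" "random_variable borel Y"
    and int: "integrable M (\<lambda>\<omega>. X \<omega> - Y \<omega>)"
  shows "cmod (char (distr M borel X) \<theta> - char (distr M borel Y) \<theta>)
    \<le> \<bar>\<theta>\<bar> * expectation (\<lambda>\<omega>. \<bar>X \<omega> - Y \<omega>\<bar>)"
proof -
  have intX: "integrable M (\<lambda>\<omega>. iexp (\<theta> * Z \<omega>))" if [measurable]: "random_variable borel Z" for Z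
    by (rule integrable_const_bound[where B = 1]) auto
  have "char (distr M borel X) \<theta> - char (distr M borel Y) \<theta> =
    (CLINT \<omega>|M. iexp (\<theta> * X \<omega>) - iexp (\<theta> * Y \<omega>))"
    using intX[OF assms(1)] intX[OF assms(2)] by (simp add: char_def integral_distr)
  also have "cmod \<dots> \<le> expectation (\<lambda>\<omega>. cmod (iexp (\<theta> * X \<omega>) - iexp (\<theta> * Y \<omega>)))"
    by (rule integral_norm_bound)
  also have "\<dots> \<le> expectation (\<lambda>\<omega>. \<bar>\<theta>\<bar> * \<bar>X \<omega> - Y \<omega>\<bar>)"
  proof (rule integral_mono)
    show "integrable M (\<lambda>\<omega>. cmod (iexp (\<theta> * X \<omega>) - iexp (\<theta> * Y \<omega>)))"
      using intX[OF assms(1)] intX[OF assms(2)] by (intro integrable_norm) simp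
    show "integrable M (\<lambda>\<omega>. \<bar>\<theta>\<bar> * \<bar>X \<omega> - Y \<omega>\<bar>)" using int by simp
    show "cmod (iexp (\<theta> * X \<omega>) - iexp (\<theta> * Y \<omega>)) \<le> \<bar>\<theta>\<bar> * \<bar>X \<omega> - Y \<omega>\<bar>" for \<omega>
      using cmod_iexp_diff_le[of "\<theta> * X \<omega>" "\<theta> * Y \<omega>"]
      by (simp add: abs_mult flip: right_diff_distrib)
  qed
  finally show ?thesis by simp
qed

text \<open>The error may depend on \<open>S\<close>, so its covariance with \<open>S\<close> has to
  be estimated; it is at most \<open>2 * C * t\<close> in absolute value. Hence the standard
  deviation of \<open>X\<close> stays within a constant of \<open>t\<close>, and the two
  standardized variables are close in mean absolute distance, which controls the characteristic
  functions.\<close>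

lemma (in prob_space) char_standardize_perturbed:
  fixes S X :: "'a \<Rightarrow> real"
  assumes rv [measurable]: "random_variable borel S" "random_variable borel X"
    and bS: "\<And>\<omega>. \<bar>S \<omega>\<bar> \<le> B" and mS: "expectation S = 0" and vS: "expectation (\<lambda>\<omega>. (S \<omega>)\<^sup>2) = t\<^sup>2"
    and dist: "AE \<omega> in M. \<bar>X \<omega> - A - S \<omega>\<bar> \<le> C"
    and t: "t \<ge> 1" "t > 4 * C + 4 * C\<^sup>2"
  shows "cmod (char (distr M borel (\<lambda>\<omega>. (X \<omega> - expectation X) / sqrt (variance X))) \<theta>
      - char (distr M borel (\<lambda>\<omega>. S \<omega> / t)) \<theta>)
    \<le> \<bar>\<theta>\<bar> * (6 * C + 4 * C\<^sup>2) / (t - (4 * C + 4 * C\<^sup>2))"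
proof -
  define Z where "Z = (\<lambda>\<omega>. X \<omega> - A - S \<omega>)"
  define D where "D = (\<lambda>\<omega>. Z \<omega> - expectation Z)"
  define s where "s = sqrt (variance X)"
  have [measurable]: "random_variable borel Z" "random_variable borel D" by (simp_all add: Z_def D_def)
  have C: "0 \<le> C"
  proof -
    have "AE \<omega> in M. 0 \<le> C" using dist by eventually_elim linarith
    then show ?thesis by (simp add: AE_const)
  qed
  have iS: "integrable M S" by (rule integrable_bounded[OF rv(1) bS])
  have B: "0 \<le> B" using bS[of undefined] by linarith
  have iS2: "integrable M (\<lambda>\<omega>. (S \<omega>)\<^sup>2)"
    by (rule integrable_bounded[where K = "B\<^sup>2"])
      (use bS B in \<open>auto simp: abs_le_square_iff[symmetric]\<close>)
  have bZ: "AE \<omega> in M. norm (Z \<omega>) \<le> C" using dist by (simp add: Z_def)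
  have iZ: "integrable M Z" by (rule integrable_const_bound[OF bZ]) simp
  have eZ: "\<bar>expectation Z\<bar> \<le> C"
  proof -
    have "\<bar>expectation Z\<bar> \<le> expectation (\<lambda>\<omega>. \<bar>Z \<omega>\<bar>)" by (rule integral_abs_bound)
    also have "\<dots> \<le> expectation (\<lambda>_. C)"
      by (rule integral_mono_AE) (use iZ bZ in auto)
    finally show ?thesis by (simp add: prob_space)
  qed
  have bD: "AE \<omega> in M. \<bar>D \<omega>\<bar> \<le> 2 * C"
    using bZ by eventually_elim (use eZ in \<open>auto simp: D_def\<close>)
  have iD: "integrable M D" using iZ by (simp add: D_def)
  have bD2: "AE \<omega> in M. (D \<omega>)\<^sup>2 \<le> 4 * C\<^sup>2"
    using bD
  proof eventually_elim
    case (elim \<omega>)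
    then have "(D \<omega>)\<^sup>2 \<le> (2 * C)\<^sup>2" using C abs_le_square_iff[of "D \<omega>" "2 * C"] by simp
    then show ?case by (simp add: power_mult_distrib)
  qed
  then have iD2: "integrable M (\<lambda>\<omega>. (D \<omega>)\<^sup>2)"
    by (intro integrable_const_bound[where B = "4 * C\<^sup>2"]) auto
  have iSD: "integrable M (\<lambda>\<omega>. S \<omega> * D \<omega>)"
  proof (rule integrable_const_bound[where B = "B * (2 * C)"])
    show "AE \<omega> in M. norm (S \<omega> * D \<omega>) \<le> B * (2 * C)"
      using bD by eventually_elim (use bS B in \<open>auto simp: abs_mult intro!: mult_mono\<close>)
  qed simp
  have XZ: "X = (\<lambda>\<omega>. A + S \<omega> + Z \<omega>)" by (auto simp: Z_def)
  have eX: "expectation X = A + expectation Z"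
    unfolding XZ using iS iZ mS by (simp add: prob_space)
  have XD: "X \<omega> - expectation X = S \<omega> + D \<omega>" for \<omega> by (simp add: eX D_def Z_def)
  \<comment> \<open>The second moment dominates the square of the first absolute moment, as a
    variance is nonnegative.\<close>
  have ES: "expectation (\<lambda>\<omega>. \<bar>S \<omega>\<bar>) \<le> t"
  proof -
    have "0 \<le> variance (\<lambda>\<omega>. \<bar>S \<omega>\<bar>)" by (rule variance_positive)
    also have "\<dots> = t\<^sup>2 - (expectation (\<lambda>\<omega>. \<bar>S \<omega>\<bar>))\<^sup>2"
      using iS iS2 by (subst variance_eq) (auto simp: vS)
    finally show ?thesis using t(1) by (simp add: abs_le_square_iff[symmetric])
  qed
  have ES0: "0 \<le> expectation (\<lambda>\<omega>. \<bar>S \<omega>\<bar>)" by simp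
  have "variance X = expectation (\<lambda>\<omega>. (S \<omega>)\<^sup>2 + 2 * (S \<omega> * D \<omega>) + (D \<omega>)\<^sup>2)"
    unfolding XD by (simp add: power2_sum algebra_simps)
  also have "\<dots> = t\<^sup>2 + 2 * expectation (\<lambda>\<omega>. S \<omega> * D \<omega>) + expectation (\<lambda>\<omega>. (D \<omega>)\<^sup>2)"
    using iS2 iSD iD2 by (simp add: vS)
  finally have var: "variance X = t\<^sup>2 + 2 * expectation (\<lambda>\<omega>. S \<omega> * D \<omega>) + expectation (\<lambda>\<omega>. (D \<omega>)\<^sup>2)" .
  have "\<bar>expectation (\<lambda>\<omega>. S \<omega> * D \<omega>)\<bar> \<le> expectation (\<lambda>\<omega>. \<bar>S \<omega> * D \<omega>\<bar>)" by (rule integral_abs_bound)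
  also have "\<dots> \<le> expectation (\<lambda>\<omega>. 2 * C * \<bar>S \<omega>\<bar>)"
  proof (rule integral_mono_AE)
    show "AE \<omega> in M. \<bar>S \<omega> * D \<omega>\<bar> \<le> 2 * C * \<bar>S \<omega>\<bar>"
      using bD
    proof eventually_elim
      case (elim \<omega>)
      then have "\<bar>S \<omega>\<bar> * \<bar>D \<omega>\<bar> \<le> \<bar>S \<omega>\<bar> * (2 * C)" by (rule mult_left_mono) simp
      then show ?case by (simp add: abs_mult mult.commute)
    qed
  qed (use iSD iS in auto)
  also have "\<dots> \<le> 2 * C * t" using ES C by (simp add: mult_left_mono)
  finally have SD: "\<bar>expectation (\<lambda>\<omega>. S \<omega> * D \<omega>)\<bar> \<le> 2 * C * t" .
  have D2: "0 \<le> expectation (\<lambda>\<omega>. (D \<omega>)\<^sup>2)" "expectation (\<lambda>\<omega>. (D \<omega>)\<^sup>2) \<le> 4 * C\<^sup>2"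
  proof -
    have "expectation (\<lambda>\<omega>. (D \<omega>)\<^sup>2) \<le> expectation (\<lambda>_. 4 * C\<^sup>2)"
      by (rule integral_mono_AE) (use iD2 bD2 in auto)
    then show "expectation (\<lambda>\<omega>. (D \<omega>)\<^sup>2) \<le> 4 * C\<^sup>2" by (simp add: prob_space)
  qed simp
  \<comment> \<open>A bound for \<open>\<bar>s - t\<bar>\<close>: the squares differ by at most
    \<open>4 * C * t\<close> from the covariance plus a constant from the error itself, together at
    most \<open>E * t\<close> as \<open>t \<ge> 1\<close>, and dividing by
    \<open>s + t \<ge> t\<close> leaves \<open>E\<close>.\<close>
  define E where "E = 4 * C + 4 * C\<^sup>2"
  have s2: "s\<^sup>2 = variance X" unfolding s_def by (simp add: variance_positive)
  have s0: "0 \<le> s" unfolding s_def by (simp add: variance_positive)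
  have "\<bar>s\<^sup>2 - t\<^sup>2\<bar> \<le> 4 * C * t + 4 * C\<^sup>2"
    unfolding s2 var using SD D2 by linarith
  also have "\<dots> \<le> E * t"
    using t(1) C mult_left_mono[of 1 t "4 * C\<^sup>2"] by (simp add: E_def algebra_simps)
  finally have "\<bar>s\<^sup>2 - t\<^sup>2\<bar> \<le> E * t" .
  moreover have "s\<^sup>2 - t\<^sup>2 = (s - t) * (s + t)" by (simp add: power2_eq_square algebra_simps)
  ultimately have "\<bar>s - t\<bar> * (s + t) \<le> E * t"
    using s0 t(1) by (simp add: abs_mult)
  moreover have "\<bar>s - t\<bar> * t \<le> \<bar>s - t\<bar> * (s + t)" by (rule mult_left_mono) (use s0 in auto)
  ultimately have "\<bar>s - t\<bar> * t \<le> E * t" by linarith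
  then have st: "\<bar>s - t\<bar> \<le> E" using t(1) by simp
  have spos: "s \<ge> t - E" "t - E > 0" "s > 0" using st t(2) by (auto simp: E_def)
  \<comment> \<open>The first summand is the cost of dividing by \<open>s\<close> instead of
    \<open>t\<close>, in mean at most \<open>E / s\<close>; the second is the centred error, at most
    \<open>2 * C / s\<close>. Their sum is the constant of the statement.\<close>
  have diff: "(X \<omega> - expectation X) / s - S \<omega> / t = S \<omega> * ((t - s) / (s * t)) + D \<omega> / s" for \<omega>
    unfolding XD using spos t(1) by (simp add: field_simps)
  have "cmod (char (distr M borel (\<lambda>\<omega>. (X \<omega> - expectation X) / s)) \<theta>
      - char (distr M borel (\<lambda>\<omega>. S \<omega> / t)) \<theta>)
    \<le> \<bar>\<theta>\<bar> * expectation (\<lambda>\<omega>. \<bar>(X \<omega> - expectation X) / s - S \<omega> / t\<bar>)"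
    by (rule char_distr_diff_le) (use iS iD in \<open>auto simp: diff\<close>)
  also have "expectation (\<lambda>\<omega>. \<bar>(X \<omega> - expectation X) / s - S \<omega> / t\<bar>) \<le> (6 * C + 4 * C\<^sup>2) / (t - E)"
  proof -
    have "expectation (\<lambda>\<omega>. \<bar>(X \<omega> - expectation X) / s - S \<omega> / t\<bar>) \<le>
      expectation (\<lambda>\<omega>. \<bar>S \<omega>\<bar> * (E / (s * t)) + 2 * C / s)"
    proof (rule integral_mono_AE)
      show "AE \<omega> in M. \<bar>(X \<omega> - expectation X) / s - S \<omega> / t\<bar> \<le> \<bar>S \<omega>\<bar> * (E / (s * t)) + 2 * C / s"
        using bD
      proof eventually_elim
        case (elim \<omega>)
        have "\<bar>S \<omega> * ((t - s) / (s * t))\<bar> = \<bar>S \<omega>\<bar> * (\<bar>s - t\<bar> / (s * t))"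
          using spos t(1) by (simp add: abs_mult abs_minus_commute)
        also have "\<dots> \<le> \<bar>S \<omega>\<bar> * (E / (s * t))"
          using st spos t(1) by (intro mult_left_mono divide_right_mono) auto
        finally have "\<bar>S \<omega> * ((t - s) / (s * t))\<bar> \<le> \<bar>S \<omega>\<bar> * (E / (s * t))" .
        moreover have "\<bar>D \<omega> / s\<bar> \<le> 2 * C / s" using elim spos by (simp add: divide_right_mono)
        ultimately show ?case unfolding diff by linarith
      qed
      show "integrable M (\<lambda>\<omega>. \<bar>(X \<omega> - expectation X) / s - S \<omega> / t\<bar>)"
        unfolding diff using iS iD by (intro integrable_abs) auto
      show "integrable M (\<lambda>\<omega>. \<bar>S \<omega>\<bar> * (E / (s * t)) + 2 * C / s)" using iS by simp
    qed
    also have "\<dots> = expectation (\<lambda>\<omega>. \<bar>S \<omega>\<bar>) * (E / (s * t)) + 2 * C / s"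
      using iS by (simp add: prob_space)
    also have "\<dots> \<le> t * (E / (s * t)) + 2 * C / s"
      using ES spos t(1) C by (intro add_right_mono mult_right_mono) (auto simp: E_def)
    also have "\<dots> = (6 * C + 4 * C\<^sup>2) / s"
      using t(1) spos by (simp add: E_def field_simps)
    also have "\<dots> \<le> (6 * C + 4 * C\<^sup>2) / (t - E)"
      using spos C by (intro divide_left_mono) auto
    finally show ?thesis .
  qed
  finally show ?thesis unfolding s_def E_def by (simp add: mult_left_mono)
qed

theorem asymptotically_normal_perturbed_sum:
  fixes P :: "nat \<Rightarrow> 'a pmf" and W :: "nat \<Rightarrow> nat \<Rightarrow> 'a \<Rightarrow> real" and X :: "nat \<Rightarrow> 'a \<Rightarrow> real"
  assumes ind: "\<And>n. n \<ge> 1 \<Longrightarrow> prob_space.indep_vars (P n) (\<lambda>_. borel) (W n) {1..n}"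
    and bd: "\<And>n i \<omega>. \<bar>W n i \<omega>\<bar> \<le> K"
    and mean: "\<And>n i. 1 \<le> i \<Longrightarrow> i \<le> n \<Longrightarrow> measure_pmf.expectation (P n) (W n i) = 0"
    and var: "filterlim (\<lambda>n. \<Sum>i=1..n. measure_pmf.expectation (P n) (\<lambda>\<omega>. (W n i \<omega>)\<^sup>2)) at_top sequentially"
    and dist: "\<And>n \<omega>. n \<ge> 1 \<Longrightarrow> \<omega> \<in> set_pmf (P n) \<Longrightarrow> \<bar>X n \<omega> - A n - (\<Sum>i=1..n. W n i \<omega>)\<bar> \<le> C"
  shows "asymptotically_normal P X"
  unfolding asymptotically_normal_def
proof (rule levy_continuity)
  show "real_distribution (distr (measure_pmf (P n)) borel
     (\<lambda>\<omega>. (X n \<omega> - measure_pmf.expectation (P n) (X n)) / sqrt (measure_pmf.variance (P n) (X n))))" for n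
    by (rule prob_space.real_distribution_distr) (auto intro: measure_pmf.prob_space_axioms)
  show "real_distribution std_normal_distribution" by (rule real_dist_normal_dist)
next
  fix \<theta> :: real
  define v where "v n = (\<Sum>i=1..n. measure_pmf.expectation (P n) (\<lambda>\<omega>. (W n i \<omega>)\<^sup>2))" for n
  define t where "t n = sqrt (v n)" for n
  define \<psi> where "\<psi> n = char (distr (measure_pmf (P n)) borel (\<lambda>\<omega>. (X n \<omega> -
    measure_pmf.expectation (P n) (X n)) / sqrt (measure_pmf.variance (P n) (X n)))) \<theta>" for n
  have v0: "0 \<le> v n" for n unfolding v_def by (intro sum_nonneg) simp
  have tlim: "filterlim t at_top sequentially"
    unfolding t_def using var by (intro filterlim_compose[OF sqrt_at_top]) (simp add: v_def)
  \<comment> \<open>The errors of the Gaussian approximation and of the perturbation together, as a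
    function of the standard deviation of the sum.\<close>
  define b where "b x = (\<bar>\<theta>\<bar> ^ 3 * K / (6 * x) + \<theta> ^ 4 * K\<^sup>2 / (4 * x\<^sup>2)) +
    \<bar>\<theta>\<bar> * (6 * C + 4 * C\<^sup>2) / (x - (4 * C + 4 * C\<^sup>2))" for x
  have "(b \<longlongrightarrow> 0) at_top" unfolding b_def by real_asymp
  then have blim: "(\<lambda>n. b (t n)) \<longlonglongrightarrow> 0" using tlim by (rule filterlim_compose)
  have "eventually (\<lambda>n. t n > max 1 (4 * C + 4 * C\<^sup>2)) sequentially"
    using tlim unfolding filterlim_at_top_dense by blast
  then have ev: "eventually (\<lambda>n. cmod (\<psi> n - exp (- \<theta>\<^sup>2 / 2)) \<le> b (t n)) sequentially"
    using eventually_ge_at_top[of 1]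
  proof eventually_elim
    case (elim n)
    let ?S = "\<lambda>\<omega>. \<Sum>i=1..n. W n i \<omega>"
    have t2: "(t n)\<^sup>2 = v n" using v0 by (simp add: t_def)
    have bS: "\<bar>?S \<omega>\<bar> \<le> n * K" for \<omega>
      using sum_norm_bound[of "{1..n}" "\<lambda>i. W n i \<omega>" K] bd by simp
    have intW: "integrable (P n) (W n i)" for i by (rule measure_pmf.integrable_bounded[OF _ bd]) simp
    have 1: "cmod (char (distr (measure_pmf (P n)) borel (\<lambda>\<omega>. ?S \<omega> / t n)) \<theta> - exp (- \<theta>\<^sup>2 / 2))
      \<le> \<bar>\<theta>\<bar> ^ 3 * K / (6 * t n) + \<theta> ^ 4 * K\<^sup>2 / (4 * (t n)\<^sup>2)"
      by (rule measure_pmf.char_sum_indep_approx[OF _ ind bd mean]) (use elim t2 in \<open>auto simp: v_def\<close>)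
    have 2: "cmod (\<psi> n - char (distr (measure_pmf (P n)) borel (\<lambda>\<omega>. ?S \<omega> / t n)) \<theta>)
      \<le> \<bar>\<theta>\<bar> * (6 * C + 4 * C\<^sup>2) / (t n - (4 * C + 4 * C\<^sup>2))"
      unfolding \<psi>_def
    proof (rule measure_pmf.char_standardize_perturbed[OF _ _ bS])
      show "measure_pmf.expectation (P n) ?S = 0" using intW mean by (simp add: integral_sum)
      show "measure_pmf.expectation (P n) (\<lambda>\<omega>. (?S \<omega>)\<^sup>2) = (t n)\<^sup>2"
        unfolding t2 v_def
        by (rule measure_pmf.expectation_square_sum_indep[OF _ ind bd mean]) (use elim in auto)
      show "AE \<omega> in P n. \<bar>X n \<omega> - A n - ?S \<omega>\<bar> \<le> C"
        using dist elim by (auto simp: AE_measure_pmf_iff)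
    qed (use elim in auto)
    show ?case
      using norm_triangle_le[OF add_mono[OF 1 2]] unfolding b_def by (simp add: norm_minus_commute)
  qed
  have "\<psi> \<longlonglongrightarrow> exp (- \<theta>\<^sup>2 / 2)"
  proof -
    have "(\<lambda>n. \<psi> n - exp (- \<theta>\<^sup>2 / 2)) \<longlonglongrightarrow> 0" by (rule Lim_null_comparison[OF ev blim])
    then show ?thesis by (simp add: LIM_zero_iff)
  qed
  then show "(\<lambda>n. char (distr (measure_pmf (P n)) borel (\<lambda>\<omega>. (X n \<omega> -
    measure_pmf.expectation (P n) (X n)) / sqrt (measure_pmf.variance (P n) (X n)))) \<theta>)
    \<longlonglongrightarrow> char std_normal_distribution \<theta>"
    by (simp add: \<psi>_def[abs_def] char_std_normal_distribution exp_of_real[symmetric])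
qed

section \<open>Independence and normal limits along maps of the sample space\<close>

lemma indep_vars_map_pmf:
  assumes "prob_space.indep_vars (measure_pmf (map_pmf f p)) (\<lambda>_. count_space UNIV) X I"
  shows "prob_space.indep_vars (measure_pmf p) (\<lambda>_. count_space UNIV) (\<lambda>i \<omega>. X i (f \<omega>)) I"
  unfolding prob_space.indep_vars_def2[OF measure_pmf.prob_space_axioms] prob_space.indep_sets_def[OF measure_pmf.prob_space_axioms]
proof (intro conjI ballI allI impI)
  fix J A
  assume J: "J \<subseteq> I" "J \<noteq> {}" "finite J"
    and A: "A \<in> Pi J (\<lambda>i. {(\<lambda>\<omega>. X i (f \<omega>)) -` B \<inter> space (measure_pmf p) |B. B \<in> sets (count_space UNIV)})"
  have "\<exists>B. \<forall>j\<in>J. A j = f -` (X j -` B j)"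
  proof (rule bchoice, rule ballI)
    fix j assume "j \<in> J"
    from Pi_mem[OF A this] obtain B where "A j = (\<lambda>\<omega>. X j (f \<omega>)) -` B" by auto
    then have "A j = f -` (X j -` B)" by auto
    then show "\<exists>B. A j = f -` (X j -` B)" by blast
  qed
  then obtain B where B: "\<And>j. j \<in> J \<Longrightarrow> A j = f -` (X j -` B j)" by blast
  have "measure (map_pmf f p) (\<Inter>j\<in>J. X j -` B j) = (\<Prod>j\<in>J. measure (map_pmf f p) (X j -` B j))"
    using assms J unfolding prob_space.indep_vars_def2[OF measure_pmf.prob_space_axioms] prob_space.indep_sets_def[OF measure_pmf.prob_space_axioms] by auto
  moreover have "f -` (\<Inter>j\<in>J. X j -` B j) = (\<Inter>j\<in>J. A j)" using B by auto
  ultimately show "measure p (\<Inter>j\<in>J. A j) = (\<Prod>j\<in>J. measure p (A j))"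
    using B by simp
qed auto

text \<open>The samples are embeddings and not tuples: \<open>r n\<close> reads off the
  \<open>n\<close> components of a sample, and it is the image distribution that is a product.
  Infinitely many variances of at least \<open>\<delta>\<close> make the total variance
  unbounded.\<close>

theorem asymptotically_normal_perturbed_product:
  fixes P :: "nat \<Rightarrow> 'a pmf" and r :: "nat \<Rightarrow> 'a \<Rightarrow> nat \<Rightarrow> 'b" and q :: "nat \<Rightarrow> 'b pmf"
    and Y :: "nat \<Rightarrow> 'b \<Rightarrow> real" and X :: "nat \<Rightarrow> 'a \<Rightarrow> real"
  assumes prod: "\<And>n. n \<ge> 1 \<Longrightarrow> map_pmf (r n) (P n) = Pi_pmf {1..n} d q"
    and bd: "\<And>i y. \<bar>Y i y\<bar> \<le> K"
    and \<delta>: "\<delta> > 0" and inf: "infinite {i. i \<ge> 1 \<and> measure_pmf.variance (q i) (Y i) \<ge> \<delta>}"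
    and dist: "\<And>n \<omega>. n \<ge> 1 \<Longrightarrow> \<omega> \<in> set_pmf (P n) \<Longrightarrow>
      \<bar>X n \<omega> - A n - (\<Sum>i=1..n. Y i (r n \<omega> i))\<bar> \<le> C"
  shows "asymptotically_normal P X"
proof -
  define m where "m i = measure_pmf.expectation (q i) (Y i)" for i
  define W where "W n i \<omega> = Y i (r n \<omega> i) - m i" for n i \<omega>
  have intY: "integrable (measure_pmf (q i)) (Y i)" for i
    by (rule measure_pmf.integrable_bounded[OF _ bd]) simp
  have m: "\<bar>m i\<bar> \<le> K" for i
  proof -
    have "\<bar>m i\<bar> \<le> measure_pmf.expectation (q i) (\<lambda>y. \<bar>Y i y\<bar>)"
      unfolding m_def by (rule integral_abs_bound)
    also have "\<dots> \<le> measure_pmf.expectation (q i) (\<lambda>_. K)"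
      by (rule integral_mono) (use intY bd in auto)
    finally show ?thesis by simp
  qed
  have comp: "map_pmf (\<lambda>\<omega>. r n \<omega> i) (P n) = q i" if "1 \<le> i" "i \<le> n" for n i
  proof -
    have "map_pmf (\<lambda>\<omega>. r n \<omega> i) (P n) = map_pmf (\<lambda>g. g i) (map_pmf (r n) (P n))"
      by (simp add: pmf.map_comp o_def)
    also have "\<dots> = q i" using that by (simp add: prod Pi_pmf_component)
    finally show ?thesis .
  qed
  have exp: "measure_pmf.expectation (P n) (\<lambda>\<omega>. h (r n \<omega> i)) = measure_pmf.expectation (q i) h"
    if "1 \<le> i" "i \<le> n" for n i and h :: "'b \<Rightarrow> real"
    unfolding comp[OF that, symmetric] by simp
  have EW2: "measure_pmf.expectation (P n) (\<lambda>\<omega>. (W n i \<omega>)\<^sup>2) = measure_pmf.variance (q i) (Y i)"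
    if "1 \<le> i" "i \<le> n" for n i
    using exp[OF that, of "\<lambda>y. (Y i y - m i)\<^sup>2"] by (simp add: W_def m_def)
  show ?thesis
  \<comment> \<open>Centring the summands at most doubles their bound and moves their means into
    \<open>A\<close>.\<close>
  proof (rule asymptotically_normal_perturbed_sum[where W = W and K = "2 * K" and C = C
        and A = "\<lambda>n. A n + (\<Sum>i=1..n. m i)"])
    fix n :: nat assume n: "n \<ge> 1"
    have "prob_space.indep_vars (measure_pmf (P n)) (\<lambda>_. count_space UNIV) (\<lambda>i \<omega>. r n \<omega> i) {1..n}"
      by (rule indep_vars_map_pmf[where f = "r n" and X = "\<lambda>i g. g i"])
        (simp add: prod[OF n] indep_vars_Pi_pmf)
    then have "prob_space.indep_vars (measure_pmf (P n)) (\<lambda>_. borel) (\<lambda>i \<omega>. Y i (r n \<omega> i) - m i) {1..n}"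
      by (rule prob_space.indep_vars_compose2[OF measure_pmf.prob_space_axioms, where Y = "\<lambda>i y. Y i y - m i"]) simp
    then show "prob_space.indep_vars (measure_pmf (P n)) (\<lambda>_. borel) (W n) {1..n}"
      unfolding W_def[abs_def] .
  next
    show "\<bar>W n i \<omega>\<bar> \<le> 2 * K" for n i \<omega>
      using bd[of i "r n \<omega> i"] m[of i] unfolding W_def by linarith
  next
    show "measure_pmf.expectation (P n) (W n i) = 0" if "1 \<le> i" "i \<le> n" for n i
      using exp[OF that, of "\<lambda>y. Y i y - m i"] intY[of i] by (simp add: W_def[abs_def] m_def)
  next
    let ?J = "{i. i \<ge> 1 \<and> measure_pmf.variance (q i) (Y i) \<ge> \<delta>}"
    have card: "filterlim (\<lambda>n. real (card (?J \<inter> {1..n}))) at_top sequentially"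
      unfolding filterlim_at_top
    proof
      fix Z :: real
      obtain k :: nat where k: "Z \<le> real k" using real_arch_simple by blast
      obtain S where S: "S \<subseteq> ?J" "finite S" "card S = k"
        using infinite_arbitrarily_large[OF inf] by blast
      have "Z \<le> real (card (?J \<inter> {1..n}))" if "Max (insert 0 S) \<le> n" for n
      proof -
        have "S \<subseteq> ?J \<inter> {1..n}" using S that by (auto simp: subset_iff)
        then have "k \<le> card (?J \<inter> {1..n})" using S(3) card_mono[of "?J \<inter> {1..n}" S] by simp
        then show ?thesis using k by linarith
      qed
      then show "eventually (\<lambda>n. Z \<le> real (card (?J \<inter> {1..n}))) sequentially"
        by (rule eventually_sequentiallyI)
    qed
    have "filterlim (\<lambda>n. \<delta> * real (card (?J \<inter> {1..n}))) at_top sequentially"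
      by (rule filterlim_tendsto_pos_mult_at_top[OF tendsto_const \<delta> card])
    then show "filterlim (\<lambda>n. \<Sum>i=1..n. measure_pmf.expectation (P n) (\<lambda>\<omega>. (W n i \<omega>)\<^sup>2)) at_top sequentially"
    proof (rule filterlim_at_top_mono, intro always_eventually allI)
      fix n :: nat
      have "\<delta> * real (card (?J \<inter> {1..n})) = (\<Sum>i\<in>?J \<inter> {1..n}. \<delta>)" by simp
      also have "\<dots> \<le> (\<Sum>i\<in>?J \<inter> {1..n}. measure_pmf.variance (q i) (Y i))"
        by (rule sum_mono) auto
      also have "\<dots> \<le> (\<Sum>i\<in>{1..n}. measure_pmf.variance (q i) (Y i))"
        by (rule sum_mono2) auto
      also have "\<dots> = (\<Sum>i=1..n. measure_pmf.expectation (P n) (\<lambda>\<omega>. (W n i \<omega>)\<^sup>2))"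
        by (rule sum.cong) (auto simp: EW2)
      finally show "\<delta> * real (card (?J \<inter> {1..n})) \<le> \<dots>" .
    qed
  next
    fix n \<omega> assume "n \<ge> (1::nat)" "\<omega> \<in> set_pmf (P n)"
    then show "\<bar>X n \<omega> - (A n + (\<Sum>i=1..n. m i)) - (\<Sum>i=1..n. W n i \<omega>)\<bar> \<le> C"
      using dist[of n \<omega>] by (simp add: W_def sum_subtractf)
  qed
qed

text \<open>Asymptotic normality is a property of the distributions of \<open>X n\<close> alone.
  This carries the limit from representatives to their classes.\<close>

lemma asymptotically_normal_map_pmf:
  assumes "asymptotically_normal p X"
    and eq: "\<And>n \<omega>. \<omega> \<in> set_pmf (p n) \<Longrightarrow> X' n (f n \<omega>) = X n \<omega>"
  shows "asymptotically_normal (\<lambda>n. map_pmf (f n) (p n)) X'"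
proof -
  have int: "measure_pmf.expectation (p n) (\<lambda>\<omega>. h (X' n (f n \<omega>))) = measure_pmf.expectation (p n) (\<lambda>\<omega>. h (X n \<omega>))"
    for n and h :: "real \<Rightarrow> real"
    by (rule integral_cong_AE) (auto simp: AE_measure_pmf_iff eq)
  have "distr (measure_pmf (map_pmf (f n) (p n))) borel (\<lambda>\<omega>. h (X' n \<omega>)) =
    distr (measure_pmf (p n)) borel (\<lambda>\<omega>. h (X n \<omega>))" for n and h :: "real \<Rightarrow> real"
  proof -
    have "distr (measure_pmf (map_pmf (f n) (p n))) borel (\<lambda>\<omega>. h (X' n \<omega>)) =
      distr (measure_pmf (p n)) borel (\<lambda>\<omega>. h (X' n (f n \<omega>)))"
      unfolding map_pmf_rep_eq by (subst distr_distr) (auto simp: comp_def)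
    also have "\<dots> = distr (measure_pmf (p n)) borel (\<lambda>\<omega>. h (X n \<omega>))"
      by (rule distr_cong_AE) (auto simp: AE_measure_pmf_iff eq)
    finally show ?thesis .
  qed
  note this[of _ "\<lambda>x. (x - m) / s" for m s]
  then show ?thesis
    using assms(1) int[of _ "\<lambda>x. x"] int[of _ "\<lambda>x. (x - m)\<^sup>2" for m]
    by (simp add: asymptotically_normal_def)
qed

section \<open>Uniform distributions on finite sets\<close>

lemma card_eq_fibers:
  assumes "finite A" "\<And>y. y \<in> f ` A \<Longrightarrow> card {x \<in> A. f x = y} = k"
  shows "card A = card (f ` A) * k"
proof -
  have "card A = (\<Sum>y\<in>f ` A. card {x \<in> A. f x = y})"
    using sum.image_gen[OF assms(1), of "\<lambda>_. 1::nat" f] by simp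
  then show ?thesis using assms(2) by simp
qed

lemma map_pmf_of_set_equal_fibers:
  assumes fin: "finite A" and ne: "A \<noteq> {}" and k: "\<And>y. y \<in> f ` A \<Longrightarrow> card {x \<in> A. f x = y} = k"
  shows "map_pmf f (pmf_of_set A) = pmf_of_set (f ` A)"
proof (rule pmf_eqI)
  fix y
  have A: "card A = card (f ` A) * k" by (rule card_eq_fibers[OF fin k])
  have A0: "card A \<noteq> 0" using fin ne by simp
  have "pmf (map_pmf f (pmf_of_set A)) y = card (A \<inter> f -` {y}) / card A"
    using fin ne by (simp add: pmf_map measure_pmf_of_set)
  also have "\<dots> = indicator (f ` A) y / card (f ` A)"
  proof (cases "y \<in> f ` A")
    case True
    have "A \<inter> f -` {y} = {x \<in> A. f x = y}" by auto
    then have "card (A \<inter> f -` {y}) = k" using k[OF True] by simp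
    then show ?thesis using True A A0 by (simp add: field_simps)
  next
    case False
    then have "A \<inter> f -` {y} = {}" by auto
    then show ?thesis using False by simp
  qed
  also have "\<dots> = pmf (pmf_of_set (f ` A)) y" using fin ne by simp
  finally show "pmf (map_pmf f (pmf_of_set A)) y = pmf (pmf_of_set (f ` A)) y" .
qed

text \<open>At least one of \<open>a\<close> and \<open>b\<close> lies at distance
  \<open>d / 2\<close> or more from the mean, and it has probability at least
  \<open>1 / N\<close>.\<close>

lemma variance_pmf_of_set_ge:
  fixes Y :: "'a \<Rightarrow> real"
  assumes A: "finite A" "card A \<le> N" and ab: "a \<in> A" "b \<in> A" and d: "\<bar>Y a - Y b\<bar> \<ge> d" "d \<ge> 0"
  shows "measure_pmf.variance (pmf_of_set A) Y \<ge> d\<^sup>2 / (4 * real N)"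
proof -
  let ?m = "measure_pmf.expectation (pmf_of_set A) Y"
  have ne: "A \<noteq> {}" using ab by auto
  then have pos: "0 < card A" using A by (simp add: card_gt_0_iff)
  have "\<exists>c\<in>A. \<bar>Y c - ?m\<bar> \<ge> d / 2"
  proof (rule ccontr)
    assume "\<not> ?thesis"
    then have "\<bar>Y a - ?m\<bar> < d / 2" "\<bar>Y b - ?m\<bar> < d / 2" using ab by auto
    then show False using d by linarith
  qed
  then obtain c where c: "c \<in> A" "\<bar>Y c - ?m\<bar> \<ge> d / 2" by blast
  have "(d / 2)\<^sup>2 \<le> (Y c - ?m)\<^sup>2" using c(2) d(2) by (simp flip: abs_le_square_iff)
  also have "\<dots> \<le> (\<Sum>x\<in>A. (Y x - ?m)\<^sup>2)"
    by (rule member_le_sum) (use A c in auto)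
  finally have "(d / 2)\<^sup>2 / card A \<le> (\<Sum>x\<in>A. (Y x - ?m)\<^sup>2) / card A"
    by (rule divide_right_mono) simp
  moreover have "(d / 2)\<^sup>2 / N \<le> (d / 2)\<^sup>2 / card A"
    using A(2) pos by (intro divide_left_mono) auto
  ultimately show ?thesis
    using A ne by (simp add: integral_pmf_of_set power_divide)
qed

section \<open>Rotation systems\<close>

lemma finite_edge_ends: "fin_digraph H \<Longrightarrow> finite (edge_ends H)"
  by (simp add: edge_ends_def fin_digraph.finite_arcs)

lemma opposite_in_edge_ends [simp]: "opposite h \<in> edge_ends H \<longleftrightarrow> h \<in> edge_ends H"
  by (cases h) (simp add: edge_ends_def opposite_def)

lemma opposite_image_edge_ends: "opposite ` edge_ends H \<subseteq> edge_ends H"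
  by auto

lemma ends_at_subset: "ends_at H x \<subseteq> edge_ends H"
  by (auto simp: ends_at_def)

lemma end_vertex_in_verts:
  assumes "wf_digraph H" "h \<in> edge_ends H"
  shows "end_vertex H h \<in> verts H"
  using assms by (auto simp: edge_ends_def end_vertex_def wf_digraph.tail_in_verts wf_digraph.head_in_verts)

lemma cyclic_on_image_eq:
  assumes "cyclic_on f S"
  shows "f ` S = S"
proof
  show "f ` S \<subseteq> S" using assms by (auto intro: cyclic_on_inI)
  obtain s where s: "s \<in> S" "S = orbit f s" using assms by (auto simp: cyclic_on_def)
  show "S \<subseteq> f ` S"
  proof
    fix y assume "y \<in> S"
    then have "y \<in> orbit f s" using s by simp
    then show "y \<in> f ` S" by cases (use s in auto)
  qed
qed

lemma rotation_systemsD: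
  assumes "\<sigma> \<in> rotation_systems H"
  shows "\<sigma> permutes edge_ends H" "bij \<sigma>" "\<sigma> ` edge_ends H \<subseteq> edge_ends H"
    "x \<in> verts H \<Longrightarrow> ends_at H x \<noteq> {} \<Longrightarrow> cyclic_on \<sigma> (ends_at H x)"
  using assms by (auto simp: rotation_systems_def permutes_bij permutes_in_image)

text \<open>Cyclicity at the vertices already gives a permutation: the sets
  \<open>ends_at H x\<close> cover the edge-ends, each is mapped onto itself, and a surjection of a
  finite set is injective.\<close>

lemma rotation_systemsI:
  assumes fin: "fin_digraph H" and out: "\<And>h. h \<notin> edge_ends H \<Longrightarrow> \<sigma> h = h"
    and cyc: "\<And>x. x \<in> verts H \<Longrightarrow> ends_at H x \<noteq> {} \<Longrightarrow> cyclic_on \<sigma> (ends_at H x)"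
  shows "\<sigma> \<in> rotation_systems H"
proof -
  interpret fin_digraph H by (rule fin)
  have at: "h \<in> ends_at H (end_vertex H h)" "cyclic_on \<sigma> (ends_at H (end_vertex H h))"
    if "h \<in> edge_ends H" for h
  proof -
    show "h \<in> ends_at H (end_vertex H h)" using that by (simp add: ends_at_def)
    then show "cyclic_on \<sigma> (ends_at H (end_vertex H h))"
      by (intro cyc end_vertex_in_verts that wf_digraph) auto
  qed
  have "\<sigma> ` edge_ends H = edge_ends H"
  proof (intro equalityI subsetI)
    fix y assume "y \<in> \<sigma> ` edge_ends H"
    then obtain h where h: "h \<in> edge_ends H" "y = \<sigma> h" by auto
    have "\<sigma> h \<in> ends_at H (end_vertex H h)" by (rule cyclic_on_inI[OF at(2)[OF h(1)] at(1)[OF h(1)]])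
    then have "\<sigma> h \<in> edge_ends H" by (rule subsetD[OF ends_at_subset])
    then show "y \<in> edge_ends H" by (simp only: h(2))
  next
    fix y assume y: "y \<in> edge_ends H"
    have "y \<in> \<sigma> ` ends_at H (end_vertex H y)"
      unfolding cyclic_on_image_eq[OF at(2)[OF y]] by (rule at(1)[OF y])
    then show "y \<in> \<sigma> ` edge_ends H" by (rule subsetD[OF image_mono[OF ends_at_subset]])
  qed
  moreover have "finite (edge_ends H)" by (rule finite_edge_ends[OF fin])
  ultimately have "bij_betw \<sigma> (edge_ends H) (edge_ends H)"
    by (simp add: bij_betw_def eq_card_imp_inj_on)
  then have "\<sigma> permutes edge_ends H" using out by (rule bij_imp_permutes)
  then show ?thesis using cyc by (simp add: rotation_systems_def)
qed

lemma end_vertex_rotation: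
  assumes "fin_digraph H" "\<sigma> \<in> rotation_systems H" "h \<in> edge_ends H"
  shows "end_vertex H (\<sigma> h) = end_vertex H h"
proof -
  interpret fin_digraph H by fact
  have "h \<in> ends_at H (end_vertex H h)" using assms by (simp add: ends_at_def)
  moreover from this have "cyclic_on \<sigma> (ends_at H (end_vertex H h))"
    by (intro rotation_systemsD[OF assms(2)] end_vertex_in_verts[OF wf_digraph assms(3)]) auto
  ultimately have "\<sigma> h \<in> ends_at H (end_vertex H h)" by (rule cyclic_on_inI[rotated])
  then show ?thesis by (simp add: ends_at_def)
qed

lemma inv_rotation_in_edge_ends:
  assumes "\<sigma> \<in> rotation_systems H"
  shows "inv \<sigma> h \<in> edge_ends H \<longleftrightarrow> h \<in> edge_ends H"
  using permutes_in_image[OF permutes_inv[OF rotation_systemsD(1)[OF assms]]] .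

lemma end_vertex_inv_rotation:
  assumes "fin_digraph H" "\<sigma> \<in> rotation_systems H" "h \<in> edge_ends H"
  shows "end_vertex H (inv \<sigma> h) = end_vertex H h"
  using end_vertex_rotation[OF assms(1,2), of "inv \<sigma> h"] assms(3)
    inv_rotation_in_edge_ends[OF assms(2)] bij_inv_apply[OF rotation_systemsD(2)[OF assms(2)]]
  by simp

lemma finite_rotation_systems: "fin_digraph H \<Longrightarrow> finite (rotation_systems H)"
  by (rule finite_subset[OF _ finite_permutations[OF finite_edge_ends]])
    (auto simp: rotation_systems_def)

lemma card_edge_ends: "card (edge_ends H) = 2 * card (arcs H)"
  by (simp add: edge_ends_def card_cartesian_product mult.commute)

lemma card_rotation_systems_le:
  assumes "fin_digraph H"
  shows "card (rotation_systems H) \<le> fact (2 * card (arcs H))"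
proof -
  have "card (rotation_systems H) \<le> card {\<sigma>. \<sigma> permutes edge_ends H}"
    by (rule card_mono[OF finite_permutations[OF finite_edge_ends[OF assms]]])
      (auto simp: rotation_systems_def)
  also have "\<dots> = fact (2 * card (arcs H))"
    by (rule card_permutations[OF card_edge_ends finite_edge_ends[OF assms]])
  finally show ?thesis .
qed

lemma rotation_systems_nonempty:
  assumes "fin_digraph H"
  shows "rotation_systems H \<noteq> {}"
proof -
  have "\<exists>\<pi>. ends_at H x \<noteq> {} \<longrightarrow> \<pi> permutes ends_at H x \<and> cyclic_on \<pi> (ends_at H x)" for x
    using exists_cyclic_permutation[of "ends_at H x"]
      finite_subset[OF ends_at_subset finite_edge_ends[OF assms]] by blast
  then obtain \<pi> where \<pi>: "\<And>x. ends_at H x \<noteq> {} \<Longrightarrow> cyclic_on (\<pi> x) (ends_at H x)" by metis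
  define \<sigma> where "\<sigma> h = (if h \<in> edge_ends H then \<pi> (end_vertex H h) h else h)" for h
  have "\<sigma> \<in> rotation_systems H"
  proof (rule rotation_systemsI[OF assms])
    show "cyclic_on \<sigma> (ends_at H x)" if "ends_at H x \<noteq> {}" for x
      using \<pi>[OF that] by (subst cyclic_cong[of _ _ "\<pi> x"]) (auto simp: \<sigma>_def ends_at_def)
  qed (simp add: \<sigma>_def)
  then show ?thesis by auto
qed

lemma num_faces_eq_face_classes:
  assumes "fin_digraph H" "\<sigma> \<in> rotation_systems H"
  shows "num_faces H \<sigma> = face_classes (edge_ends H) (\<sigma>, {}) + card (isolated_verts H)"
  unfolding num_faces_def
  using face_classes_untwisted[OF rotation_systemsD(2)[OF assms(2)] finite_edge_ends[OF assms(1)]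
      rotation_systemsD(3)[OF assms(2)] opposite_image_edge_ends]
  by (simp add: num_orbits_def)

lemma face_classes_le:
  assumes "finite A"
  shows "face_classes A X \<le> 2 * card A"
proof -
  have "face_classes A X \<le> card (A \<times> (UNIV :: bool set))"
    unfolding face_classes_def by (rule card_image_le) (use assms in simp)
  then show ?thesis by (simp add: card_cartesian_product)
qed

text \<open>\<open>inv \<sigma> h = \<sigma> h\<close> means that two steps of
  \<open>\<sigma>\<close> lead back to \<open>h\<close>, and then the cycle has at most two
  elements. So the answer depends on the degree and not on the cyclic order.\<close>

lemma rotation_twice_fixed_iff:
  assumes "cyclic_on \<sigma> A" "h \<in> A" "bij \<sigma>"
  shows "inv \<sigma> h = \<sigma> h \<longleftrightarrow> card A \<le> 2"
proof -
  have fin: "finite A" using assms(1) by (rule finite_cyclic_on)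
  have in1: "\<sigma> h \<in> A" and in2: "\<sigma> (\<sigma> h) \<in> A" using assms cyclic_on_inI by metis+
  have "inv \<sigma> h = \<sigma> h \<longleftrightarrow> \<sigma> (\<sigma> h) = h" using bij_inv_apply[OF assms(3)] by metis
  also have "\<dots> \<longleftrightarrow> card A \<le> 2"
  proof
    assume "\<sigma> (\<sigma> h) = h"
    then have "orbit \<sigma> h = {(\<sigma> ^^ m) h |m. m < 2}"
      by (intro orbit_altdef_bounded) (auto simp: numeral_2_eq_2)
    also have "\<dots> \<subseteq> {h, \<sigma> h}" by (auto simp: less_2_cases_iff)
    finally have "A \<subseteq> {h, \<sigma> h}" using orbit_cyclic_eq3[OF assms(1,2)] by simp
    then have "card A \<le> card {h, \<sigma> h}" by (intro card_mono) auto
    also have "\<dots> \<le> 2" by (simp add: card_insert_if)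
    finally show "card A \<le> 2" .
  next
    assume le: "card A \<le> 2"
    show "\<sigma> (\<sigma> h) = h"
    proof (rule ccontr)
      assume ne: "\<sigma> (\<sigma> h) \<noteq> h"
      then have "\<sigma> h \<noteq> h" by auto
      moreover from this have "\<sigma> (\<sigma> h) \<noteq> \<sigma> h" using assms(3) by (metis bij_inv_apply(1))
      ultimately have "card {h, \<sigma> h, \<sigma> (\<sigma> h)} = 3" using ne by auto
      moreover have "card {h, \<sigma> h, \<sigma> (\<sigma> h)} \<le> card A"
        using fin in1 in2 assms(2) by (intro card_mono) auto
      ultimately show False using le by simp
    qed
  qed
  finally show ?thesis .
qed

section \<open>General embeddings\<close>

definition flip_rotation ::
  "('v, 'e) pre_digraph \<Rightarrow> 'v set \<Rightarrow> ('e edge_end \<Rightarrow> 'e edge_end) \<Rightarrow> 'e edge_end \<Rightarrow> 'e edge_end" where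
  "flip_rotation H S \<sigma> h = (if h \<in> edge_ends H \<and> end_vertex H h \<in> S then inv \<sigma> h else \<sigma> h)"

text \<open>On the arcs of \<open>H\<close> this is the edge cut between \<open>S\<close> and its
  complement; loops never belong to it.\<close>

definition boundary :: "('v, 'e) pre_digraph \<Rightarrow> 'v set \<Rightarrow> 'e set" where
  "boundary H S = {e. (tail H e \<in> S) \<noteq> (head H e \<in> S)}"

lemma switch_eq:
  "switch H S (\<sigma>, T) = (flip_rotation H S \<sigma>, {e \<in> arcs H. (e \<in> T) \<noteq> (e \<in> boundary H S)})"
  by (auto simp: switch_def flip_rotation_def boundary_def fun_eq_iff)

lemma flip_rotation_in:
  assumes fin: "fin_digraph H" and \<sigma>: "\<sigma> \<in> rotation_systems H"
  shows "flip_rotation H S \<sigma> \<in> rotation_systems H"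
proof (rule rotation_systemsI[OF fin])
  show "flip_rotation H S \<sigma> h = h" if "h \<notin> edge_ends H" for h
    using that rotation_systemsD(1)[OF \<sigma>] by (simp add: flip_rotation_def permutes_not_in)
  fix x assume x: "x \<in> verts H" "ends_at H x \<noteq> {}"
  have cyc: "cyclic_on \<sigma> (ends_at H x)" by (rule rotation_systemsD(4)[OF \<sigma> x])
  have perm: "permutation \<sigma>"
    using rotation_systemsD(1)[OF \<sigma>] finite_edge_ends[OF fin] by (auto simp: permutation_permutes)
  have "cyclic_on (inv \<sigma>) (ends_at H x)"
    using cyc by (simp add: cyclic_on_def orbit_inv_eq[OF perm])
  then show "cyclic_on (flip_rotation H S \<sigma>) (ends_at H x)"
  proof (cases "x \<in> S")
    case True
    then have "cyclic_on (flip_rotation H S \<sigma>) (ends_at H x) = cyclic_on (inv \<sigma>) (ends_at H x)"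
      by (intro cyclic_cong) (auto simp: flip_rotation_def ends_at_def)
    then show ?thesis using \<open>cyclic_on (inv \<sigma>) _\<close> by simp
  next
    case False
    then have "cyclic_on (flip_rotation H S \<sigma>) (ends_at H x) = cyclic_on \<sigma> (ends_at H x)"
      by (intro cyclic_cong) (auto simp: flip_rotation_def ends_at_def)
    then show ?thesis using cyc by simp
  qed
qed

lemma inv_flip_rotation:
  assumes fin: "fin_digraph H" and \<sigma>: "\<sigma> \<in> rotation_systems H"
  shows "inv (flip_rotation H S \<sigma>) h = (if h \<in> edge_ends H \<and> end_vertex H h \<in> S then \<sigma> h else inv \<sigma> h)"
    (is "_ = ?\<tau> h")
proof -
  have "flip_rotation H S \<sigma> (?\<tau> h) = h"
    using end_vertex_rotation[OF fin \<sigma>, of h] end_vertex_inv_rotation[OF fin \<sigma>, of h]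
      inv_rotation_in_edge_ends[OF \<sigma>, of h] permutes_in_image[OF rotation_systemsD(1)[OF \<sigma>], of h]
      bij_inv_apply[OF rotation_systemsD(2)[OF \<sigma>], of h]
    by (auto simp: flip_rotation_def)
  then show ?thesis
    by (rule inv_f_eq[OF bij_is_inj[OF rotation_systemsD(2)[OF flip_rotation_in[OF fin \<sigma>]]]])
qed

lemma switch_in:
  assumes "fin_digraph H" "X \<in> signed_rotation_systems H"
  shows "switch H S X \<in> signed_rotation_systems H"
  using assms flip_rotation_in[OF assms(1)]
  by (cases X) (auto simp: signed_rotation_systems_def switch_eq)

text \<open>Two reversals at a vertex cancel, and edge cuts add modulo two. So switching is an
  action of the vertex sets under symmetric difference, and its orbits are the general
  embeddings.\<close>

lemma switch_switch:
  assumes "fin_digraph H" "X \<in> signed_rotation_systems H"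
  shows "switch H S (switch H S' X) = switch H (sym_diff S S') X"
proof -
  obtain \<sigma> T where X: "X = (\<sigma>, T)" by (cases X)
  then have \<sigma>: "\<sigma> \<in> rotation_systems H" using assms by (simp add: signed_rotation_systems_def)
  have "flip_rotation H S (flip_rotation H S' \<sigma>) h = flip_rotation H (sym_diff S S') \<sigma> h" for h
    using inv_flip_rotation[OF assms(1) \<sigma>, of S' h] by (auto simp: flip_rotation_def)
  then have "flip_rotation H S (flip_rotation H S' \<sigma>) = flip_rotation H (sym_diff S S') \<sigma>" ..
  moreover have "e \<in> boundary H (sym_diff S S') \<longleftrightarrow> (e \<in> boundary H S) \<noteq> (e \<in> boundary H S')" for e
    by (auto simp: boundary_def)
  ultimately show ?thesis by (auto simp: X switch_eq)
qed

lemma switch_empty: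
  assumes "X \<in> signed_rotation_systems H"
  shows "switch H {} X = X"
  using assms by (cases X) (auto simp: switch_eq flip_rotation_def boundary_def signed_rotation_systems_def)

lemma equiv_switch_rel:
  assumes "fin_digraph H"
  shows "equiv (signed_rotation_systems H) (switch_rel H)"
proof (rule equivI)
  show "switch_rel H \<subseteq> signed_rotation_systems H \<times> signed_rotation_systems H"
    by (auto simp: switch_rel_def)
  show "refl_on (signed_rotation_systems H) (switch_rel H)"
  proof (rule refl_onI)
    fix X assume "X \<in> signed_rotation_systems H"
    then show "(X, X) \<in> switch_rel H"
      using switch_empty[of X H] unfolding switch_rel_def by (metis (mono_tags, lifting) case_prodI empty_subsetI mem_Collect_eq)
  qed
  show "sym (switch_rel H)"
  proof (rule symI)
    fix X Y assume XY: "(X, Y) \<in> switch_rel H"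
    then obtain S where S: "S \<subseteq> verts H" "Y = switch H S X" by (auto simp: switch_rel_def)
    have X: "X \<in> signed_rotation_systems H" using XY by (simp add: switch_rel_def)
    have "switch H S Y = X"
      unfolding S(2) using switch_switch[OF assms X, of S S] switch_empty[OF X] by simp
    then show "(Y, X) \<in> switch_rel H" using XY S by (auto simp: switch_rel_def)
  qed
  show "trans (switch_rel H)"
  proof (rule transI)
    fix X Y Z assume XY: "(X, Y) \<in> switch_rel H" and YZ: "(Y, Z) \<in> switch_rel H"
    obtain S where S: "S \<subseteq> verts H" "Y = switch H S X" using XY by (auto simp: switch_rel_def)
    obtain S' where S': "S' \<subseteq> verts H" "Z = switch H S' Y" using YZ by (auto simp: switch_rel_def)
    have "Z = switch H (sym_diff S' S) X"
      using XY S S' switch_switch[OF assms, of X S' S] by (auto simp: switch_rel_def)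
    moreover have "sym_diff S' S \<subseteq> verts H" using S S' by auto
    ultimately have "\<exists>R\<subseteq>verts H. Z = switch H R X" by blast
    then show "(X, Z) \<in> switch_rel H" using XY YZ unfolding switch_rel_def by simp
  qed
qed

lemma switch_class:
  assumes "fin_digraph H" "X \<in> signed_rotation_systems H"
  shows "switch_rel H `` {X} = (\<lambda>S. switch H S X) ` Pow (verts H)"
  using assms switch_in[OF assms] by (auto simp: switch_rel_def)

text \<open>Reversing the local orientation fixes a rotation exactly at the vertices of degree at most
  two, whatever the rotation system is.\<close>

lemma switch_eq_switch_iff:
  assumes fin: "fin_digraph H" and X: "X \<in> signed_rotation_systems H"
  shows "switch H S X = switch H S' X \<longleftrightarrow>
    (\<forall>e\<in>arcs H. e \<in> boundary H S \<longleftrightarrow> e \<in> boundary H S') \<and>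
    (\<forall>h\<in>edge_ends H. (end_vertex H h \<in> S) \<noteq> (end_vertex H h \<in> S') \<longrightarrow>
       card (ends_at H (end_vertex H h)) \<le> 2)"
proof -
  interpret fin_digraph H by (rule fin)
  obtain \<sigma> T where XE: "X = (\<sigma>, T)" by (cases X)
  then have \<sigma>: "\<sigma> \<in> rotation_systems H" using X by (simp add: signed_rotation_systems_def)
  have iff: "inv \<sigma> h = \<sigma> h \<longleftrightarrow> card (ends_at H (end_vertex H h)) \<le> 2" if h: "h \<in> edge_ends H" for h
  proof -
    have mem: "h \<in> ends_at H (end_vertex H h)" using h by (simp add: ends_at_def)
    have "cyclic_on \<sigma> (ends_at H (end_vertex H h))"
      using mem by (intro rotation_systemsD[OF \<sigma>] end_vertex_in_verts[OF wf_digraph h]) auto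
    then show ?thesis by (rule rotation_twice_fixed_iff[OF _ mem rotation_systemsD(2)[OF \<sigma>]])
  qed
  have "flip_rotation H S \<sigma> = flip_rotation H S' \<sigma> \<longleftrightarrow>
    (\<forall>h\<in>edge_ends H. (end_vertex H h \<in> S) \<noteq> (end_vertex H h \<in> S') \<longrightarrow> inv \<sigma> h = \<sigma> h)"
    by (auto simp: fun_eq_iff flip_rotation_def)
  moreover have "{e \<in> arcs H. (e \<in> T) \<noteq> (e \<in> boundary H S)} = {e \<in> arcs H. (e \<in> T) \<noteq> (e \<in> boundary H S')}
    \<longleftrightarrow> (\<forall>e\<in>arcs H. e \<in> boundary H S \<longleftrightarrow> e \<in> boundary H S')"
    by auto
  ultimately show ?thesis using iff by (simp add: XE switch_eq conj_commute)
qed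

text \<open>Both images have one element for each block of the common partition that
  \<open>f\<close> and \<open>g\<close> induce on \<open>A\<close>. This compares the orbits of two
  signed rotation systems under switching.\<close>

lemma card_image_eq_of_same_kernel:
  assumes "\<And>a b. a \<in> A \<Longrightarrow> b \<in> A \<Longrightarrow> f a = f b \<longleftrightarrow> g a = g b"
  shows "card (f ` A) = card (g ` A)"
proof -
  let ?k = "\<lambda>y. g (inv_into A f y)"
  have inv: "inv_into A f (f a) \<in> A" "f (inv_into A f (f a)) = f a" if "a \<in> A" for a
    using that by (auto intro: inv_into_into f_inv_into_f)
  have k: "?k (f a) = g a" if "a \<in> A" for a
    using inv[OF that] assms that by blast
  have "inj_on ?k (f ` A)" using k assms by (auto intro!: inj_onI)
  moreover have "?k ` f ` A = g ` A" using k by (auto simp: image_image)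
  ultimately show ?thesis by (metis card_image)
qed

lemma card_switch_class:
  assumes "fin_digraph H" "X \<in> signed_rotation_systems H" "Y \<in> signed_rotation_systems H"
  shows "card (switch_rel H `` {X}) = card (switch_rel H `` {Y})"
  unfolding switch_class[OF assms(1,2)] switch_class[OF assms(1,3)]
  by (rule card_image_eq_of_same_kernel)
    (simp add: switch_eq_switch_iff[OF assms(1,2)] switch_eq_switch_iff[OF assms(1,3)])

text \<open>The boundary walks stay the same; only the flags at the vertices of \<open>S\<close> are
  now read against the reversed local orientation. The map \<open>\<phi>\<close> is this change of
  reading, and it conjugates the two face tracers.\<close>

lemma face_classes_switch:
  assumes fin: "fin_digraph H" and X: "X \<in> signed_rotation_systems H"
  shows "face_classes (edge_ends H) (switch H S X) = face_classes (edge_ends H) X"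
proof -
  let ?E = "edge_ends H"
  obtain \<sigma> T where XE: "X = (\<sigma>, T)" by (cases X)
  then have \<sigma>: "\<sigma> \<in> rotation_systems H" using X by (simp add: signed_rotation_systems_def)
  define \<sigma>' where "\<sigma>' = flip_rotation H S \<sigma>"
  define T' where "T' = {e \<in> arcs H. (e \<in> T) \<noteq> (e \<in> boundary H S)}"
  define \<phi> where "\<phi> = (\<lambda>(h, s). (h, s \<noteq> (end_vertex H h \<in> S)))"
  have \<sigma>': "\<sigma>' \<in> rotation_systems H" unfolding \<sigma>'_def by (rule flip_rotation_in[OF fin \<sigma>])
  note perm = rotation_systemsD(2)[OF \<sigma>] finite_edge_ends[OF fin] rotation_systemsD(3)[OF \<sigma>]
    opposite_image_edge_ends[of H]
  note perm' = rotation_systemsD(2)[OF \<sigma>'] finite_edge_ends[OF fin] rotation_systemsD(3)[OF \<sigma>']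
    opposite_image_edge_ends[of H]
  have "num_orbits (face_step (\<sigma>', T')) (\<phi> ` (?E \<times> UNIV)) = num_orbits (face_step (\<sigma>, T)) (?E \<times> UNIV)"
  proof (rule num_orbits_semiconj)
    show "inj_on \<phi> (?E \<times> UNIV)" by (auto simp: \<phi>_def inj_on_def)
    show "face_step (\<sigma>, T) ` (?E \<times> UNIV) \<subseteq> ?E \<times> UNIV" by (rule face_step_image_subset[OF perm])
    fix z :: "'b edge_end \<times> bool" assume "z \<in> ?E \<times> UNIV"
    then obtain h s where z: "z = (h, s)" and h: "h \<in> ?E" by auto
    define k where "k = opposite h"
    define b where "b = (s \<noteq> (fst h \<in> T))"
    have k: "k \<in> ?E" using h by (simp add: k_def)
    \<comment> \<open>The twist changes exactly when one of the two ends lies in \<open>S\<close>,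
      which matches the flags as they are read at the two ends of the edge.\<close>
    have "fst h \<in> T' \<longleftrightarrow> (fst h \<in> T) \<noteq> ((end_vertex H h \<in> S) \<noteq> (end_vertex H k \<in> S))"
      using h by (auto simp: T'_def boundary_def k_def edge_ends_def end_vertex_def opposite_def)
    then have flag: "((s \<noteq> (end_vertex H h \<in> S)) \<noteq> (fst h \<in> T')) = (b \<noteq> (end_vertex H k \<in> S))"
      by (auto simp: b_def)
    define w where "w = (if b then \<sigma> else inv \<sigma>) k"
    have w: "end_vertex H w = end_vertex H k"
      using end_vertex_rotation[OF fin \<sigma> k] end_vertex_inv_rotation[OF fin \<sigma> k] by (simp add: w_def)
    have "(if b \<noteq> (end_vertex H k \<in> S) then \<sigma>' else inv \<sigma>') k = w"
      using k inv_flip_rotation[OF fin \<sigma>, of S k] by (auto simp: w_def \<sigma>'_def flip_rotation_def)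
    then have "face_step (\<sigma>', T') (\<phi> z) = (w, b \<noteq> (end_vertex H k \<in> S))"
      by (simp only: z \<phi>_def prod.case face_step_apply flag k_def[symmetric])
    moreover have "face_step (\<sigma>, T) z = (w, b)"
      by (simp add: z face_step_apply w_def b_def k_def)
    ultimately show "face_step (\<sigma>', T') (\<phi> z) = \<phi> (face_step (\<sigma>, T) z)"
      by (simp add: \<phi>_def w)
  qed
  moreover have "\<phi> ` (?E \<times> UNIV) = ?E \<times> UNIV"
  proof -
    have "z \<in> \<phi> ` (?E \<times> UNIV)" if "z \<in> ?E \<times> UNIV" for z
      using that by (auto simp: \<phi>_def image_iff split: prod.splits)
    then show ?thesis by (auto simp: \<phi>_def)
  qed
  ultimately show ?thesis
    using num_orbits_face_step[OF perm, of T] num_orbits_face_step[OF perm', of T']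
    by (simp add: XE switch_eq \<sigma>'_def T'_def)
qed

lemma finite_signed_rotation_systems:
  "fin_digraph H \<Longrightarrow> finite (signed_rotation_systems H)"
  by (simp add: signed_rotation_systems_def finite_rotation_systems fin_digraph.finite_arcs)

lemma signed_rotation_systems_nonempty:
  "fin_digraph H \<Longrightarrow> signed_rotation_systems H \<noteq> {}"
  using rotation_systems_nonempty by (auto simp: signed_rotation_systems_def)

lemma euler_genus_class:
  assumes fin: "fin_digraph H" and X: "X \<in> signed_rotation_systems H"
  shows "euler_genus H (switch_rel H `` {X}) = signed_euler_genus H X"
proof -
  have "signed_euler_genus H ` switch_rel H `` {X} = {signed_euler_genus H X}"
    unfolding switch_class[OF assms] image_image
    by (auto simp: signed_euler_genus_def signed_num_faces_eq face_classes_switch[OF assms])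
  then show ?thesis by (simp add: euler_genus_def)
qed

lemma map_pmf_switch_class:
  assumes fin: "fin_digraph H"
  shows "map_pmf (\<lambda>X. switch_rel H `` {X}) (pmf_of_set (signed_rotation_systems H)) =
    pmf_of_set (general_embeddings H)"
proof -
  let ?A = "signed_rotation_systems H" and ?f = "\<lambda>X. switch_rel H `` {X}"
  note eq = equiv_switch_rel[OF fin]
  obtain Z where Z: "Z \<in> ?A" using signed_rotation_systems_nonempty[OF fin] by auto
  have "general_embeddings H = ?f ` ?A" by (auto simp: general_embeddings_def quotient_def)
  moreover have "map_pmf ?f (pmf_of_set ?A) = pmf_of_set (?f ` ?A)"
  proof (rule map_pmf_of_set_equal_fibers[OF finite_signed_rotation_systems[OF fin]
        signed_rotation_systems_nonempty[OF fin], where k = "card (?f Z)"])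
    fix C assume "C \<in> ?f ` ?A"
    then obtain X where X: "X \<in> ?A" "C = ?f X" by auto
    have "?f Y = C \<longleftrightarrow> Y \<in> C" if "Y \<in> ?A" for Y
      using eq_equiv_class_iff[OF eq X(1) that] by (auto simp: X(2))
    moreover have "C \<subseteq> ?A" by (auto simp: X(2) switch_rel_def)
    ultimately have "{Y \<in> ?A. ?f Y = C} = C" by blast
    then show "card {Y \<in> ?A. ?f Y = C} = card (?f Z)"
      using card_switch_class[OF fin X(1) Z] X by simp
  qed
  ultimately show ?thesis by simp
qed

section \<open>Bar-rings\<close>

lemma cyclic_on_singleton_iff: "cyclic_on f {x} \<longleftrightarrow> f x = x"
  using orbit_eq_singleton_iff[of f x] by (auto simp: cyclic_on_def)

lemma cyclic_on_doubleton_iff: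
  assumes "x \<noteq> y"
  shows "cyclic_on f {x, y} \<longleftrightarrow> f x = y \<and> f y = x"
proof
  assume cyc: "cyclic_on f {x, y}"
  have "f x \<in> {x, y}" "f y \<in> {x, y}" using cyclic_on_inI[OF cyc] by auto
  moreover have "orbit f x = {x, y}" "orbit f y = {x, y}"
    using orbit_cyclic_eq3[OF cyc] by auto
  then have "f x \<noteq> x" "f y \<noteq> y"
    using orbit_eq_singleton_iff[of f x] orbit_eq_singleton_iff[of f y] assms by auto
  ultimately show "f x = y \<and> f y = x" by auto
next
  assume f: "f x = y \<and> f y = x"
  have "orbit f x \<subseteq> {x, y}" by (rule orbit_subset_invariant) (use f in auto)
  moreover have "y \<in> orbit f x" using orbit.base[of f x] f by simp
  moreover from this have "x \<in> orbit f x" using orbit.step[of y f x] f by simp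
  ultimately have "{x, y} = orbit f x" by auto
  then show "cyclic_on f {x, y}" unfolding cyclic_on_def by blast
qed

definition lift_end :: "nat \<Rightarrow> 'e edge_end \<Rightarrow> ((nat \<times> 'e) + nat) edge_end" where
  "lift_end i g = (Inl (i, fst g), snd g)"

definition bar_end :: "nat \<Rightarrow> bool \<Rightarrow> ((nat \<times> 'e) + nat) edge_end" where
  "bar_end i b = (Inr i, b)"

definition unlift_end :: "((nat \<times> 'e) + nat) edge_end \<Rightarrow> 'e edge_end" where
  "unlift_end h = (snd (projl (fst h)), snd h)"

lemma lift_bar_end_simps [simp]:
  "lift_end i g = lift_end j g' \<longleftrightarrow> i = j \<and> g = g'" "lift_end i g \<noteq> bar_end j b" "bar_end j b \<noteq> lift_end i g"
  "bar_end i b = bar_end j b' \<longleftrightarrow> i = j \<and> b = b'"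
  "opposite (lift_end i g) = lift_end i (opposite g)" "opposite (bar_end i b) = bar_end i (\<not> b)"
  "fst (lift_end i g) = Inl (i, fst g)" "fst (bar_end i b) = Inr i" "unlift_end (lift_end i g) = g"
  by (auto simp: lift_end_def bar_end_def unlift_end_def opposite_def prod_eq_iff)

lemma edge_end_cases:
  obtains i g where "h = lift_end i g" | i b where "h = bar_end i b"
proof (cases h)
  case (Pair x b)
  then show thesis
  proof (cases x)
    case (Inl y)
    then have "h = lift_end (fst y) (snd y, b)" using Pair by (simp add: lift_end_def)
    then show thesis using that(1) by blast
  next
    case (Inr i)
    then have "h = bar_end i b" using Pair by (simp add: bar_end_def)
    then show thesis using that(2) by blast
  qed
qed

text \<open>This is a bar cut loose at both ends. Its four states form two orbits of length two that
  are reversals of each other, whether the edge is twisted or not.\<close>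

lemma face_classes_fixed_edge:
  assumes \<sigma>: "bij \<sigma>" "\<sigma> h = h" "\<sigma> (opposite h) = opposite h"
  shows "face_classes {h, opposite h} (\<sigma>, T) = 1"
proof -
  let ?A = "{h, opposite h}"
  let ?f = "face_step (\<sigma>, T)" and ?r = "reverse_state (\<sigma>, T)"
  have fin: "finite ?A" and sA: "\<sigma> ` ?A \<subseteq> ?A" and oA: "opposite ` ?A \<subseteq> ?A" using \<sigma> by auto
  have inv: "inv \<sigma> k = k" if "k \<in> ?A" for k
    using that \<sigma> bij_inv_apply(1)[OF \<sigma>(1), of k] by auto
  have f: "?f (k, s) = (opposite k, s \<noteq> (fst k \<in> T))" if "k \<in> ?A" for k s
  proof -
    have k: "opposite k \<in> ?A" using that by auto
    then have "\<sigma> (opposite k) = opposite k" "inv \<sigma> (opposite k) = opposite k"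
      using inv[OF k] \<sigma> by auto
    then show ?thesis by (simp add: face_step_apply)
  qed
  have bij: "bij_betw ?f (?A \<times> UNIV) (?A \<times> UNIV)" by (rule bij_betw_face_step[OF \<sigma>(1) fin sA oA])
  have cls: "orbit ?f (k, s) \<union> orbit ?f (?r (k, s)) = ?A \<times> UNIV" if k: "k \<in> ?A" for k s
  proof
    have r: "?r (k, s) \<in> ?A \<times> UNIV" using k by (auto simp: reverse_state_apply)
    show "orbit ?f (k, s) \<union> orbit ?f (?r (k, s)) \<subseteq> ?A \<times> UNIV"
    proof (rule Un_least)
      note closed = face_step_image_subset[OF \<sigma>(1) fin sA oA]
      show "orbit ?f (k, s) \<subseteq> ?A \<times> UNIV" by (rule orbit_subset_invariant[OF closed]) (use k in simp)
      show "orbit ?f (?r (k, s)) \<subseteq> ?A \<times> UNIV" by (rule orbit_subset_invariant[OF closed r])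
    qed
    have 1: "(k, s) \<in> orbit ?f (k, s)"
      by (rule self_in_orbit_bij_betw[OF _ bij]) (use k in auto)
    have 2: "(opposite k, s \<noteq> (fst k \<in> T)) \<in> orbit ?f (k, s)"
      using orbit.base[of ?f "(k, s)"] f[OF k] by simp
    have 3: "(opposite k, s = (fst k \<in> T)) \<in> orbit ?f (?r (k, s))"
      using self_in_orbit_bij_betw[OF _ bij r] by (simp add: reverse_state_apply)
    have 4: "(k, \<not> s) \<in> orbit ?f (?r (k, s))"
    proof -
      have "opposite k \<in> ?A" using k by auto
      then have "?f (?r (k, s)) = (k, \<not> s)" by (auto simp: reverse_state_apply f)
      then show ?thesis using orbit.base[of ?f "?r (k, s)"] by simp
    qed
    show "?A \<times> UNIV \<subseteq> orbit ?f (k, s) \<union> orbit ?f (?r (k, s))"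
    proof
      fix z assume "z \<in> ?A \<times> (UNIV :: bool set)"
      then obtain k' s' where z: "z = (k', s')" "k' \<in> ?A" by auto
      then have "k' = k \<or> k' = opposite k" using k by auto
      then have "z = (k, s) \<or> z = (k, \<not> s) \<or> z = (opposite k, s \<noteq> (fst k \<in> T)) \<or>
        z = (opposite k, s = (fst k \<in> T))"
        using z by (cases s; cases s') auto
      then show "z \<in> orbit ?f (k, s) \<union> orbit ?f (?r (k, s))" using 1 2 3 4 by blast
    qed
  qed
  have "(\<lambda>x. orbit ?f x \<union> orbit ?f (?r x)) ` (?A \<times> UNIV) = (\<lambda>x. ?A \<times> UNIV) ` (?A \<times> (UNIV :: bool set))"
  proof (rule image_cong[OF refl])
    fix x assume "x \<in> ?A \<times> (UNIV :: bool set)"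
    then show "orbit ?f x \<union> orbit ?f (?r x) = ?A \<times> UNIV" using cls by (metis SigmaE)
  qed
  also have "\<dots> = {?A \<times> UNIV}" by (rule image_constant[of "(h, True)"]) simp
  finally show ?thesis unfolding face_classes_def by simp
qed

locale bar_ring_pieces =
  fixes G :: "nat \<Rightarrow> ('v, 'e) pre_digraph" and u v :: "nat \<Rightarrow> 'v" and n :: nat
  assumes graphs: "\<And>i. i \<in> {1..n} \<Longrightarrow> fin_digraph (G i)"
    and marked: "\<And>i. i \<in> {1..n} \<Longrightarrow> pendant (G i) (u i) \<and> pendant (G i) (v i) \<and> u i \<noteq> v i"
begin

abbreviation "H \<equiv> bar_ring G u v n"

definition next_index :: "nat \<Rightarrow> nat" where "next_index i = i mod n + 1"

text \<open>Bar \<open>i\<close> runs from \<open>v i\<close> to \<open>u (next_index i)\<close>, so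
  this is the index of the bar that ends at \<open>u i\<close>.\<close>

definition prev_index :: "nat \<Rightarrow> nat" where "prev_index i = (if i = 1 then n else i - 1)"

definition u_end :: "nat \<Rightarrow> 'e edge_end" where "u_end i = the_elem (ends_at (G i) (u i))"

definition v_end :: "nat \<Rightarrow> 'e edge_end" where "v_end i = the_elem (ends_at (G i) (v i))"

lemma next_index_eq: "i \<in> {1..n} \<Longrightarrow> next_index i = (if i = n then 1 else Suc i)"
  by (auto simp: next_index_def)

lemma index_shift: "i \<in> {1..n} \<Longrightarrow> next_index i \<in> {1..n}" "i \<in> {1..n} \<Longrightarrow> prev_index i \<in> {1..n}"
    "i \<in> {1..n} \<Longrightarrow> next_index (prev_index i) = i" "i \<in> {1..n} \<Longrightarrow> prev_index (next_index i) = i"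
proof -
  assume i: "i \<in> {1..n}"
  show "next_index i \<in> {1..n}" using i by (auto simp: next_index_eq)
  show prev_index: "prev_index i \<in> {1..n}" using i by (auto simp: prev_index_def)
  show "next_index (prev_index i) = i" using i by (auto simp: next_index_eq[OF prev_index]) (auto simp: prev_index_def split: if_splits)
  show "prev_index (next_index i) = i" using i by (auto simp: next_index_eq[OF i] prev_index_def)
qed

lemma ends_at_marked:
  assumes "i \<in> {1..n}"
  shows "ends_at (G i) (u i) = {u_end i}" "ends_at (G i) (v i) = {v_end i}"
  using marked[OF assms] by (auto simp: pendant_def u_end_def v_end_def card_1_singleton_iff)

lemma marked_end_iff:
  assumes "i \<in> {1..n}" "g \<in> edge_ends (G i)"
  shows "end_vertex (G i) g = u i \<longleftrightarrow> g = u_end i" "end_vertex (G i) g = v i \<longleftrightarrow> g = v_end i"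
  using ends_at_marked[OF assms(1)] assms(2) by (auto simp: ends_at_def)

lemma marked_ends:
  assumes "i \<in> {1..n}"
  shows "u_end i \<in> edge_ends (G i)" "v_end i \<in> edge_ends (G i)" "u_end i \<noteq> v_end i"
    "end_vertex (G i) (u_end i) = u i" "end_vertex (G i) (v_end i) = v i"
proof -
  have "u_end i \<in> ends_at (G i) (u i)" "v_end i \<in> ends_at (G i) (v i)" using ends_at_marked[OF assms] by auto
  then show "u_end i \<in> edge_ends (G i)" "v_end i \<in> edge_ends (G i)" "u_end i \<noteq> v_end i"
    "end_vertex (G i) (u_end i) = u i" "end_vertex (G i) (v_end i) = v i"
    using marked[OF assms] by (auto simp: ends_at_def)
qed

lemma in_edge_ends_ring [simp]:
  "lift_end i g \<in> edge_ends H \<longleftrightarrow> i \<in> {1..n} \<and> g \<in> edge_ends (G i)"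
  "bar_end i b \<in> edge_ends H \<longleftrightarrow> i \<in> {1..n}"
  by (cases g) (auto simp: edge_ends_def bar_ring_def lift_end_def bar_end_def)

lemma end_vertex_ring [simp]:
  "end_vertex H (lift_end i g) = (i, end_vertex (G i) g)"
  "end_vertex H (bar_end i b) = (if b then (next_index i, u (next_index i)) else (i, v i))"
  by (auto simp: end_vertex_def bar_ring_def lift_end_def bar_end_def next_index_def Let_def)

lemma in_verts_ring: "(i, x) \<in> verts H \<longleftrightarrow> i \<in> {1..n} \<and> x \<in> verts (G i)"
  by (auto simp: bar_ring_def)

lemma fin_digraph_ring: "fin_digraph H"
proof
  have wf: "wf_digraph (G i)" if "i \<in> {1..n}" for i
    using graphs[OF that] by (simp add: fin_digraph_def)
  have uv: "u i \<in> verts (G i)" "v i \<in> verts (G i)" if "i \<in> {1..n}" for i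
    using marked[OF that] by (auto simp: pendant_def)
  show "finite (verts H)" "finite (arcs H)"
    using fin_digraph.finite_verts[OF graphs] fin_digraph.finite_arcs[OF graphs]
    by (auto simp: bar_ring_def)
  fix e assume e: "e \<in> arcs H"
  show "tail H e \<in> verts H"
    using e uv wf_digraph.tail_in_verts[OF wf] by (auto simp: bar_ring_def)
  show "head H e \<in> verts H"
    using e uv(1)[OF index_shift(1)] index_shift(1) wf_digraph.head_in_verts[OF wf]
    by (auto simp: bar_ring_def Let_def next_index_def)
qed

section \<open>Rotations of the ring and their restrictions\<close>

lemma ends_at_ring:
  assumes i: "i \<in> {1..n}"
  shows "ends_at H (i, x) = lift_end i ` ends_at (G i) x \<union> (if x = v i then {bar_end i False} else {}) \<union>
    (if x = u i then {bar_end (prev_index i) True} else {})"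
proof (rule set_eqI)
  fix h
  show "h \<in> ends_at H (i, x) \<longleftrightarrow> h \<in> lift_end i ` ends_at (G i) x \<union> (if x = v i then {bar_end i False} else {}) \<union>
    (if x = u i then {bar_end (prev_index i) True} else {})"
  proof (cases h rule: edge_end_cases)
    case (1 j g)
    then show ?thesis using i by (auto simp: ends_at_def)
  next
    case (2 j b)
    show ?thesis
    proof (cases b)
      case True
      have "j \<in> {1..n} \<and> next_index j = i \<longleftrightarrow> j = prev_index i" using index_shift(2)[OF i] index_shift(3)[OF i] index_shift(4) by metis
      then show ?thesis by (auto simp: 2 True ends_at_def)
    next
      case False
      then show ?thesis using 2 i by (auto simp: ends_at_def)
    qed
  qed
qed

lemma ends_at_ring_cases:
  assumes i: "i \<in> {1..n}"
  shows "ends_at H (i, u i) = {lift_end i (u_end i), bar_end (prev_index i) True}"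
    "ends_at H (i, v i) = {lift_end i (v_end i), bar_end i False}"
    "x \<noteq> u i \<Longrightarrow> x \<noteq> v i \<Longrightarrow> ends_at H (i, x) = lift_end i ` ends_at (G i) x"
  using marked[OF i] by (auto simp: ends_at_ring[OF i] ends_at_marked[OF i])

text \<open>A marked vertex has exactly two edge-ends in the ring, and two ends have only one cyclic
  order. All freedom of a rotation system of the ring therefore lies inside the graphs
  \<open>G i\<close>.\<close>

lemma rotation_at_marked:
  assumes \<sigma>: "\<sigma> \<in> rotation_systems H" and i: "i \<in> {1..n}"
  shows "\<sigma> (lift_end i (u_end i)) = bar_end (prev_index i) True" "\<sigma> (bar_end (prev_index i) True) = lift_end i (u_end i)"
    "\<sigma> (lift_end i (v_end i)) = bar_end i False" "\<sigma> (bar_end i False) = lift_end i (v_end i)"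
proof -
  have "(i, u i) \<in> verts H" "(i, v i) \<in> verts H"
    using i marked[OF i] by (auto simp: in_verts_ring pendant_def)
  moreover have "ends_at H (i, u i) \<noteq> {}" "ends_at H (i, v i) \<noteq> {}"
    by (simp_all add: ends_at_ring_cases[OF i])
  ultimately have "cyclic_on \<sigma> (ends_at H (i, u i))" "cyclic_on \<sigma> (ends_at H (i, v i))"
    by (blast intro: rotation_systemsD(4)[OF \<sigma>])+
  then show "\<sigma> (lift_end i (u_end i)) = bar_end (prev_index i) True" "\<sigma> (bar_end (prev_index i) True) = lift_end i (u_end i)"
    "\<sigma> (lift_end i (v_end i)) = bar_end i False" "\<sigma> (bar_end i False) = lift_end i (v_end i)"
    by (auto simp: ends_at_ring_cases[OF i] cyclic_on_doubleton_iff)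
qed

text \<open>When the ring is cut, the marked vertices become pendant again and their single ends are
  fixed points; every other vertex keeps its rotation.\<close>

definition restrict_rotation ::
  "nat \<Rightarrow> (((nat \<times> 'e) + nat) edge_end \<Rightarrow> ((nat \<times> 'e) + nat) edge_end) \<Rightarrow> 'e edge_end \<Rightarrow> 'e edge_end" where
  "restrict_rotation i \<sigma> g =
     (if g \<in> edge_ends (G i) \<and> g \<noteq> u_end i \<and> g \<noteq> v_end i then unlift_end (\<sigma> (lift_end i g)) else g)"

definition restrict_twist :: "nat \<Rightarrow> ((nat \<times> 'e) + nat) set \<Rightarrow> 'e set" where
  "restrict_twist i T = {e \<in> arcs (G i). Inl (i, e) \<in> T}"

lemma rotation_lift:
  assumes \<sigma>: "\<sigma> \<in> rotation_systems H" and i: "i \<in> {1..n}"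
    and g: "g \<in> edge_ends (G i)" "g \<noteq> u_end i" "g \<noteq> v_end i"
  shows "\<sigma> (lift_end i g) = lift_end i (restrict_rotation i \<sigma> g)"
    and "restrict_rotation i \<sigma> g \<in> ends_at (G i) (end_vertex (G i) g)"
proof -
  let ?x = "end_vertex (G i) g"
  have x: "?x \<noteq> u i" "?x \<noteq> v i" using marked_end_iff[OF i g(1)] g by auto
  have "lift_end i g \<in> edge_ends H" using i g by simp
  then have "\<sigma> (lift_end i g) \<in> edge_ends H" using rotation_systemsD(3)[OF \<sigma>] by auto
  moreover have "end_vertex H (\<sigma> (lift_end i g)) = (i, ?x)"
    using end_vertex_rotation[OF fin_digraph_ring \<sigma> \<open>lift_end i g \<in> edge_ends H\<close>] by simp
  ultimately have "\<sigma> (lift_end i g) \<in> ends_at H (i, ?x)" by (simp add: ends_at_def)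
  then obtain g' where "g' \<in> ends_at (G i) ?x" "\<sigma> (lift_end i g) = lift_end i g'"
    using ends_at_ring_cases(3)[OF i x] by auto
  then show "\<sigma> (lift_end i g) = lift_end i (restrict_rotation i \<sigma> g)"
    and "restrict_rotation i \<sigma> g \<in> ends_at (G i) ?x"
    using g by (auto simp: restrict_rotation_def)
qed

lemma restrict_rotation_in:
  assumes \<sigma>: "\<sigma> \<in> rotation_systems H" and i: "i \<in> {1..n}"
  shows "restrict_rotation i \<sigma> \<in> rotation_systems (G i)"
proof (rule rotation_systemsI[OF graphs[OF i]])
  fix x assume x: "x \<in> verts (G i)" "ends_at (G i) x \<noteq> {}"
  consider "x = u i" | "x = v i" | "x \<noteq> u i" "x \<noteq> v i" by blast
  then show "cyclic_on (restrict_rotation i \<sigma>) (ends_at (G i) x)"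
  proof cases
    case 3
    have eq: "ends_at H (i, x) = lift_end i ` ends_at (G i) x" by (rule ends_at_ring_cases(3)[OF i 3])
    have "cyclic_on \<sigma> (lift_end i ` ends_at (G i) x)"
      unfolding eq[symmetric]
      by (rule rotation_systemsD(4)[OF \<sigma>]) (use x i eq in \<open>auto simp: in_verts_ring\<close>)
    then have "cyclic_on (restrict_rotation i \<sigma>) (unlift_end ` lift_end i ` ends_at (G i) x)"
    proof (rule cyclic_on_image)
      fix h assume "h \<in> lift_end i ` ends_at (G i) x"
      then obtain g where g: "g \<in> ends_at (G i) x" "h = lift_end i g" by auto
      then have gE: "g \<in> edge_ends (G i)" "end_vertex (G i) g = x" by (auto simp: ends_at_def)
      then have "g \<noteq> u_end i" "g \<noteq> v_end i" using marked_end_iff[OF i gE(1)] 3 by auto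
      then show "restrict_rotation i \<sigma> (unlift_end h) = unlift_end (\<sigma> h)"
        using g gE by (simp add: restrict_rotation_def)
    qed
    then show ?thesis by (simp add: image_image)
  qed (simp_all add: ends_at_marked[OF i] cyclic_on_singleton_iff restrict_rotation_def)
qed (simp add: restrict_rotation_def)

text \<open>The components in ring order are graph 1, bar 1, graph 2, bar 2 and so on, with levels
  counted from 0. Joint \<open>2 * i - 1\<close> lies at \<open>v i\<close>, between graph
  \<open>i\<close> and bar \<open>i\<close>; joint \<open>2 * i\<close> lies at the head of bar
  \<open>i\<close>, and for \<open>i = n\<close> it leads back to level 0. At each joint
  \<open>p\<close> is the end on the component that comes first.\<close>

definition p :: "nat \<Rightarrow> ((nat \<times> 'e) + nat) edge_end" where
  "p j = (if odd j then lift_end (Suc j div 2) (v_end (Suc j div 2)) else bar_end (j div 2) True)"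

definition q :: "nat \<Rightarrow> ((nat \<times> 'e) + nat) edge_end" where
  "q j = (if odd j then bar_end (Suc j div 2) False else lift_end (next_index (j div 2)) (u_end (next_index (j div 2))))"

definition L :: "((nat \<times> 'e) + nat) edge_end \<Rightarrow> nat" where
  "L h = (case fst h of Inl (i, e) \<Rightarrow> 2 * i - 2 | Inr i \<Rightarrow> 2 * i - 1)"

lemma L_simps [simp]: "L (lift_end i g) = 2 * i - 2" "L (bar_end i b) = 2 * i - 1"
  by (simp_all add: L_def lift_end_def bar_end_def)

lemma pq_simps [simp]:
  assumes "i \<ge> 1"
  shows "p (2 * i - Suc 0) = lift_end i (v_end i)" "p (2 * i) = bar_end i True"
    "q (2 * i - Suc 0) = bar_end i False" "q (2 * i) = lift_end (next_index i) (u_end (next_index i))"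
  using assms by (auto simp: p_def q_def)

lemma index_cases:
  assumes "1 \<le> j" "j \<le> 2 * n"
  obtains i where "i \<in> {1..n}" "j = 2 * i - 1" | i where "i \<in> {1..n}" "j = 2 * i"
proof (cases "odd j")
  case True
  then obtain k where "j = 2 * k + 1" by (rule oddE)
  then have "Suc k \<in> {1..n}" "j = 2 * Suc k - 1" using assms by auto
  then show thesis by (rule that(1))
next
  case False
  then obtain k where "j = 2 * k" by (auto elim: evenE)
  then have "k \<in> {1..n}" using assms by auto
  then show thesis using \<open>j = 2 * k\<close> by (rule that(2))
qed

definition joint_ends :: "((nat \<times> 'e) + nat) edge_end set" where
  "joint_ends = (\<Union>i\<in>{1..n}. {lift_end i (u_end i), lift_end i (v_end i), bar_end i False, bar_end i True})"

lemma joint_ends_eq: "p ` {1..2 * n} \<union> q ` {1..2 * n} = joint_ends"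
proof (intro equalityI subsetI)
  fix h assume "h \<in> p ` {1..2 * n} \<union> q ` {1..2 * n}"
  then obtain j where j: "1 \<le> j" "j \<le> 2 * n" and h: "h = p j \<or> h = q j" by auto
  from j show "h \<in> joint_ends"
  proof (cases rule: index_cases)
    case (1 i)
    then have "h = lift_end i (v_end i) \<or> h = bar_end i False" using h by auto
    then show ?thesis using 1 unfolding joint_ends_def by blast
  next
    case (2 i)
    then have "h = bar_end i True \<or> h = lift_end (next_index i) (u_end (next_index i))" using h by auto
    then show ?thesis using 2 index_shift(1)[of i] unfolding joint_ends_def by blast
  qed
next
  fix h assume "h \<in> joint_ends"
  then obtain i where i: "i \<in> {1..n}" and h: "h \<in> {lift_end i (u_end i), lift_end i (v_end i), bar_end i False, bar_end i True}"
    unfolding joint_ends_def by blast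
  have ge: "i \<ge> 1" "prev_index i \<ge> 1" using i index_shift(2)[OF i] by auto
  have "h \<in> {q (2 * prev_index i), p (2 * i - 1), q (2 * i - 1), p (2 * i)}"
    using h pq_simps[OF ge(1)] pq_simps(4)[OF ge(2)] index_shift(3)[OF i] by auto
  moreover have "2 * prev_index i \<in> {1..2 * n}" "2 * i - 1 \<in> {1..2 * n}" "2 * i \<in> {1..2 * n}"
    using i index_shift(2)[OF i] by auto
  ultimately show "h \<in> p ` {1..2 * n} \<union> q ` {1..2 * n}" by blast
qed

lemma in_joint_ends:
  "lift_end i g \<in> joint_ends \<longleftrightarrow> i \<in> {1..n} \<and> (g = u_end i \<or> g = v_end i)"
  "bar_end i b \<in> joint_ends \<longleftrightarrow> i \<in> {1..n}"
  by (cases b) (auto simp: joint_ends_def)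

lemma ring_of_components_ring:
  assumes n: "n \<ge> 1" and \<sigma>: "\<sigma> \<in> rotation_systems H"
  shows "ring_of_components (edge_ends H) (2 * n) p q L \<sigma>"
proof
  show "finite (edge_ends H)" by (rule finite_edge_ends[OF fin_digraph_ring])
  show "opposite ` edge_ends H \<subseteq> edge_ends H" by (rule opposite_image_edge_ends)
  show "\<sigma> permutes edge_ends H" by (rule rotation_systemsD(1)[OF \<sigma>])
  show "1 \<le> 2 * n" using n by simp
next
  fix j assume j: "1 \<le> j" "j \<le> 2 * n"
  have "p j \<in> edge_ends H \<and> q j \<in> edge_ends H \<and> Suc (L (p j)) = j \<and> L (q j) = j mod (2 * n) \<and>
    \<sigma> (p j) = q j \<and> \<sigma> (q j) = p j"
    using j
  proof (cases rule: index_cases)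
    case (1 i)
    have "1 \<le> i" using 1 by simp
    then show ?thesis
      using 1 marked_ends[OF 1(1)] rotation_at_marked[OF \<sigma> 1(1)] by auto
  next
    case (2 i)
    have i: "1 \<le> i" using 2 by simp
    \<comment> \<open>For \<open>i = n\<close> both sides are 0: this is the closing joint.\<close>
    have "2 * next_index i - 2 = 2 * (i mod n)" by (simp add: next_index_def)
    then have "2 * next_index i - 2 = 2 * i mod (2 * n)" by (simp only: mult_mod_right)
    then show ?thesis
      using 2 i marked_ends[OF index_shift(1)[OF 2(1)]] rotation_at_marked[OF \<sigma> index_shift(1)[OF 2(1)]]
        index_shift(1,4)[OF 2(1)] by auto
  qed
  then show "p j \<in> edge_ends H" "q j \<in> edge_ends H" "Suc (L (p j)) = j" "L (q j) = j mod (2 * n)"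
    "\<sigma> (p j) = q j" "\<sigma> (q j) = p j" by blast+
next
  fix i j assume i: "1 \<le> i" "i \<le> 2 * n" and j: "1 \<le> j" "j \<le> 2 * n"
  from i show "p i \<noteq> q j"
  proof (cases rule: index_cases)
    case i: (1 k)
    from j show ?thesis
    proof (cases rule: index_cases)
      case (1 l)
      then show ?thesis using i by auto
    next
      case (2 l)
      \<comment> \<open>The two ends may belong to the same graph; then they differ because its
        marked vertices do.\<close>
      then show ?thesis using i marked_ends(3)[OF index_shift(1)[OF 2(1)]] by auto
    qed
  next
    case i: (2 k)
    from j show ?thesis
    proof (cases rule: index_cases)
      case (1 l)
      then show ?thesis using i by auto
    next
      case (2 l)
      then show ?thesis using i by auto
    qed
  qed
next
  fix h assume "h \<in> edge_ends H"
  show "L (opposite h) = L h" by (cases h rule: edge_end_cases) auto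
next
  fix h assume h: "h \<in> edge_ends H" "h \<notin> p ` {1..2 * n} \<union> q ` {1..2 * n}"
  have "h \<notin> joint_ends" using h(2) unfolding joint_ends_eq .
  show "L (\<sigma> h) = L h"
  proof (cases h rule: edge_end_cases)
    case (1 i g)
    with \<open>h \<notin> joint_ends\<close> show ?thesis using h(1) rotation_lift(1)[OF \<sigma>, of i g] by (auto simp: in_joint_ends)
  next
    case (2 i b)
    with \<open>h \<notin> joint_ends\<close> show ?thesis using h(1) by (auto simp: in_joint_ends)
  qed
qed

text \<open>With all joints open, the faces are those of the graphs \<open>G i\<close> and one for
  each of the \<open>n\<close> bars. The \<open>2 * n\<close> joints contribute
  \<open>- 2 * n + 1\<close> up to an error of one, which leaves \<open>- n + 1\<close>.\<close>

theorem face_classes_bar_ring: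
  assumes n: "n \<ge> 1" and \<sigma>: "\<sigma> \<in> rotation_systems H"
  shows "\<bar>int (face_classes (edge_ends H) (\<sigma>, T)) -
    ((\<Sum>i=1..n. int (face_classes (edge_ends (G i)) (restrict_rotation i \<sigma>, restrict_twist i T)))
      - int n + 1)\<bar> \<le> 1"
proof -
  interpret R: ring_of_components "edge_ends H" "2 * n" p q L \<sigma>
    by (rule ring_of_components_ring[OF n \<sigma>])
  \<comment> \<open>The ring with all its joints cut open.\<close>
  define \<tau> where "\<tau> = R.stage 0"
  let ?f = "face_step (\<tau>, T)"
  have perm: "\<tau> permutes edge_ends H" unfolding \<tau>_def by (rule R.stage_permutes)
  note bij = permutes_bij[OF perm]
  have pend: "R.pending 0 = joint_ends"
    using joint_ends_eq by (auto simp: R.pending_def simp flip: atLeastSucAtMost_greaterThanAtMost)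
  have \<tau>_lift: "\<tau> (lift_end i g) = lift_end i (restrict_rotation i \<sigma> g)"
    if "i \<in> {1..n}" "g \<in> edge_ends (G i)" for i g
    using that rotation_lift(1)[OF \<sigma> that(1,2)]
    by (auto simp: \<tau>_def R.stage_def pend in_joint_ends restrict_rotation_def)
  have \<tau>_bar: "\<tau> (bar_end i b) = bar_end i b" if "i \<in> {1..n}" for i b
    using that by (simp add: \<tau>_def R.stage_def pend in_joint_ends)
  define piece :: "nat + nat \<Rightarrow> ((nat \<times> 'e) + nat) edge_end set" where
    "piece x = (case x of Inl i \<Rightarrow> lift_end i ` edge_ends (G i) | Inr i \<Rightarrow> {bar_end i False, bar_end i True})" for x
  let ?I = "{1..n} <+> {1..n}"
  have E: "edge_ends H \<times> UNIV = (\<Union>x\<in>?I. piece x \<times> (UNIV :: bool set))"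
  proof -
    have bex: "(\<exists>x\<in>?I. P x) \<longleftrightarrow> (\<exists>i\<in>{1..n}. P (Inl i)) \<or> (\<exists>i\<in>{1..n}. P (Inr i))" for P
      unfolding Plus_def by blast
    have "h \<in> edge_ends H \<longleftrightarrow> (\<exists>x\<in>?I. h \<in> piece x)" for h
    proof (cases h rule: edge_end_cases)
      case (1 i g)
      then show ?thesis unfolding bex by (auto simp: piece_def)
    next
      case (2 i b)
      then show ?thesis unfolding bex by (cases b) (auto simp: piece_def)
    qed
    then show ?thesis by auto
  qed
  have fin: "finite (piece x)" if "x \<in> ?I" for x
    using that graphs by (auto simp: piece_def intro!: finite_imageI finite_edge_ends)
  have closed: "\<tau> ` piece x \<subseteq> piece x" "opposite ` piece x \<subseteq> piece x" if x: "x \<in> ?I" for x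
  proof -
    from x consider i where "i \<in> {1..n}" "x = Inl i" | i where "i \<in> {1..n}" "x = Inr i" by auto
    then have "\<tau> ` piece x \<subseteq> piece x \<and> opposite ` piece x \<subseteq> piece x"
    proof cases
      case 1
      then show ?thesis
        using rotation_systemsD(3)[OF restrict_rotation_in[OF \<sigma> 1(1)]]
        by (auto simp: piece_def \<tau>_lift)
    next
      case 2
      then show ?thesis by (auto simp: piece_def \<tau>_bar)
    qed
    then show "\<tau> ` piece x \<subseteq> piece x" "opposite ` piece x \<subseteq> piece x" by auto
  qed
  have disj: "piece x \<inter> piece y = {}" if "x \<noteq> y" for x y
    using that by (auto simp: piece_def split: sum.splits)
  have "num_orbits ?f (edge_ends H \<times> UNIV) = (\<Sum>x\<in>?I. num_orbits ?f (piece x \<times> UNIV))"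
    unfolding E
  proof (rule num_orbits_UN_disjoint)
    show "?f ` (piece x \<times> UNIV) \<subseteq> piece x \<times> UNIV" if "x \<in> ?I" for x
      by (rule face_step_image_subset[OF bij fin[OF that] closed[OF that]])
    show "(piece x \<times> UNIV) \<inter> (piece y \<times> (UNIV :: bool set)) = {}" if "x \<noteq> y" for x y
      using disj[OF that] by auto
  qed (use fin in auto)
  also have "\<dots> = (\<Sum>i=1..n. num_orbits ?f (lift_end i ` edge_ends (G i) \<times> UNIV)) +
    (\<Sum>i=1..n. num_orbits ?f ({bar_end i False, bar_end i True} \<times> UNIV))"
    by (simp add: sum.Plus piece_def)
  also have "(\<Sum>i=1..n. num_orbits ?f ({bar_end i False, bar_end i True} \<times> UNIV)) = (\<Sum>i=1..n. 2)"
  proof (rule sum.cong[OF refl])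
    fix i assume i: "i \<in> {1..n}"
    have "face_classes {bar_end i False, opposite (bar_end i False)} (\<tau>, T) = 1"
      by (rule face_classes_fixed_edge[OF bij]) (use \<tau>_bar[OF i] in auto)
    then show "num_orbits ?f ({bar_end i False, bar_end i True} \<times> UNIV) = 2"
      using num_orbits_face_step[OF bij fin[OF InrI[OF i]] closed[OF InrI[OF i]], of T]
      by (simp add: piece_def)
  qed
  also have "(\<Sum>i=1..n. num_orbits ?f (lift_end i ` edge_ends (G i) \<times> UNIV)) =
    (\<Sum>i=1..n. 2 * face_classes (edge_ends (G i)) (restrict_rotation i \<sigma>, restrict_twist i T))"
  proof (rule sum.cong[OF refl])
    fix i assume i: "i \<in> {1..n}"
    let ?\<rho> = "restrict_rotation i \<sigma>" and ?T = "restrict_twist i T" and ?E = "edge_ends (G i)"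
    have \<rho>: "?\<rho> \<in> rotation_systems (G i)" by (rule restrict_rotation_in[OF \<sigma> i])
    note perm\<rho> = rotation_systemsD(2)[OF \<rho>] finite_edge_ends[OF graphs[OF i]] rotation_systemsD(3)[OF \<rho>]
      opposite_image_edge_ends[of "G i"]
    let ?\<phi> = "\<lambda>(g, s :: bool). (lift_end i g, s)"
    have "num_orbits ?f (?\<phi> ` (?E \<times> UNIV)) = num_orbits (face_step (?\<rho>, ?T)) (?E \<times> UNIV)"
    proof (rule num_orbits_semiconj)
      show "inj_on ?\<phi> (?E \<times> UNIV)" by (auto simp: inj_on_def)
      show "face_step (?\<rho>, ?T) ` (?E \<times> UNIV) \<subseteq> ?E \<times> UNIV" by (rule face_step_image_subset[OF perm\<rho>])
      fix z :: "'e edge_end \<times> bool" assume "z \<in> ?E \<times> UNIV"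
      then obtain g s where z: "z = (g, s)" and g: "g \<in> ?E" by auto
      define k where "k = opposite g"
      have k: "k \<in> ?E" using g by (simp add: k_def)
      have "inv ?\<rho> k \<in> ?E" using k inv_rotation_in_edge_ends[OF \<rho>] by simp
      then have "\<tau> (lift_end i (inv ?\<rho> k)) = lift_end i k"
        using \<tau>_lift[OF i] bij_inv_apply(2)[OF perm\<rho>(1)] by simp
      then have inv: "inv \<tau> (lift_end i k) = lift_end i (inv ?\<rho> k)"
        by (rule inv_f_eq[OF bij_is_inj[OF bij]])
      have "fst g \<in> ?T \<longleftrightarrow> Inl (i, fst g) \<in> T"
        using g by (auto simp: restrict_twist_def edge_ends_def)
      then show "?f (?\<phi> z) = ?\<phi> (face_step (?\<rho>, ?T) z)"
        using inv \<tau>_lift[OF i k] by (simp add: z face_step_apply k_def)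
    qed
    moreover have "?\<phi> ` (?E \<times> UNIV) = lift_end i ` ?E \<times> UNIV" by force
    ultimately show "num_orbits ?f (lift_end i ` ?E \<times> UNIV) = 2 * face_classes ?E (?\<rho>, ?T)"
      using num_orbits_face_step[OF perm\<rho>, of ?T] by simp
  qed
  finally have "num_orbits ?f (edge_ends H \<times> UNIV) =
    2 * ((\<Sum>i=1..n. face_classes (edge_ends (G i)) (restrict_rotation i \<sigma>, restrict_twist i T)) + n)"
    by (simp add: sum_distrib_left)
  moreover have "num_orbits ?f (edge_ends H \<times> UNIV) = 2 * face_classes (edge_ends H) (\<tau>, T)"
    by (rule num_orbits_face_step[OF bij R.fin _ R.opp]) (use permutes_in_image[OF perm] in auto)
  ultimately have "face_classes (edge_ends H) (\<tau>, T) =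
    (\<Sum>i=1..n. face_classes (edge_ends (G i)) (restrict_rotation i \<sigma>, restrict_twist i T)) + n"
    by simp
  then show ?thesis using R.face_classes_ring[of T] by (simp add: \<tau>_def)
qed

section \<open>The random rotation system of the ring as a product\<close>

definition glue ::
  "(nat \<Rightarrow> 'e edge_end \<Rightarrow> 'e edge_end) \<Rightarrow> ((nat \<times> 'e) + nat) edge_end \<Rightarrow> ((nat \<times> 'e) + nat) edge_end" where
  "glue \<rho> h = (if h \<notin> edge_ends H then h else
     case fst h of
       Inl (i, e) \<Rightarrow> (if unlift_end h = u_end i then bar_end (prev_index i) True else if unlift_end h = v_end i then bar_end i False
         else lift_end i (\<rho> i (unlift_end h)))
     | Inr i \<Rightarrow> (if snd h then lift_end (next_index i) (u_end (next_index i)) else lift_end i (v_end i)))"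

lemma glue_simps:
  assumes i: "i \<in> {1..n}"
  shows "glue \<rho> (lift_end i (u_end i)) = bar_end (prev_index i) True" "glue \<rho> (lift_end i (v_end i)) = bar_end i False"
    "g \<in> edge_ends (G i) \<Longrightarrow> g \<noteq> u_end i \<Longrightarrow> g \<noteq> v_end i \<Longrightarrow> glue \<rho> (lift_end i g) = lift_end i (\<rho> i g)"
    "glue \<rho> (bar_end i True) = lift_end (next_index i) (u_end (next_index i))" "glue \<rho> (bar_end i False) = lift_end i (v_end i)"
  using i marked_ends[OF i] by (auto simp: glue_def) (auto simp: bar_end_def)

lemma glue_in:
  assumes \<rho>: "\<And>i. i \<in> {1..n} \<Longrightarrow> \<rho> i \<in> rotation_systems (G i)"
  shows "glue \<rho> \<in> rotation_systems H"
proof (rule rotation_systemsI[OF fin_digraph_ring])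
  fix z assume z: "z \<in> verts H" "ends_at H z \<noteq> {}"
  then obtain i x where zx: "z = (i, x)" and i: "i \<in> {1..n}" and x: "x \<in> verts (G i)"
    by (cases z) (auto simp: in_verts_ring)
  consider "x = u i" | "x = v i" | "x \<noteq> u i" "x \<noteq> v i" by blast
  then show "cyclic_on (glue \<rho>) (ends_at H z)"
  proof cases
    case 1
    then show ?thesis
      using glue_simps[OF i] glue_simps(4)[OF index_shift(2)[OF i]] index_shift(3)[OF i]
      by (simp add: zx ends_at_ring_cases[OF i] cyclic_on_doubleton_iff)
  next
    case 2
    then show ?thesis
      using glue_simps[OF i] by (simp add: zx ends_at_ring_cases[OF i] cyclic_on_doubleton_iff)
  next
    case 3
    have eq: "ends_at H z = lift_end i ` ends_at (G i) x" unfolding zx by (rule ends_at_ring_cases(3)[OF i 3])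
    have "cyclic_on (\<rho> i) (ends_at (G i) x)"
      by (rule rotation_systemsD(4)[OF \<rho>[OF i] x]) (use z eq in auto)
    then have "cyclic_on (glue \<rho>) (lift_end i ` ends_at (G i) x)"
    proof (rule cyclic_on_image)
      fix g assume "g \<in> ends_at (G i) x"
      then have g: "g \<in> edge_ends (G i)" "end_vertex (G i) g = x" by (auto simp: ends_at_def)
      then show "glue \<rho> (lift_end i g) = lift_end i (\<rho> i g)"
        using marked_end_iff[OF i g(1)] 3 by (intro glue_simps(3)[OF i]) auto
    qed
    then show ?thesis by (simp add: eq)
  qed
qed (simp add: glue_def)

lemma restrict_glue:
  assumes \<rho>: "\<rho> i \<in> rotation_systems (G i)" and i: "i \<in> {1..n}"
  shows "restrict_rotation i (glue \<rho>) = \<rho> i"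
proof
  fix g
  have "\<rho> i (u_end i) = u_end i" "\<rho> i (v_end i) = v_end i"
    using rotation_systemsD(4)[OF \<rho>, of "u i"] rotation_systemsD(4)[OF \<rho>, of "v i"] marked[OF i]
    by (auto simp: ends_at_marked[OF i] cyclic_on_singleton_iff pendant_def)
  then show "restrict_rotation i (glue \<rho>) g = \<rho> i g"
    using rotation_systemsD(1)[OF \<rho>] glue_simps(3)[OF i, of g \<rho>]
    by (auto simp: restrict_rotation_def permutes_not_in)
qed

text \<open>What the restrictions do not record are the values at the joints, and those are
  forced.\<close>

lemma restrict_rotation_inj:
  assumes \<sigma>: "\<sigma> \<in> rotation_systems H" "\<sigma>' \<in> rotation_systems H"
    and eq: "\<And>i. i \<in> {1..n} \<Longrightarrow> restrict_rotation i \<sigma> = restrict_rotation i \<sigma>'"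
  shows "\<sigma> = \<sigma>'"
proof
  fix h
  show "\<sigma> h = \<sigma>' h"
  proof (cases "h \<in> edge_ends H")
    case False
    then show ?thesis
      using rotation_systemsD(1)[OF \<sigma>(1)] rotation_systemsD(1)[OF \<sigma>(2)] by (simp add: permutes_not_in)
  next
    case True
    show ?thesis
    proof (cases h rule: edge_end_cases)
      case (1 i g)
      then have i: "i \<in> {1..n}" and g: "g \<in> edge_ends (G i)" using True by auto
      show ?thesis
        using rotation_at_marked[OF \<sigma>(1) i] rotation_at_marked[OF \<sigma>(2) i]
          rotation_lift(1)[OF \<sigma>(1) i g] rotation_lift(1)[OF \<sigma>(2) i g] eq[OF i]
        by (cases "g = u_end i"; cases "g = v_end i") (simp_all add: 1)
    next
      case (2 i b)
      then have i: "i \<in> {1..n}" using True by auto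
      show ?thesis
        using rotation_at_marked[OF \<sigma>(1) i] rotation_at_marked[OF \<sigma>(2) i]
          rotation_at_marked[OF \<sigma>(1) index_shift(1)[OF i]] rotation_at_marked[OF \<sigma>(2) index_shift(1)[OF i]]
          index_shift(4)[OF i]
        by (cases b) (simp_all add: 2)
    qed
  qed
qed

text \<open>The value \<open>id\<close> outside \<open>{1..n}\<close> is the default that the
  product distribution \<open>Pi_pmf\<close> takes there.\<close>

definition pieces_rotation ::
  "(((nat \<times> 'e) + nat) edge_end \<Rightarrow> ((nat \<times> 'e) + nat) edge_end) \<Rightarrow> nat \<Rightarrow> 'e edge_end \<Rightarrow> 'e edge_end" where
  "pieces_rotation \<sigma> i = (if i \<in> {1..n} then restrict_rotation i \<sigma> else id)"

definition pieces_signed :: "((nat \<times> 'e) + nat) signed_rotation \<Rightarrow> nat \<Rightarrow> 'e signed_rotation" where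
  "pieces_signed X i =
     (if i \<in> {1..n} then (restrict_rotation i (fst X), restrict_twist i (snd X)) else (id, {}))"

text \<open>Restriction is a bijection onto the tuples of rotation systems, with \<open>glue\<close>
  as its inverse, and the uniform distribution on a product set is the product of the uniform
  ones.\<close>

lemma map_pmf_pieces_rotation:
  "map_pmf pieces_rotation (pmf_of_set (rotation_systems H)) =
    Pi_pmf {1..n} id (\<lambda>i. pmf_of_set (rotation_systems (G i)))"
proof -
  have "inj_on pieces_rotation (rotation_systems H)"
  proof (rule inj_onI)
    fix \<sigma> \<sigma>' assume \<sigma>: "\<sigma> \<in> rotation_systems H" "\<sigma>' \<in> rotation_systems H"
      and eq: "pieces_rotation \<sigma> = pieces_rotation \<sigma>'"
    show "\<sigma> = \<sigma>'"
    proof (rule restrict_rotation_inj[OF \<sigma>])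
      fix i assume "i \<in> {1..n}"
      then show "restrict_rotation i \<sigma> = restrict_rotation i \<sigma>'"
        using fun_cong[OF eq, of i] by (simp add: pieces_rotation_def)
    qed
  qed
  then have "map_pmf pieces_rotation (pmf_of_set (rotation_systems H)) =
    pmf_of_set (pieces_rotation ` rotation_systems H)"
    by (rule map_pmf_of_set_inj)
      (auto simp: rotation_systems_nonempty finite_rotation_systems fin_digraph_ring)
  also have "pieces_rotation ` rotation_systems H = PiE_dflt {1..n} id (\<lambda>i. rotation_systems (G i))"
  proof (intro equalityI subsetI)
    fix \<rho> assume "\<rho> \<in> pieces_rotation ` rotation_systems H"
    then show "\<rho> \<in> PiE_dflt {1..n} id (\<lambda>i. rotation_systems (G i))"
      by (auto simp: PiE_dflt_def pieces_rotation_def intro!: restrict_rotation_in)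
  next
    fix \<rho> assume \<rho>: "\<rho> \<in> PiE_dflt {1..n} id (\<lambda>i. rotation_systems (G i))"
    then have \<rho>i: "\<rho> i \<in> rotation_systems (G i)" if "i \<in> {1..n}" for i
      using that by (simp add: PiE_dflt_def)
    have "pieces_rotation (glue \<rho>) = \<rho>"
      using \<rho> restrict_glue[of \<rho>, OF \<rho>i] by (auto simp: fun_eq_iff pieces_rotation_def PiE_dflt_def)
    then show "\<rho> \<in> pieces_rotation ` rotation_systems H"
      using glue_in[of \<rho>, OF \<rho>i] by (metis imageI)
  qed
  also have "pmf_of_set \<dots> = Pi_pmf {1..n} id (\<lambda>i. pmf_of_set (rotation_systems (G i)))"
    by (rule Pi_pmf_of_set[symmetric])
      (use graphs rotation_systems_nonempty finite_rotation_systems in auto)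
  finally show ?thesis .
qed

lemma arcs_ring: "arcs H = (SIGMA i:{1..n}. arcs (G i)) <+> {1..n}"
  by (simp add: bar_ring_def)

text \<open>Restriction is no longer injective, since it forgets which bars are twisted. These
  twists are free, so all fibers have the size of \<open>Pow {1..n}\<close> and the image
  distribution is still uniform.\<close>

lemma map_pmf_pieces_signed:
  "map_pmf pieces_signed (pmf_of_set (signed_rotation_systems H)) =
    Pi_pmf {1..n} (id, {}) (\<lambda>i. pmf_of_set (signed_rotation_systems (G i)))"
proof -
  let ?B = "PiE_dflt {1..n} (id, {}) (\<lambda>i. signed_rotation_systems (G i))"
  define T :: "(nat \<Rightarrow> 'e signed_rotation) \<Rightarrow> ((nat \<times> 'e) + nat) set" where
    "T Y = {Inl (i, e) |i e. i \<in> {1..n} \<and> e \<in> snd (Y i)}" for Y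
  \<comment> \<open>\<open>B\<close> is the set of twisted bars, the only datum that the pieces do
    not record.\<close>
  define X where "X Y B = (glue (\<lambda>i. fst (Y i)), T Y \<union> Inr ` B)"
    for Y :: "nat \<Rightarrow> 'e signed_rotation" and B :: "nat set"
  have fiber: "{Z \<in> signed_rotation_systems H. pieces_signed Z = Y} = X Y ` Pow {1..n}"
    if Y: "Y \<in> ?B" for Y
  proof -
    have Yi: "fst (Y i) \<in> rotation_systems (G i)" "snd (Y i) \<subseteq> arcs (G i)" if "i \<in> {1..n}" for i
      using Y that by (auto simp: PiE_dflt_def signed_rotation_systems_def mem_Times_iff)
    have gl: "glue (\<lambda>i. fst (Y i)) \<in> rotation_systems H" by (rule glue_in) (rule Yi(1))
    have re: "restrict_rotation i (glue (\<lambda>i. fst (Y i))) = fst (Y i)" if "i \<in> {1..n}" for i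
      using restrict_glue[of "\<lambda>i. fst (Y i)" i] Yi(1)[OF that] that by simp
    show ?thesis
    proof (intro equalityI subsetI)
      fix Z assume "Z \<in> {Z \<in> signed_rotation_systems H. pieces_signed Z = Y}"
      then have Z: "fst Z \<in> rotation_systems H" "snd Z \<subseteq> arcs H" "pieces_signed Z = Y"
        by (auto simp: signed_rotation_systems_def mem_Times_iff)
      have Yeq: "Y i = (restrict_rotation i (fst Z), restrict_twist i (snd Z))" if "i \<in> {1..n}" for i
        using fun_cong[OF Z(3), of i] that by (simp add: pieces_signed_def)
      have "fst Z = glue (\<lambda>i. fst (Y i))"
        by (rule restrict_rotation_inj[OF Z(1) gl]) (simp add: re Yeq)
      moreover have "snd Z = T Y \<union> Inr ` {i. Inr i \<in> snd Z}"
      proof (rule set_eqI)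
        fix e
        show "e \<in> snd Z \<longleftrightarrow> e \<in> T Y \<union> Inr ` {i. Inr i \<in> snd Z}"
        proof (cases e)
          case (Inl y)
          then show ?thesis using Z(2)
            by (cases y) (auto simp: T_def Yeq restrict_twist_def arcs_ring)
        next
          case (Inr i)
          then show ?thesis by (auto simp: T_def)
        qed
      qed
      ultimately have "Z = X Y {i. Inr i \<in> snd Z}" by (simp add: X_def prod_eq_iff)
      moreover have "{i. Inr i \<in> snd Z} \<in> Pow {1..n}" using Z(2) by (auto simp: arcs_ring)
      ultimately show "Z \<in> X Y ` Pow {1..n}" by blast
    next
      fix Z assume "Z \<in> X Y ` Pow {1..n}"
      then obtain B where B: "B \<subseteq> {1..n}" "Z = X Y B" by auto
      have "T Y \<union> Inr ` B \<subseteq> arcs H" using B(1) Yi(2) by (auto simp: T_def arcs_ring)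
      then have "Z \<in> signed_rotation_systems H"
        using gl by (simp add: B(2) X_def signed_rotation_systems_def)
      moreover have "pieces_signed Z = Y"
      proof
        fix i
        show "pieces_signed Z i = Y i"
        proof (cases "i \<in> {1..n}")
          case True
          have "restrict_twist i (T Y \<union> Inr ` B) = snd (Y i)"
            using Yi(2)[OF True] True by (auto simp: restrict_twist_def T_def)
          then show ?thesis using True re[OF True] by (simp add: pieces_signed_def B(2) X_def)
        next
          case False
          then show ?thesis using Y by (auto simp: pieces_signed_def PiE_dflt_def)
        qed
      qed
      ultimately show "Z \<in> {Z \<in> signed_rotation_systems H. pieces_signed Z = Y}" by simp
    qed
  qed
  have img: "pieces_signed ` signed_rotation_systems H = ?B"
  proof (intro equalityI subsetI)
    fix Y assume "Y \<in> pieces_signed ` signed_rotation_systems H"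
    then show "Y \<in> ?B"
      by (auto simp: PiE_dflt_def pieces_signed_def signed_rotation_systems_def restrict_twist_def
          intro!: restrict_rotation_in)
  next
    fix Y assume "Y \<in> ?B"
    then have "X Y {} \<in> {Z \<in> signed_rotation_systems H. pieces_signed Z = Y}"
      by (simp only: fiber) blast
    then have "Y = pieces_signed (X Y {})" "X Y {} \<in> signed_rotation_systems H" by simp_all
    then show "Y \<in> pieces_signed ` signed_rotation_systems H" by (rule image_eqI)
  qed
  have "map_pmf pieces_signed (pmf_of_set (signed_rotation_systems H)) =
    pmf_of_set (pieces_signed ` signed_rotation_systems H)"
  proof (rule map_pmf_of_set_equal_fibers)
    fix Y assume "Y \<in> pieces_signed ` signed_rotation_systems H"
    then have Y: "Y \<in> ?B" by (simp only: img)
    have "inj_on (X Y) (Pow {1..n})" by (rule inj_onI) (auto simp: X_def T_def)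
    then show "card {Z \<in> signed_rotation_systems H. pieces_signed Z = Y} = card (Pow {1..n})"
      by (simp only: fiber[OF Y] card_image)
  qed (auto simp: finite_signed_rotation_systems signed_rotation_systems_nonempty fin_digraph_ring)
  also have "\<dots> = Pi_pmf {1..n} (id, {}) (\<lambda>i. pmf_of_set (signed_rotation_systems (G i)))"
    unfolding img
    by (rule Pi_pmf_of_set[symmetric])
      (use graphs signed_rotation_systems_nonempty finite_signed_rotation_systems in auto)
  finally show ?thesis .
qed

end

section \<open>The genus of the ring as a constant plus a perturbed sum\<close>

context bar_ring_pieces
begin

text \<open>Euler's formula with the face count replaced by its approximation, apart from the faces
  of the pieces: the 2 of the formula loses the 1 of \<open>- int n + 1\<close>, and
  \<open>int n\<close> enters with a plus sign.\<close>

definition genus_offset :: int where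
  "genus_offset = 1 + int n - int (card (verts H)) + int (card (arcs H)) - int (card (isolated_verts H))"

lemma signed_euler_genus_ring:
  assumes n: "n \<ge> 1" and X: "X \<in> signed_rotation_systems H"
  shows "\<bar>signed_euler_genus H X - real_of_int genus_offset -
    (\<Sum>i=1..n. - real (face_classes (edge_ends (G i)) (pieces_signed X i)))\<bar> \<le> 1"
proof -
  obtain \<sigma> T where XE: "X = (\<sigma>, T)" by (cases X)
  then have \<sigma>: "\<sigma> \<in> rotation_systems H" using X by (simp add: signed_rotation_systems_def)
  define s where "s = (\<Sum>i=1..n. int (face_classes (edge_ends (G i)) (restrict_rotation i \<sigma>, restrict_twist i T)))"
  have "\<bar>int (face_classes (edge_ends H) (\<sigma>, T)) - (s - int n + 1)\<bar> \<le> 1"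
    unfolding s_def by (rule face_classes_bar_ring[OF n \<sigma>])
  then have "\<bar>euler_genus_of_faces H (signed_num_faces H X) - genus_offset + s\<bar> \<le> 1"
    unfolding genus_offset_def euler_genus_of_faces_def signed_num_faces_eq XE by linarith
  then have "\<bar>signed_euler_genus H X - real_of_int genus_offset + real_of_int s\<bar> \<le> 1"
    unfolding signed_euler_genus_def by linarith
  moreover have "(\<Sum>i=1..n. - real (face_classes (edge_ends (G i)) (pieces_signed X i))) = - real_of_int s"
    unfolding s_def sum_negf by (simp add: pieces_signed_def XE)
  ultimately show ?thesis by simp
qed

lemma genus_ring:
  assumes n: "n \<ge> 1" and \<sigma>: "\<sigma> \<in> rotation_systems H"
  shows "\<bar>genus H \<sigma> - real_of_int genus_offset / 2 -
    (\<Sum>i=1..n. - real (face_classes (edge_ends (G i)) (pieces_rotation \<sigma> i, {})) / 2)\<bar> \<le> 1"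
proof -
  define s where "s = (\<Sum>i=1..n. int (face_classes (edge_ends (G i)) (restrict_rotation i \<sigma>, {})))"
  have "restrict_twist i {} = {}" for i by (simp add: restrict_twist_def)
  then have "\<bar>int (face_classes (edge_ends H) (\<sigma>, {})) - (s - int n + 1)\<bar> \<le> 1"
    using face_classes_bar_ring[OF n \<sigma>, of "{}"] by (simp add: s_def)
  then have "\<bar>euler_genus_of_faces H (num_faces H \<sigma>) - genus_offset + s\<bar> \<le> 1"
    unfolding genus_offset_def euler_genus_of_faces_def num_faces_eq_face_classes[OF fin_digraph_ring \<sigma>]
    by linarith
  then have "\<bar>genus H \<sigma> - real_of_int genus_offset / 2 + real_of_int s / 2\<bar> \<le> 1"
    unfolding genus_def by linarith
  moreover have "(\<Sum>i=1..n. - real (face_classes (edge_ends (G i)) (pieces_rotation \<sigma> i, {})) / 2) =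
    - real_of_int s / 2"
    unfolding s_def sum_divide_distrib[symmetric] sum_negf by (simp add: pieces_rotation_def)
  ultimately show ?thesis by simp
qed

end

text \<open>On a fixed graph the genus depends on the rotation system only through the number of
  faces, and distinct integers differ by at least one.\<close>

lemma exists_distinct_face_classes:
  assumes fin: "fin_digraph H" and gap: "max_genus H > min_genus H"
  obtains \<sigma> \<sigma>' where "\<sigma> \<in> rotation_systems H" "\<sigma>' \<in> rotation_systems H"
    "1 \<le> \<bar>real (face_classes (edge_ends H) (\<sigma>, {})) - real (face_classes (edge_ends H) (\<sigma>', {}))\<bar>"
proof -
  let ?S = "genus H ` rotation_systems H"
  have "finite ?S" "?S \<noteq> {}"
    using finite_rotation_systems[OF fin] rotation_systems_nonempty[OF fin] by auto
  then have "max_genus H \<in> ?S" "min_genus H \<in> ?S"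
    unfolding max_genus_def min_genus_def by (rule Max_in, rule Min_in)
  then obtain \<sigma> \<sigma>' where \<sigma>: "\<sigma> \<in> rotation_systems H" "\<sigma>' \<in> rotation_systems H"
    and "genus H \<sigma> \<noteq> genus H \<sigma>'" using gap by fastforce
  then have "face_classes (edge_ends H) (\<sigma>, {}) \<noteq> face_classes (edge_ends H) (\<sigma>', {})"
    by (auto simp: genus_def num_faces_eq_face_classes[OF fin])
  then have "1 \<le> \<bar>real (face_classes (edge_ends H) (\<sigma>, {})) - real (face_classes (edge_ends H) (\<sigma>', {}))\<bar>"
    by linarith
  with \<sigma> show thesis by (rule that)
qed

theorem theorem4p7:
  fixes G :: "nat \<Rightarrow> ('v, 'e) pre_digraph" and u v :: "nat \<Rightarrow> 'v" and M :: nat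
  assumes graphs: "\<And>i. i \<ge> 1 \<Longrightarrow> fin_digraph (G i)"
    and marked: "\<And>i. i \<ge> 1 \<Longrightarrow> pendant (G i) (u i) \<and> pendant (G i) (v i) \<and> u i \<noteq> v i"
    and connected: "\<And>i. i \<ge> 1 \<Longrightarrow> Digraph_Component.connected (G i)"
    and genus_gap: "infinite {i. i \<ge> 1 \<and> max_genus (G i) > min_genus (G i)}"
    and bounded: "\<And>i. i \<ge> 1 \<Longrightarrow> card (arcs (G i)) \<le> M"
  shows "asymptotically_normal
           (\<lambda>n. pmf_of_set (rotation_systems (bar_ring G u v n)))
           (\<lambda>n. genus (bar_ring G u v n))
       \<and> asymptotically_normal
           (\<lambda>n. pmf_of_set (general_embeddings (bar_ring G u v n)))
           (\<lambda>n. euler_genus (bar_ring G u v n))"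
proof
  have ring: "bar_ring_pieces G u v n" for n
    by (rule bar_ring_pieces.intro) (use graphs marked in auto)
  \<comment> \<open>Bounds the number of signed rotation systems of every \<open>G i\<close>:
    permutations of at most \<open>2 * M\<close> edge-ends, times the sets of twisted edges.\<close>
  define N :: nat where "N = fact (2 * M) * 2 ^ M"
  have N: "N > 0" by (simp add: N_def)
  \<comment> \<open>Each edge has two ends and each end two tracer states, so there are at most
    \<open>4 * M\<close> states.\<close>
  have fc_le: "real (face_classes (edge_ends (G i)) X) \<le> 4 * real M" if i: "i \<ge> 1" for i X
  proof -
    have "face_classes (edge_ends (G i)) X \<le> 4 * M"
      using face_classes_le[OF finite_edge_ends[OF graphs[OF i]], of X] bounded[OF i]
      by (simp add: card_edge_ends)
    then show ?thesis by (metis of_nat_le_iff of_nat_mult of_nat_numeral)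
  qed
  have card_RS: "card (rotation_systems (G i)) \<le> fact (2 * M)" if i: "i \<ge> 1" for i
    using card_rotation_systems_le[OF graphs[OF i]] fact_mono_nat[of "2 * card (arcs (G i))" "2 * M"]
      bounded[OF i] by simp
  have card_SRS: "card (signed_rotation_systems (G i)) \<le> N" if i: "i \<ge> 1" for i
  proof -
    have "card (signed_rotation_systems (G i)) = card (rotation_systems (G i)) * 2 ^ card (arcs (G i))"
      using fin_digraph.finite_arcs[OF graphs[OF i]]
      by (simp add: signed_rotation_systems_def card_cartesian_product card_Pow)
    also have "\<dots> \<le> N"
      unfolding N_def using card_RS[OF i] bounded[OF i] by (intro mult_mono power_increasing) auto
    finally show ?thesis .
  qed
  \<comment> \<open>More faces mean smaller genus, hence the sign; the factor one half is that
    between genus and Euler-genus. Nothing is assumed about \<open>G 0\<close>, and the value 0 at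
    index 0 makes the bound hold for all indices.\<close>
  define Y where "Y i \<rho> = (if i \<ge> 1 then - real (face_classes (edge_ends (G i)) (\<rho>, {})) / 2 else 0)"
    for i and \<rho> :: "'e edge_end \<Rightarrow> 'e edge_end"
  show "asymptotically_normal (\<lambda>n. pmf_of_set (rotation_systems (bar_ring G u v n)))
    (\<lambda>n. genus (bar_ring G u v n))"
  proof (rule asymptotically_normal_perturbed_product[where Y = Y and K = "4 * real M" and C = 1
        and d = id and \<delta> = "(1 / 2)\<^sup>2 / (4 * real N)"
        and A = "\<lambda>n. real_of_int (bar_ring_pieces.genus_offset G u v n) / 2"
        and q = "\<lambda>i. pmf_of_set (rotation_systems (G i))"
        and r = "bar_ring_pieces.pieces_rotation G u v"])
    fix n :: nat
    show "map_pmf (bar_ring_pieces.pieces_rotation G u v n) (pmf_of_set (rotation_systems (bar_ring G u v n))) =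
      Pi_pmf {1..n} id (\<lambda>i. pmf_of_set (rotation_systems (G i)))"
      by (rule bar_ring_pieces.map_pmf_pieces_rotation[OF ring])
  next
    show "\<bar>Y i \<rho>\<bar> \<le> 4 * real M" for i \<rho>
      using fc_le[of i "(\<rho>, {})"] by (auto simp: Y_def)
  next
    show "0 < (1 / 2)\<^sup>2 / (4 * real N)" using N by simp
  next
    show "infinite {i. 1 \<le> i \<and>
      (1 / 2)\<^sup>2 / (4 * real N) \<le> measure_pmf.variance (pmf_of_set (rotation_systems (G i))) (Y i)}"
    proof (rule infinite_super[OF _ genus_gap], safe)
      fix i :: nat assume i: "1 \<le> i" and gap: "min_genus (G i) < max_genus (G i)"
      obtain \<sigma> \<sigma>' where \<sigma>: "\<sigma> \<in> rotation_systems (G i)" "\<sigma>' \<in> rotation_systems (G i)"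
        "1 \<le> \<bar>real (face_classes (edge_ends (G i)) (\<sigma>, {})) - real (face_classes (edge_ends (G i)) (\<sigma>', {}))\<bar>"
        by (rule exists_distinct_face_classes[OF graphs[OF i] gap])
      have "Y i \<sigma> - Y i \<sigma>' =
          - ((real (face_classes (edge_ends (G i)) (\<sigma>, {})) - real (face_classes (edge_ends (G i)) (\<sigma>', {}))) / 2)"
        using i by (simp add: Y_def diff_divide_distrib)
      then have "\<bar>Y i \<sigma> - Y i \<sigma>'\<bar> =
          \<bar>real (face_classes (edge_ends (G i)) (\<sigma>, {})) - real (face_classes (edge_ends (G i)) (\<sigma>', {}))\<bar> / 2"
        by (simp only: abs_minus_cancel abs_divide abs_numeral)
      \<comment> \<open>Face counts that differ by at least one contribute a gap of one half to the
        genus; this is the origin of \<open>1 / 2\<close> in the choice of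
        \<open>\<delta>\<close>.\<close>
      then have d: "1 / 2 \<le> \<bar>Y i \<sigma> - Y i \<sigma>'\<bar>" using \<sigma>(3) by simp
      have N': "card (rotation_systems (G i)) \<le> N"
        using card_RS[OF i] by (simp add: N_def)
          (metis mult_le_mono2 mult.right_neutral one_le_numeral one_le_power order_trans)
      show "(1 / 2)\<^sup>2 / (4 * real N) \<le> measure_pmf.variance (pmf_of_set (rotation_systems (G i))) (Y i)"
        by (rule variance_pmf_of_set_ge[where Y = "Y i", OF finite_rotation_systems[OF graphs[OF i]] N' \<sigma>(1,2) d]) simp
    qed
  next
    fix n :: nat and \<sigma>
    assume n: "1 \<le> n" and "\<sigma> \<in> set_pmf (pmf_of_set (rotation_systems (bar_ring G u v n)))"
    then have \<sigma>: "\<sigma> \<in> rotation_systems (bar_ring G u v n)"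
      using bar_ring_pieces.fin_digraph_ring[OF ring]
      by (simp add: rotation_systems_nonempty finite_rotation_systems)
    show "\<bar>genus (bar_ring G u v n) \<sigma> - real_of_int (bar_ring_pieces.genus_offset G u v n) / 2 -
      (\<Sum>i=1..n. Y i (bar_ring_pieces.pieces_rotation G u v n \<sigma> i))\<bar> \<le> 1"
      using bar_ring_pieces.genus_ring[OF ring n \<sigma>] by (simp add: Y_def)
  qed
  define Z where "Z i X = (if i \<ge> 1 then - real (face_classes (edge_ends (G i)) X) else 0)"
    for i and X :: "'e signed_rotation"
  have signed: "asymptotically_normal (\<lambda>n. pmf_of_set (signed_rotation_systems (bar_ring G u v n)))
    (\<lambda>n. signed_euler_genus (bar_ring G u v n))"
  proof (rule asymptotically_normal_perturbed_product[where Y = Z and K = "4 * real M" and C = 1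
        and d = "(id, {})" and \<delta> = "1\<^sup>2 / (4 * real N)"
        and A = "\<lambda>n. real_of_int (bar_ring_pieces.genus_offset G u v n)"
        and q = "\<lambda>i. pmf_of_set (signed_rotation_systems (G i))"
        and r = "bar_ring_pieces.pieces_signed G u v"])
    fix n :: nat
    show "map_pmf (bar_ring_pieces.pieces_signed G u v n) (pmf_of_set (signed_rotation_systems (bar_ring G u v n))) =
      Pi_pmf {1..n} (id, {}) (\<lambda>i. pmf_of_set (signed_rotation_systems (G i)))"
      by (rule bar_ring_pieces.map_pmf_pieces_signed[OF ring])
  next
    show "\<bar>Z i X\<bar> \<le> 4 * real M" for i X
      using fc_le[of i X] by (auto simp: Z_def)
  next
    show "0 < 1\<^sup>2 / (4 * real N)" using N by simp
  next
    show "infinite {i. 1 \<le> i \<and>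
      1\<^sup>2 / (4 * real N) \<le> measure_pmf.variance (pmf_of_set (signed_rotation_systems (G i))) (Z i)}"
    proof (rule infinite_super[OF _ genus_gap], safe)
      fix i :: nat assume i: "1 \<le> i" and gap: "min_genus (G i) < max_genus (G i)"
      obtain \<sigma> \<sigma>' where \<sigma>: "\<sigma> \<in> rotation_systems (G i)" "\<sigma>' \<in> rotation_systems (G i)"
        "1 \<le> \<bar>real (face_classes (edge_ends (G i)) (\<sigma>, {})) - real (face_classes (edge_ends (G i)) (\<sigma>', {}))\<bar>"
        by (rule exists_distinct_face_classes[OF graphs[OF i] gap])
      \<comment> \<open>The genus gap of orientable embeddings serves the general case as well: the
        two rotation systems without twisted edges are signed rotation systems with different face
        counts.\<close>
      have X: "(\<sigma>, {}) \<in> signed_rotation_systems (G i)" "(\<sigma>', {}) \<in> signed_rotation_systems (G i)"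
        using \<sigma> by (auto simp: signed_rotation_systems_def)
      have d: "1 \<le> \<bar>Z i (\<sigma>, {}) - Z i (\<sigma>', {})\<bar>" 
        using \<sigma>(3) i by (simp add: Z_def abs_minus_commute)
      show "1\<^sup>2 / (4 * real N) \<le> measure_pmf.variance (pmf_of_set (signed_rotation_systems (G i))) (Z i)"
        by (rule variance_pmf_of_set_ge[where Y = "Z i", OF finite_signed_rotation_systems[OF graphs[OF i]]
              card_SRS[OF i] X d]) simp
    qed
  next
    fix n :: nat and X
    assume n: "1 \<le> n" and "X \<in> set_pmf (pmf_of_set (signed_rotation_systems (bar_ring G u v n)))"
    then have X: "X \<in> signed_rotation_systems (bar_ring G u v n)"
      using bar_ring_pieces.fin_digraph_ring[OF ring]
      by (simp add: signed_rotation_systems_nonempty finite_signed_rotation_systems)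
    show "\<bar>signed_euler_genus (bar_ring G u v n) X - real_of_int (bar_ring_pieces.genus_offset G u v n) -
      (\<Sum>i=1..n. Z i (bar_ring_pieces.pieces_signed G u v n X i))\<bar> \<le> 1"
      using bar_ring_pieces.signed_euler_genus_ring[OF ring n X] by (simp add: Z_def)
  qed
  have fin: "fin_digraph (bar_ring G u v n)" for n by (rule bar_ring_pieces.fin_digraph_ring[OF ring])
  show "asymptotically_normal (\<lambda>n. pmf_of_set (general_embeddings (bar_ring G u v n)))
    (\<lambda>n. euler_genus (bar_ring G u v n))"
    unfolding map_pmf_switch_class[OF fin, symmetric]
  proof (rule asymptotically_normal_map_pmf[OF signed])
    fix n X assume "X \<in> set_pmf (pmf_of_set (signed_rotation_systems (bar_ring G u v n)))"
    then have "X \<in> signed_rotation_systems (bar_ring G u v n)"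
      using fin by (simp add: signed_rotation_systems_nonempty finite_signed_rotation_systems)
    then show "euler_genus (bar_ring G u v n) (switch_rel (bar_ring G u v n) `` {X}) =
      signed_euler_genus (bar_ring G u v n) X"
      by (rule euler_genus_class[OF fin])
  qed
qed

end
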